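(* There is an absolute constant $C>0$ such that for all $n\in\mathbb N$ and $0<\delta<1$: (General $K$) For every $K\subset\mathbb S^n$ and every integer $m\ge C\delta^{-2}H(K)^2$, there exists a map $\varphi:K\to\{-1,1\}^m$ that is a $\delta$-RIP from $(K,d)$ to $(\{-1,1\}^m,d_H)$. (Sparse vectors) For every integer $1\le s\le n+1$ and every integer $m\ge C\delta^{-2}s\log_+\frac ns$, if $\theta_1,\dots,\theta_m$ are i.i.d. uniform on $\mathbb S^n$, then with probability at least $1-\exp(-s\log_+\frac ns)$ the map $x\mapsto\operatorname{sgn}(Ax):=(\operatorname{sgn}\langle\theta_j,x\rangle)_{j=1}^m$ is a $\delta$-RIP from $(K_s,d)$ to $(\{-1,1\}^m,d_H)$.
   Context: $\mathbb S^n$ is the unit sphere in $\mathbb R^{n+1}$, with geodesic distance $d(x,y)=\cos^{-1}(\langle x,y\rangle)/\pi$. The normalized Hamming distance on $\{-1,1\}^m$ is $d_H(u,v)=\frac1m\#\{j:u_j\ne v_j\}$. A map $\varphi:(X,d_X)\to(Y,d_Y)$ is a $\delta$-RIP if $|d_X(x,x')-d_Y(\varphi(x),\varphi(x'))|<\delta$ for all $x,x'\in X$. $K_s:=\{x\in\mathbb S^n:\#\{j:x_j\neq0\}\le s\}$. $\log_+t:=\max\{1,\log t\}$. The hemisphere gaussian process $\{G_x:x\in\mathbb S^n\}$ is the mean-zero gaussian process with $\mathbb E G_x^2=\frac14$ and $\mathbb E(G_x-G_y)^2=d(x,y)$ (equivalently, covariance $\mathbb E G_xG_y=\frac14-\frac12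 d(x,y)$). The hemisphere mean width is $H(K):=\mathbb E\sup_{x,y\in K}(G_x-G_y)$ (the supremum understood as the supremum over finite subsets). *)

theory Defs
  imports "HOL-Probability.Probability"
begin

text \<open>Points of R^(n+1) are represented as functions nat => real vanishing
  outside the index set {..n}.\<close>

definition sinner :: "nat \<Rightarrow> (nat \<Rightarrow> real) \<Rightarrow> (nat \<Rightarrow> real) \<Rightarrow> real" where
  "sinner n x y = (\<Sum>i\<le>n. x i * y i)"

definition sphere_n :: "nat \<Rightarrow> (nat \<Rightarrow> real) set" where
  "sphere_n n = {x. (\<forall>i>n. x i = 0) \<and> sinner n x x = 1}"

definition sdist :: "nat \<Rightarrow> (nat \<Rightarrow> real) \<Rightarrow> (nat \<Rightarrow> real) \<Rightarrow> real" where
  "sdist n x y = arccos (sinner n x y) / pi"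

definition hamming :: "nat \<Rightarrow> (nat \<Rightarrow> real) \<Rightarrow> (nat \<Rightarrow> real) \<Rightarrow> real" where
  "hamming m u v = real (card {j. j < m \<and> u j \<noteq> v j}) / real m"

definition cube :: "nat \<Rightarrow> (nat \<Rightarrow> real) set" where
  "cube m = {u. \<forall>j<m. u j = -1 \<or> u j = 1}"

definition is_RIP :: "nat \<Rightarrow> nat \<Rightarrow> (nat \<Rightarrow> real) set \<Rightarrow> ((nat \<Rightarrow> real) \<Rightarrow> (nat \<Rightarrow> real)) \<Rightarrow> real \<Rightarrow> bool" where
  "is_RIP n m K \<phi> \<delta> \<longleftrightarrow> (\<forall>x\<in>K. \<phi> x \<in> cube m) \<and>
     (\<forall>x\<in>K. \<forall>x'\<in>K. \<bar>sdist n x x' - hamming m (\<phi> x) (\<phi> x')\<bar> < \<delta>)"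

definition sparse_sphere :: "nat \<Rightarrow> nat \<Rightarrow> (nat \<Rightarrow> real) set" where
  "sparse_sphere n s = {x \<in> sphere_n n. card {j. j \<le> n \<and> x j \<noteq> 0} \<le> s}"

definition log_plus :: "real \<Rightarrow> real" where
  "log_plus t = max 1 (ln t)"

text \<open>Sign with values in {-1,1} (the value at 0 is irrelevant: probability zero).\<close>
definition sgn1 :: "real \<Rightarrow> real" where
  "sgn1 t = (if t \<ge> 0 then 1 else -1)"

definition std_gauss :: "real measure" where
  "std_gauss = density lborel std_normal_density"

definition gauss_vec :: "nat \<Rightarrow> (nat \<Rightarrow> real) measure" where
  "gauss_vec k = PiM {..<k} (\<lambda>_. std_gauss)"

text \<open>Hemisphere mean width. For a finite nonempty F \<subseteq> K, the restriction of the
  hemisphere gaussian process to F is realised as G_x = <v x, Z> with Z a standard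
  gaussian vector in R^k and <v x, v y> = 1/4 - d(x,y)/2 (its covariance).
  H(K) is the supremum over finite subsets of E max_{x,y in F} (G_x - G_y).\<close>
definition hemi_width :: "nat \<Rightarrow> (nat \<Rightarrow> real) set \<Rightarrow> real" where
  "hemi_width n K = Sup {integral\<^sup>L (gauss_vec k)
        (\<lambda>z. Max ((\<lambda>(x, y). \<Sum>i<k. (v x i - v y i) * z i) ` (F \<times> F))) | F k v.
      finite F \<and> F \<noteq> {} \<and> F \<subseteq> K \<and>
      (\<forall>x\<in>F. \<forall>y\<in>F. (\<Sum>i<k. v x i * v y i) = 1/4 - sdist n x y / 2)}"

definition unif_sphere :: "nat \<Rightarrow> (nat \<Rightarrow> real) measure" where
  "unif_sphere n = distr (gauss_vec (Suc n)) (PiM UNIV (\<lambda>_. borel))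
     (\<lambda>g i. if i \<le> n then g i / sqrt (\<Sum>l\<le>n. (g l)\<^sup>2) else 0)"

definition iid_sphere :: "nat \<Rightarrow> nat \<Rightarrow> (nat \<Rightarrow> nat \<Rightarrow> real) measure" where
  "iid_sphere n m = PiM {..<m} (\<lambda>_. unif_sphere n)"

end

theory Submission
  imports Defs "HOL-Real_Asymp.Real_Asymp"
begin

text \<open>
A random hyperplane separates two points of the sphere with probability equal to their normalized
geodesic distance $d$, so the Hamming distance of the sign patterns is an empirical mean of $d$.

For general $K$ let $T$ be a maximal $\delta/4$-separated subset and $Z$ the largest deviation on
$T \times T$. Gaussian symmetrization bounds the mean of $Z$ by a conditionally Gaussian process
whose squared increments are empirical Hamming distances. By separation these are at most
$1 + 4 Z / \delta$ times the geodesic ones, so the Sudakov-Fernique inequality compares the process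
with the hemisphere process and gives the self-bounding estimate
$E Z \le C H(K) m^{-1/2} (1 + 4 E Z / \delta)$. Points of $K$ inherit the pattern of a nearby point of $T$.

For sparse vectors a Bernstein chaining over lattice nets runs down to the scale $\delta^2$, where
the entropy is still beaten by $m \delta^2$. Below this scale a sign flip between $x$ and its net
point $t$ forces a row to be almost orthogonal to $t$ or to have a large product with $x - t$; the former is rare
for all net points simultaneously and the latter is controlled by the operator norm of
the Gaussian matrix on sparse vectors.
\<close>

subsection \<open>Gaussian vectors\<close>

text \<open>Two obstacles shape the proof. \<open>hemi_width\<close> is a real-valued
  \<open>Sup\<close>, which is informative only for a bounded set, so finiteness of the width has to
  be proved before it can bound anything. And a supremum over \<open>K\<close> or over all sparse
  vectors is not visibly measurable. General sets are therefore treated on the finite space of sign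
  patterns of a separated net, where expectations are weighted sums; in the sparse case the RIP is
  deduced from finitely many conditions on nets. The chain for sparse vectors has mesh of order
  \<open>16 ^ -k\<close>. With deviation \<open>\<delta> / 8 * 2 ^ -k\<close> and variance
  \<open>8 ^ -k\<close> the best exponential parameter is \<open>\<delta> * 4 ^ k / 16\<close>, and
  the exponent is of order \<open>m * \<delta>^2 * 2 ^ k\<close>, which outgrows an entropy linear
  in \<open>k\<close>. The parameter may not exceed 1, so \<open>4 ^ k\<close> has to stop near
  \<open>1 / \<delta>\<close>: this is where the final scale \<open>\<delta>^2\<close> comes
  from.\<close>

lemma prob_space_std_gauss: "prob_space std_gauss"
  unfolding std_gauss_def by (rule prob_space_normal_density) simp

lemma sets_std_gauss [simp, measurable_cong]: "sets std_gauss = sets borel"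
  by (simp add: std_gauss_def)

lemma space_std_gauss [simp]: "space std_gauss = UNIV"
  by (simp add: std_gauss_def)

interpretation std_gauss: prob_space std_gauss
  by (rule prob_space_std_gauss)

interpretation std_gauss: pair_sigma_finite std_gauss std_gauss ..

interpretation gauss: product_prob_space "\<lambda>_::nat. std_gauss" I for I ..

lemma prob_space_gauss_vec: "prob_space (gauss_vec k)"
  unfolding gauss_vec_def by (intro prob_space_PiM prob_space_std_gauss)

interpretation gauss_vec: prob_space "gauss_vec k" for k
  by (rule prob_space_gauss_vec)

lemma sets_gauss_vec [simp, measurable_cong]:
  "sets (gauss_vec k) = sets (PiM {..<k} (\<lambda>_. borel))"
  unfolding gauss_vec_def by (intro sets_PiM_cong) auto

lemma nn_integral_std_gauss:
  assumes [measurable]: "f \<in> borel_measurable borel"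
  shows "(\<integral>\<^sup>+x. f x \<partial>std_gauss) = (\<integral>\<^sup>+x. ennreal (std_normal_density x) * f x \<partial>lborel)"
  unfolding std_gauss_def by (subst nn_integral_density) auto

lemma integral_std_gauss:
  fixes f :: "real \<Rightarrow> real"
  assumes [measurable]: "f \<in> borel_measurable borel"
  shows "(\<integral>x. f x \<partial>std_gauss) = (\<integral>x. std_normal_density x * f x \<partial>lborel)"
  unfolding std_gauss_def by (subst integral_density) auto

lemma integrable_std_gauss:
  fixes f :: "real \<Rightarrow> real"
  assumes [measurable]: "f \<in> borel_measurable borel"
  shows "integrable std_gauss f \<longleftrightarrow> integrable lborel (\<lambda>x. std_normal_density x * f x)"
  unfolding std_gauss_def by (subst integrable_density) auto

lemma std_gauss_integrable_power [simp]: "integrable std_gauss (\<lambda>x. x ^ k)"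
  by (subst integrable_std_gauss) (auto intro: integrable_std_normal_moment)

lemma std_gauss_integrable_id [simp]: "integrable std_gauss (\<lambda>x. x)"
  using std_gauss_integrable_power[of 1] by simp

lemma std_gauss_abs: "integral\<^sup>L std_gauss abs = sqrt (2 / pi)"
  using integral_std_normal_moment_abs_odd[of 0] by (subst integral_std_gauss) auto

text \<open>Crude bounds suffice: the lower one costs a factor 2 in the symmetrization and excludes
  a degenerate increment in \<open>hemi_width_zero_imp\<close>, the upper one serves the lacunary
  series.\<close>

lemma std_gauss_abs_bounds:
  "1/2 \<le> integral\<^sup>L std_gauss abs" "integral\<^sup>L std_gauss abs \<le> 1"
proof -
  have "(1/2)\<^sup>2 \<le> 2 / pi" "2 / pi \<le> 1\<^sup>2"
    using pi_less_4 pi_gt3 by (auto simp: field_simps power2_eq_square)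
  then show "1/2 \<le> integral\<^sup>L std_gauss abs" "integral\<^sup>L std_gauss abs \<le> 1"
    unfolding std_gauss_abs by (intro real_le_rsqrt real_le_lsqrt; simp)+
qed

lemma nn_integral_std_gauss_uminus:
  assumes [measurable]: "f \<in> borel_measurable borel"
  shows "(\<integral>\<^sup>+x. f (- x) \<partial>std_gauss) = (\<integral>\<^sup>+x. f x \<partial>std_gauss)"
proof -
  have "(\<integral>\<^sup>+x. ennreal (std_normal_density x) * f x \<partial>lborel)
      = ennreal \<bar>-1\<bar> * (\<integral>\<^sup>+x. ennreal (std_normal_density (0 + (-1) * x)) * f (0 + (-1) * x) \<partial>lborel)"
    by (rule nn_integral_real_affine) auto
  then show ?thesis
    by (simp add: nn_integral_std_gauss std_normal_density_def)
qed

text \<open>For $c \neq 0$ the rotation is a composition of two one-dimensional affine substitutions.\<close>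

lemma nn_integral_gauss_rotate:
  fixes c s :: real and f :: "real \<Rightarrow> real \<Rightarrow> ennreal"
  assumes [measurable]: "(\<lambda>(u, v). f u v) \<in> borel_measurable (borel \<Otimes>\<^sub>M borel)"
    and cs: "c\<^sup>2 + s\<^sup>2 = 1"
  shows "(\<integral>\<^sup>+u. \<integral>\<^sup>+v. f (c * u + s * v) (c * v - s * u) \<partial>std_gauss \<partial>std_gauss)
       = (\<integral>\<^sup>+u. \<integral>\<^sup>+v. f u v \<partial>std_gauss \<partial>std_gauss)"
proof (cases "c = 0")
  case True
  \<comment> \<open>A quarter turn only exchanges the variables up to sign, so Fubini and the
    evenness of the density suffice.\<close>
  then have s: "s = 1 \<or> s = -1"
    using cs by (simp add: power2_eq_1_iff)
  have s1: "(\<integral>\<^sup>+x. g (s * x) \<partial>std_gauss) = (\<integral>\<^sup>+x. g x \<partial>std_gauss)"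
    "(\<integral>\<^sup>+x. g (- (s * x)) \<partial>std_gauss) = (\<integral>\<^sup>+x. g x \<partial>std_gauss)"
    if "g \<in> borel_measurable borel" for g
    using nn_integral_std_gauss_uminus[OF that] s by auto
  have "(\<integral>\<^sup>+u. \<integral>\<^sup>+v. f (s * v) (- (s * u)) \<partial>std_gauss \<partial>std_gauss)
      = (\<integral>\<^sup>+u. \<integral>\<^sup>+v. f v (- (s * u)) \<partial>std_gauss \<partial>std_gauss)"
    by (intro nn_integral_cong s1) measurable
  also have "\<dots> = (\<integral>\<^sup>+v. \<integral>\<^sup>+u. f v (- (s * u)) \<partial>std_gauss \<partial>std_gauss)"
    by (rule std_gauss.Fubini') measurable
  also have "\<dots> = (\<integral>\<^sup>+v. \<integral>\<^sup>+u. f v u \<partial>std_gauss \<partial>std_gauss)"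
    by (intro nn_integral_cong s1) measurable
  finally show ?thesis
    using True by simp
next
  case False
  define E where "E u v = ennreal (1 / (2 * pi) * exp (- (u\<^sup>2 + v\<^sup>2) / 2))" for u v :: real
  have [measurable]: "(\<lambda>(u, v). E u v) \<in> borel_measurable (borel \<Otimes>\<^sub>M borel)"
    unfolding E_def by measurable
  have E: "ennreal (std_normal_density u) * (ennreal (std_normal_density v) * z) = E u v * z" for u v z
    by (simp add: E_def std_normal_density_def ennreal_mult[symmetric] mult.assoc[symmetric]
        exp_add[symmetric] add_divide_distrib diff_divide_distrib real_sqrt_mult[symmetric])
  have dbl: "(\<integral>\<^sup>+u. \<integral>\<^sup>+v. g u v \<partial>std_gauss \<partial>std_gauss) = (\<integral>\<^sup>+u. \<integral>\<^sup>+v. E u v * g u v \<partial>lborel \<partial>lborel)"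
    if [measurable]: "(\<lambda>(u, v). g u v) \<in> borel_measurable (borel \<Otimes>\<^sub>M borel)" for g
  proof -
    have "(\<integral>\<^sup>+u. \<integral>\<^sup>+v. g u v \<partial>std_gauss \<partial>std_gauss)
      = (\<integral>\<^sup>+u. ennreal (std_normal_density u) * (\<integral>\<^sup>+v. ennreal (std_normal_density v) * g u v \<partial>lborel) \<partial>lborel)"
      by (simp add: nn_integral_std_gauss)
    then show ?thesis
      by (simp add: nn_integral_cmult[symmetric] E)
  qed
  have E_rot: "E (c * p - s * q) (s * p + c * q) = E p q" for p q
  proof -
    have "(c * p - s * q)\<^sup>2 + (s * p + c * q)\<^sup>2 = (c\<^sup>2 + s\<^sup>2) * (p\<^sup>2 + q\<^sup>2)"
      by (simp add: power2_eq_square algebra_simps)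
    then show ?thesis
      by (simp add: E_def cs)
  qed
  have cc: "c * c = 1 - s * s"
    using cs by (simp add: power2_eq_square)
  have u: "(p - s * (s * p + c * q)) / c = c * p - s * q" for p q
  proof -
    have "p - s * (s * p + c * q) = c * (c * p - s * q)"
      using cc by algebra
    then show ?thesis
      using False by simp
  qed
  have w: "c * (s * p + c * q) - s * (c * p - s * q) = q" for p q
    using cc by algebra
  have "(\<integral>\<^sup>+u. \<integral>\<^sup>+v. f (c * u + s * v) (c * v - s * u) \<partial>std_gauss \<partial>std_gauss)
      = (\<integral>\<^sup>+u. \<integral>\<^sup>+v. E u v * f (c * u + s * v) (c * v - s * u) \<partial>lborel \<partial>lborel)"
    by (rule dbl) measurable
  also have "\<dots> = (\<integral>\<^sup>+v. \<integral>\<^sup>+u. E u v * f (c * u + s * v) (c * v - s * u) \<partial>lborel \<partial>lborel)"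
    by (rule lborel_pair.Fubini') measurable
  also have "\<dots> = (\<integral>\<^sup>+v. ennreal \<bar>1 / c\<bar> *
      (\<integral>\<^sup>+p. E (- (s * v / c) + 1 / c * p) v * f (c * (- (s * v / c) + 1 / c * p) + s * v) (c * v - s * (- (s * v / c) + 1 / c * p)) \<partial>lborel) \<partial>lborel)"
    using False by (intro nn_integral_cong nn_integral_real_affine) measurable
  also have "\<dots> = (\<integral>\<^sup>+v. (\<integral>\<^sup>+p. ennreal \<bar>1 / c\<bar> * (E ((p - s * v) / c) v * f p (c * v - s * ((p - s * v) / c))) \<partial>lborel) \<partial>lborel)"
    using False by (subst nn_integral_cmult[symmetric])
      (auto intro!: nn_integral_cong simp: right_diff_distrib diff_divide_distrib)
  also have "\<dots> = (\<integral>\<^sup>+p. (\<integral>\<^sup>+v. ennreal \<bar>1 / c\<bar> * (E ((p - s * v) / c) v * f p (c * v - s * ((p - s * v) / c))) \<partial>lborel) \<partial>lborel)"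
    by (rule lborel_pair.Fubini') measurable
  also have "\<dots> = (\<integral>\<^sup>+p. ennreal \<bar>c\<bar> * (\<integral>\<^sup>+q. ennreal \<bar>1 / c\<bar> * (E ((p - s * (s * p + c * q)) / c) (s * p + c * q) *
      f p (c * (s * p + c * q) - s * ((p - s * (s * p + c * q)) / c))) \<partial>lborel) \<partial>lborel)"
    using False by (intro nn_integral_cong nn_integral_real_affine) measurable
  also have "\<dots> = (\<integral>\<^sup>+p. ennreal \<bar>c\<bar> * (\<integral>\<^sup>+q. ennreal \<bar>1 / c\<bar> * (E p q * f p q) \<partial>lborel) \<partial>lborel)"
    by (simp only: u w E_rot)
  also have "\<dots> = (\<integral>\<^sup>+p. \<integral>\<^sup>+q. E p q * f p q \<partial>lborel \<partial>lborel)"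
  proof (rule nn_integral_cong)
    fix p
    have [measurable]: "(\<lambda>q. E p q * f p q) \<in> borel_measurable borel"
      by measurable
    show "ennreal \<bar>c\<bar> * (\<integral>\<^sup>+q. ennreal \<bar>1 / c\<bar> * (E p q * f p q) \<partial>lborel) = (\<integral>\<^sup>+q. E p q * f p q \<partial>lborel)"
      using False by (subst nn_integral_cmult) (auto simp: mult.assoc[symmetric] ennreal_mult[symmetric])
  qed
  also have "\<dots> = (\<integral>\<^sup>+u. \<integral>\<^sup>+v. f u v \<partial>std_gauss \<partial>std_gauss)"
    by (rule dbl[symmetric]) measurable
  finally show ?thesis .
qed

lemma nn_integral_gauss_vec_Suc:
  assumes "f \<in> borel_measurable (gauss_vec (Suc k))"
  shows "integral\<^sup>N (gauss_vec (Suc k)) f = (\<integral>\<^sup>+w. \<integral>\<^sup>+z. f (z(k := w)) \<partial>gauss_vec k \<partial>std_gauss)"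
  using gauss.product_nn_integral_insert_rev[of "{..<k}" k f] assms
  by (simp add: gauss_vec_def lessThan_Suc)

lemma measurable_gauss_vec_linear:
  "(\<lambda>z. \<Sum>i<k. x i * z i) \<in> borel_measurable (gauss_vec k)"
  by (intro borel_measurable_sum borel_measurable_times borel_measurable_const)
    (simp add: gauss_vec_def)

lemma rotation_to_axis:
  fixes a b :: real
  obtains C S where "C\<^sup>2 + S\<^sup>2 = 1" "a = sqrt (a\<^sup>2 + b\<^sup>2) * C" "b = sqrt (a\<^sup>2 + b\<^sup>2) * S"
proof (cases "a\<^sup>2 + b\<^sup>2 = 0")
  case True
  then show ?thesis
    using that[of 1 0] by (simp add: sum_power2_eq_zero_iff)
next
  case False
  then have pos: "a\<^sup>2 + b\<^sup>2 > 0"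
    by (metis sum_power2_gt_zero_iff sum_power2_eq_zero_iff)
  then have ne: "a = 0 \<longrightarrow> b \<noteq> 0"
    by auto
  let ?r = "sqrt (a\<^sup>2 + b\<^sup>2)"
  have "(a / ?r)\<^sup>2 + (b / ?r)\<^sup>2 = 1"
    using pos ne by (simp add: power_divide add_divide_distrib[symmetric])
  then show ?thesis
    using that[of "a / ?r" "b / ?r"] pos ne by auto
qed

text \<open>Two linear forms of a Gaussian vector have the joint law of
  \<open>(a * U, b * U + c * V)\<close> with \<open>U\<close>, \<open>V\<close> independent standard
  Gaussians: a Cholesky factorization of their Gram matrix. The coefficient \<open>b\<close> is
  fixed through \<open>a * b\<close>, which also covers \<open>a = 0\<close>. Law and coefficients
  are built together by induction on the dimension.\<close>

lemma nn_integral_gauss_vec_pair: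
  fixes x y :: "nat \<Rightarrow> real"
  shows "\<exists>a b c. a \<ge> 0 \<and> c \<ge> 0 \<and> a\<^sup>2 = (\<Sum>i<k. (x i)\<^sup>2) \<and> a * b = (\<Sum>i<k. x i * y i) \<and>
     b\<^sup>2 + c\<^sup>2 = (\<Sum>i<k. (y i)\<^sup>2) \<and>
     (\<forall>f. (\<lambda>(u, v). f u v) \<in> borel_measurable (borel \<Otimes>\<^sub>M borel) \<longrightarrow>
       (\<integral>\<^sup>+z. f (\<Sum>i<k. x i * z i) (\<Sum>i<k. y i * z i) \<partial>gauss_vec k)
        = (\<integral>\<^sup>+u. \<integral>\<^sup>+v. f (a * u) (b * u + c * v) \<partial>std_gauss \<partial>std_gauss))"
proof (induction k)
  case 0
  show ?case
    by (rule exI[of _ 0], rule exI[of _ 0], rule exI[of _ 0])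
      (simp add: gauss_vec.emeasure_space_1 std_gauss.emeasure_space_1[simplified])
next
  case (Suc k)
  then obtain a b c where ac: "a \<ge> 0" "c \<ge> 0" and a: "a\<^sup>2 = (\<Sum>i<k. (x i)\<^sup>2)"
    and ab: "a * b = (\<Sum>i<k. x i * y i)" and bc: "b\<^sup>2 + c\<^sup>2 = (\<Sum>i<k. (y i)\<^sup>2)"
    and law: "\<And>f. (\<lambda>(u, v). f u v) \<in> borel_measurable (borel \<Otimes>\<^sub>M borel) \<Longrightarrow>
       (\<integral>\<^sup>+z. f (\<Sum>i<k. x i * z i) (\<Sum>i<k. y i * z i) \<partial>gauss_vec k)
        = (\<integral>\<^sup>+u. \<integral>\<^sup>+v. f (a * u) (b * u + c * v) \<partial>std_gauss \<partial>std_gauss)"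
    by blast
  define a' where "a' = sqrt (a\<^sup>2 + (x k)\<^sup>2)"
  \<comment> \<open>The rotation \<open>(C, S)\<close> of the old first variable and the new
    coordinate makes the first form a multiple of a single variable. The second form keeps a
    residual coefficient \<open>y1\<close> on the other rotated variable; the rotation
    \<open>(C', S')\<close> merges it with the old residual \<open>c * v\<close>.\<close>
  obtain C S where CS: "C\<^sup>2 + S\<^sup>2 = 1" and aC: "a = a' * C" and xS: "x k = a' * S"
    unfolding a'_def by (rule rotation_to_axis)
  define b1 where "b1 = b * C + y k * S"
  define y1 where "y1 = y k * C - b * S"
  define c' where "c' = sqrt (c\<^sup>2 + y1\<^sup>2)"
  obtain C' S' where CS': "C'\<^sup>2 + S'\<^sup>2 = 1" and cC: "c = c' * C'" and yS: "y1 = c' * S'"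
    unfolding c'_def by (rule rotation_to_axis)
  have CC: "C * C = 1 - S * S"
    using CS by (simp add: power2_eq_square)
  have r1: "a * u + x k * w = a' * (C * u + S * w)" for u w
    by (simp add: aC xS algebra_simps)
  have r2: "b * u + y k * w = b1 * (C * u + S * w) + y1 * (C * w - S * u)" for u w
    unfolding b1_def y1_def using CC by algebra
  show ?case
  proof (intro exI conjI allI impI)
    show "a' \<ge> 0" "c' \<ge> 0"
      by (auto simp: a'_def c'_def)
    show "a'\<^sup>2 = (\<Sum>i<Suc k. (x i)\<^sup>2)"
      by (simp add: a'_def a sum_nonneg)
    have "a' * b1 = a * b + x k * y k"
      by (simp add: b1_def aC xS algebra_simps)
    then show "a' * b1 = (\<Sum>i<Suc k. x i * y i)"
      by (simp add: ab)
    have "b1\<^sup>2 + y1\<^sup>2 = (C\<^sup>2 + S\<^sup>2) * (b\<^sup>2 + (y k)\<^sup>2)"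
      by (simp add: b1_def y1_def power2_eq_square algebra_simps)
    then have "b1\<^sup>2 + c'\<^sup>2 = b\<^sup>2 + c\<^sup>2 + (y k)\<^sup>2"
      by (simp add: c'_def CS)
    then show "b1\<^sup>2 + c'\<^sup>2 = (\<Sum>i<Suc k. (y i)\<^sup>2)"
      by (simp add: bc)
    fix f :: "real \<Rightarrow> real \<Rightarrow> ennreal"
    assume [measurable]: "(\<lambda>(u, v). f u v) \<in> borel_measurable (borel \<Otimes>\<^sub>M borel)"
    have upd: "(\<Sum>i<k. r i * (z(k := w)) i) = (\<Sum>i<k. r i * z i)" for r z and w :: real
      by (intro sum.cong) auto
    have "(\<integral>\<^sup>+z. f (\<Sum>i<Suc k. x i * z i) (\<Sum>i<Suc k. y i * z i) \<partial>gauss_vec (Suc k))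
       = (\<integral>\<^sup>+w. \<integral>\<^sup>+z. f ((\<Sum>i<k. x i * z i) + x k * w) ((\<Sum>i<k. y i * z i) + y k * w) \<partial>gauss_vec k \<partial>std_gauss)"
    proof (subst nn_integral_gauss_vec_Suc)
      have "(\<lambda>z. (\<Sum>i<Suc k. x i * z i, \<Sum>i<Suc k. y i * z i)) \<in> gauss_vec (Suc k) \<rightarrow>\<^sub>M borel \<Otimes>\<^sub>M borel"
        by (intro measurable_Pair measurable_gauss_vec_linear)
      from measurable_compose[OF this, of "\<lambda>(u, v). f u v"]
      show "(\<lambda>z. f (\<Sum>i<Suc k. x i * z i) (\<Sum>i<Suc k. y i * z i)) \<in> borel_measurable (gauss_vec (Suc k))"
        by simp
    qed (simp only: sum.lessThan_Suc upd fun_upd_same)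
    also have "\<dots> = (\<integral>\<^sup>+w. \<integral>\<^sup>+u. \<integral>\<^sup>+v. f (a * u + x k * w) (b * u + c * v + y k * w) \<partial>std_gauss \<partial>std_gauss \<partial>std_gauss)"
      by (intro nn_integral_cong law) measurable
    also have "\<dots> = (\<integral>\<^sup>+u. \<integral>\<^sup>+w. \<integral>\<^sup>+v. f (a * u + x k * w) (b * u + c * v + y k * w) \<partial>std_gauss \<partial>std_gauss \<partial>std_gauss)"
      by (rule std_gauss.Fubini') measurable
    also have "\<dots> = (\<integral>\<^sup>+u. \<integral>\<^sup>+w. (\<lambda>p q. \<integral>\<^sup>+v. f (a' * p) (b1 * p + y1 * q + c * v) \<partial>std_gauss) (C * u + S * w) (C * w - S * u) \<partial>std_gauss \<partial>std_gauss)"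
    proof -
      have "b * u + c * v + y k * w = b1 * (C * u + S * w) + y1 * (C * w - S * u) + c * v" for u v w
        using r2[of u w] by simp
      then show ?thesis
        by (simp only: r1)
    qed
    also have "\<dots> = (\<integral>\<^sup>+u. \<integral>\<^sup>+w. \<integral>\<^sup>+v. f (a' * u) (b1 * u + y1 * w + c * v) \<partial>std_gauss \<partial>std_gauss \<partial>std_gauss)"
      by (rule nn_integral_gauss_rotate) (measurable, rule CS)
    also have "\<dots> = (\<integral>\<^sup>+u. \<integral>\<^sup>+v. f (a' * u) (b1 * u + c' * v) \<partial>std_gauss \<partial>std_gauss)"
    proof (rule nn_integral_cong)
      fix u
      have "(\<integral>\<^sup>+w. \<integral>\<^sup>+v. f (a' * u) (b1 * u + y1 * w + c * v) \<partial>std_gauss \<partial>std_gauss)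
         = (\<integral>\<^sup>+v. \<integral>\<^sup>+w. f (a' * u) (b1 * u + y1 * w + c * v) \<partial>std_gauss \<partial>std_gauss)"
        by (rule std_gauss.Fubini') measurable
      also have "\<dots> = (\<integral>\<^sup>+v. \<integral>\<^sup>+w. (\<lambda>p q. f (a' * u) (b1 * u + c' * p)) (C' * v + S' * w) (C' * w - S' * v) \<partial>std_gauss \<partial>std_gauss)"
        by (simp add: cC yS algebra_simps)
      also have "\<dots> = (\<integral>\<^sup>+v. \<integral>\<^sup>+w. f (a' * u) (b1 * u + c' * v) \<partial>std_gauss \<partial>std_gauss)"
        by (rule nn_integral_gauss_rotate) (measurable, rule CS')
      finally show "(\<integral>\<^sup>+w. \<integral>\<^sup>+v. f (a' * u) (b1 * u + y1 * w + c * v) \<partial>std_gauss \<partial>std_gauss)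
          = (\<integral>\<^sup>+v. f (a' * u) (b1 * u + c' * v) \<partial>std_gauss)"
        by (simp add: std_gauss.emeasure_space_1[simplified])
    qed
    finally show "(\<integral>\<^sup>+z. f (\<Sum>i<Suc k. x i * z i) (\<Sum>i<Suc k. y i * z i) \<partial>gauss_vec (Suc k))
       = (\<integral>\<^sup>+u. \<integral>\<^sup>+v. f (a' * u) (b1 * u + c' * v) \<partial>std_gauss \<partial>std_gauss)" .
  qed
qed

lemma nn_integral_gauss_vec_linear:
  fixes x :: "nat \<Rightarrow> real"
  assumes [measurable]: "f \<in> borel_measurable borel"
  shows "(\<integral>\<^sup>+z. f (\<Sum>i<k. x i * z i) \<partial>gauss_vec k) = (\<integral>\<^sup>+u. f (sqrt (\<Sum>i<k. (x i)\<^sup>2) * u) \<partial>std_gauss)"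
proof -
  obtain a b c where "a \<ge> 0" and a: "a\<^sup>2 = (\<Sum>i<k. (x i)\<^sup>2)" and
    "\<forall>f. (\<lambda>(u, v). f u v) \<in> borel_measurable (borel \<Otimes>\<^sub>M borel) \<longrightarrow>
       (\<integral>\<^sup>+z. f (\<Sum>i<k. x i * z i) (\<Sum>i<k. x i * z i) \<partial>gauss_vec k)
        = (\<integral>\<^sup>+u. \<integral>\<^sup>+v. f (a * u) (b * u + c * v) \<partial>std_gauss \<partial>std_gauss)"
    using nn_integral_gauss_vec_pair[where k = k and x = x and y = x] by blast
  from this(3)[rule_format, of "\<lambda>u v. f u"]
  have "(\<integral>\<^sup>+z. f (\<Sum>i<k. x i * z i) \<partial>gauss_vec k) = (\<integral>\<^sup>+u. f (a * u) \<partial>std_gauss)"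
    by (simp add: std_gauss.emeasure_space_1[simplified])
  moreover have "a = sqrt (\<Sum>i<k. (x i)\<^sup>2)"
    using \<open>a \<ge> 0\<close> a by (metis real_sqrt_unique)
  ultimately show ?thesis by simp
qed

lemma integral_gauss_vec_linear:
  fixes x :: "nat \<Rightarrow> real" and f :: "real \<Rightarrow> real"
  assumes [measurable]: "f \<in> borel_measurable borel" and nn: "\<And>t. f t \<ge> 0"
  shows "(\<integral>z. f (\<Sum>i<k. x i * z i) \<partial>gauss_vec k) = (\<integral>u. f (sqrt (\<Sum>i<k. (x i)\<^sup>2) * u) \<partial>std_gauss)"
proof -
  have [measurable]: "(\<lambda>z. f (\<Sum>i<k. x i * z i)) \<in> borel_measurable (gauss_vec k)"
    by measurable
  show ?thesis
    using nn_integral_gauss_vec_linear[where f = "\<lambda>t. ennreal (f t)" and x = x and k = k]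
    by (simp add: integral_eq_nn_integral nn)
qed

subsection \<open>Hyperplane crossing probabilities\<close>

lemma nn_integral_wedge:
  assumes bc: "b\<^sup>2 + c\<^sup>2 = 1" and "c \<ge> 0"
  shows "(\<integral>\<^sup>+u. \<integral>\<^sup>+v. indicator {p. sgn1 (fst p) \<noteq> sgn1 (snd p)} (u, b * u + c * v) \<partial>std_gauss \<partial>std_gauss)
    = ennreal (arccos b / pi)"
proof (cases "c = 0")
  case True
  then have b: "b = 1 \<or> b = -1"
    using bc by (simp add: power2_eq_1_iff)
  have AE: "AE u in std_gauss. u \<noteq> 0"
    unfolding std_gauss_def using AE_lborel_singleton[of "0::real"]
    by (subst AE_density) (auto elim: AE_mp)
  show ?thesis
    using b
  proof
    assume "b = 1"
    then show ?thesis using True by simp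
  next
    assume b: "b = -1"
    have "(\<integral>\<^sup>+u. \<integral>\<^sup>+v. indicator {p. sgn1 (fst p) \<noteq> sgn1 (snd p)} (u, b * u + c * v) \<partial>std_gauss \<partial>std_gauss)
       = (\<integral>\<^sup>+u. 1 \<partial>std_gauss)"
    proof (rule nn_integral_cong_AE)
      show "AE u in std_gauss. (\<integral>\<^sup>+v. indicator {p. sgn1 (fst p) \<noteq> sgn1 (snd p)} (u, b * u + c * v) \<partial>std_gauss) = 1"
        using AE by eventually_elim
          (auto simp: True b sgn1_def indicator_def std_gauss.emeasure_space_1[simplified])
    qed
    then show ?thesis
      using b by (simp add: std_gauss.emeasure_space_1[simplified])
  qed
next
  case False
  then have c: "c > 0"
    using assms by simp
  have [measurable]: "sgn1 \<in> borel_measurable borel"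
    unfolding sgn1_def by measurable
  have [measurable]: "(\<lambda>(u, v). indicator {p. sgn1 (fst p) \<noteq> sgn1 (snd p)} (u, v) :: ennreal) \<in> borel_measurable (borel \<Otimes>\<^sub>M borel)"
    by measurable
  let ?I = "\<lambda>u v. indicator {p. sgn1 (fst p) \<noteq> sgn1 (snd p)} (u, v) :: ennreal"
  let ?d = "std_normal_density"
  \<comment> \<open>The joint density in the variables \<open>(u, w)\<close>; the factor
    \<open>\<bar>u\<bar>\<close> is the Jacobian of the substitution.\<close>
  define K where "K u w = ennreal (?d u * \<bar>u\<bar> * ?d (u * w))" for u w
  have [measurable]: "(\<lambda>(u, w). K u w) \<in> borel_measurable (borel \<Otimes>\<^sub>M borel)"
    unfolding K_def std_normal_density_def by measurable
  have K: "(\<integral>\<^sup>+u. K u w \<partial>lborel) = ennreal (inverse (1 + w\<^sup>2) / pi)" for w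
  proof -
    \<comment> \<open>For fixed \<open>w\<close> the product of the two Gaussian densities is a
      multiple of the centered normal density in \<open>u\<close> with variance
      \<open>1 / (1 + w^2)\<close>, so the integral over \<open>u\<close> is its first absolute
      moment.\<close>
    define \<sigma> where "\<sigma> = 1 / sqrt (1 + w\<^sup>2)"
    have pos: "0 < 1 + w\<^sup>2"
      by (smt (verit) zero_le_power2)
    then have \<sigma>: "\<sigma> > 0" "\<sigma>\<^sup>2 = inverse (1 + w\<^sup>2)"
      by (auto simp: \<sigma>_def power_divide inverse_eq_divide)
    have "K u w = ennreal (\<sigma> / sqrt (2 * pi) * (normal_density 0 \<sigma> u * \<bar>u\<bar>))" for u
    proof -
      have "?d u * ?d (u * w) = 1 / (2 * pi) * exp (- (u\<^sup>2 * (1 + w\<^sup>2)) / 2)"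
        by (simp add: std_normal_density_def exp_add[symmetric] power_mult_distrib algebra_simps add_divide_distrib diff_divide_distrib)
      also have "\<dots> = \<sigma> / sqrt (2 * pi) * normal_density 0 \<sigma> u"
      proof -
        have "inverse (\<sigma>\<^sup>2) = 1 + w\<^sup>2"
          unfolding \<sigma>(2) by simp
        moreover have "- (u - 0)\<^sup>2 / (2 * \<sigma>\<^sup>2) = - (u\<^sup>2 * inverse (\<sigma>\<^sup>2)) / 2"
          by (simp add: field_simps)
        ultimately have e: "- (u - 0)\<^sup>2 / (2 * \<sigma>\<^sup>2) = - (u\<^sup>2 * (1 + w\<^sup>2)) / 2"
          by (simp only:)
        have r: "sqrt (2 * pi * \<sigma>\<^sup>2) = sqrt (2 * pi) * \<sigma>"
          using \<sigma>(1) by (simp add: real_sqrt_mult)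
        have "1 / (2 * pi) = \<sigma> / sqrt (2 * pi) * (1 / (sqrt (2 * pi) * \<sigma>))"
          using \<sigma>(1) real_sqrt_mult_self[of "2 * pi"] by (simp add: field_simps del: real_sqrt_mult_self)
        then show ?thesis
          unfolding normal_density_def e r by (simp only: mult.assoc[symmetric])
      qed
      finally show ?thesis
        by (simp add: K_def ac_simps)
    qed
    moreover have "(\<integral>\<^sup>+u. ennreal (\<sigma> / sqrt (2 * pi) * (normal_density 0 \<sigma> u * \<bar>u\<bar>)) \<partial>lborel) = ennreal (\<sigma> / sqrt (2 * pi) * (\<sigma> * sqrt (2 / pi)))"
    proof -
      have "has_bochner_integral lborel (\<lambda>u. normal_density 0 \<sigma> u * \<bar>u\<bar>) (\<sigma> * sqrt (2 / pi))"
        using normal_moment_abs_odd[OF \<sigma>(1), of 0 0] by simp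
      then have "has_bochner_integral lborel (\<lambda>u. \<sigma> / sqrt (2 * pi) * (normal_density 0 \<sigma> u * \<bar>u\<bar>)) (\<sigma> / sqrt (2 * pi) * (\<sigma> * sqrt (2 / pi)))"
        by (rule has_bochner_integral_mult_right)
      then show ?thesis
        using \<sigma> by (subst nn_integral_eq_integral)
          (auto simp: has_bochner_integral_iff)
    qed
    moreover have "\<sigma> / sqrt (2 * pi) * (\<sigma> * sqrt (2 / pi)) = inverse (1 + w\<^sup>2) / pi"
      unfolding \<sigma>(2)[symmetric] by (simp add: real_sqrt_mult real_sqrt_divide power2_eq_square field_simps)
    ultimately show ?thesis by simp
  qed
  have "(\<integral>\<^sup>+u. \<integral>\<^sup>+v. ?I u (b * u + c * v) \<partial>std_gauss \<partial>std_gauss)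
     = (\<integral>\<^sup>+u. ?d u * (\<integral>\<^sup>+v. ?d v * ?I u (b * u + c * v) \<partial>lborel) \<partial>lborel)"
    by (simp add: nn_integral_std_gauss)
  also have "\<dots> = (\<integral>\<^sup>+u. \<integral>\<^sup>+w. K u w * indicator {b / c..} w \<partial>lborel \<partial>lborel)"
  proof (rule nn_integral_cong_AE)
    show "AE u in lborel. ?d u * (\<integral>\<^sup>+v. ?d v * ?I u (b * u + c * v) \<partial>lborel) = (\<integral>\<^sup>+w. K u w * indicator {b / c..} w \<partial>lborel)"
      using AE_lborel_singleton[of "0::real"]
    proof eventually_elim
      case (elim u)
      have "(\<integral>\<^sup>+v. ?d v * ?I u (b * u + c * v) \<partial>lborel)
        = ennreal \<bar>- u\<bar> * (\<integral>\<^sup>+w. ?d (0 + - u * w) * ?I u (b * u + c * (0 + - u * w)) \<partial>lborel)"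
        using elim by (intro nn_integral_real_affine) auto
      also have "(\<integral>\<^sup>+w. ?d (0 + - u * w) * ?I u (b * u + c * (0 + - u * w)) \<partial>lborel)
         = (\<integral>\<^sup>+w. ennreal (?d (u * w)) * indicator {b / c..} w \<partial>lborel)"
      proof (rule nn_integral_cong_AE)
        show "AE w in lborel. ?d (0 + - u * w) * ?I u (b * u + c * (0 + - u * w)) = ennreal (?d (u * w)) * indicator {b / c..} w"
          using AE_lborel_singleton[of "b / c"]
        proof eventually_elim
          case (elim w)
          have "b * u + c * (0 + - u * w) = u * (b - c * w)"
            by (simp add: algebra_simps)
          moreover have "sgn1 u \<noteq> sgn1 (u * (b - c * w)) \<longleftrightarrow> w \<ge> b / c"
          proof -
            have "b \<noteq> c * w" "w \<ge> b / c \<longleftrightarrow> b \<le> c * w"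
              using elim c by (auto simp: field_simps)
            then show ?thesis
              using \<open>u \<noteq> 0\<close> by (auto simp: sgn1_def zero_le_mult_iff not_le)
          qed
          ultimately show ?case
            by (simp add: indicator_def std_normal_density_def)
        qed
      qed
      finally have "(\<integral>\<^sup>+v. ?d v * ?I u (b * u + c * v) \<partial>lborel) = \<bar>u\<bar> * (\<integral>\<^sup>+w. ennreal (?d (u * w)) * indicator {b / c..} w \<partial>lborel)"
        by simp
      then show ?case
        by (simp add: K_def nn_integral_cmult[symmetric] ennreal_mult mult.assoc)
    qed
  qed
  also have "\<dots> = (\<integral>\<^sup>+w. \<integral>\<^sup>+u. K u w * indicator {b / c..} w \<partial>lborel \<partial>lborel)"
    by (rule lborel_pair.Fubini') measurable
  also have "\<dots> = (\<integral>\<^sup>+w. ennreal (inverse (1 + w\<^sup>2) / pi) * indicator {b / c..} w \<partial>lborel)"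
    by (simp add: nn_integral_multc K)
  also have "\<dots> = ennreal ((pi / 2) / pi - arctan (b / c) / pi)"
  proof (rule nn_integral_FTC_atLeast)
    show "((\<lambda>w. arctan w / pi) has_real_derivative inverse (1 + w\<^sup>2) / pi) (at w)" for w
      by (auto intro!: derivative_eq_intros simp: divide_inverse)
    show "((\<lambda>w. arctan w / pi) \<longlongrightarrow> pi / 2 / pi) at_top"
      by (intro tendsto_divide tendsto_arctan_at_top tendsto_const) simp
  qed auto
  also have "(pi / 2) / pi - arctan (b / c) / pi = arccos b / pi"
  proof -
    have "b\<^sup>2 < 1"
      using bc zero_less_power[OF c, of 2] by linarith
    then have b: "-1 < b" "b < 1"
      by (auto simp: power2_less_1_iff abs_less_iff)
    moreover have "c = sqrt (1 - b\<^sup>2)"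
      using bc c by (metis add_diff_cancel_left' less_imp_le real_sqrt_unique)
    ultimately have "arctan (b / c) = arcsin b"
      by (simp add: arcsin_arctan)
    then show ?thesis
      using b arcsin_arccos_eq[of b] by (simp add: diff_divide_distrib)
  qed
  finally show ?thesis by simp
qed

text \<open>The normal vector of the hyperplane comes last, so that \<open>crosses n x y\<close> is
  an event. With \<open>sgn1\<close> as the sign, it is exact disagreement of the sign patterns in
  the theorem, even on hyperplanes through a point.\<close>

definition crosses :: "nat \<Rightarrow> (nat \<Rightarrow> real) \<Rightarrow> (nat \<Rightarrow> real) \<Rightarrow> (nat \<Rightarrow> real) \<Rightarrow> bool" where
  "crosses n x y z \<longleftrightarrow> sgn1 (sinner n z x) \<noteq> sgn1 (sinner n z y)"

lemma sinner_eq_sum_lessThan: "sinner n z x = (\<Sum>i<Suc n. x i * z i)"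
  unfolding sinner_def by (intro sum.cong) auto

lemma measurable_sgn1 [measurable]: "sgn1 \<in> borel_measurable borel"
  unfolding sgn1_def by measurable

lemma measurable_sinner: "(\<lambda>z. sinner n z x) \<in> borel_measurable (gauss_vec (Suc n))"
  unfolding sinner_eq_sum_lessThan by (rule measurable_gauss_vec_linear)

lemma measurable_crosses [measurable]: "Measurable.pred (gauss_vec (Suc n)) (crosses n x y)"
proof -
  have m: "(\<lambda>z. sgn1 (sinner n z x)) \<in> borel_measurable (gauss_vec (Suc n))" for x
    by (rule measurable_compose[OF measurable_sinner measurable_sgn1])
  show ?thesis
    unfolding crosses_def pred_def by (rule borel_measurable_neq[OF m m])
qed

lemma sinner_sphere: "x \<in> sphere_n n \<Longrightarrow> (\<Sum>i<Suc n. (x i)\<^sup>2) = 1"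
  unfolding sphere_n_def sinner_def lessThan_Suc_atMost power2_eq_square by simp

lemma prob_crosses:
  assumes x: "x \<in> sphere_n n" and y: "y \<in> sphere_n n"
  shows "measure (gauss_vec (Suc n)) {z \<in> space (gauss_vec (Suc n)). crosses n x y z} = sdist n x y"
proof -
  obtain a b c where a: "a \<ge> 0" "c \<ge> 0" "a\<^sup>2 = 1" and ab: "a * b = (\<Sum>i<Suc n. x i * y i)"
    and bc: "b\<^sup>2 + c\<^sup>2 = 1" and law:
     "\<And>f. (\<lambda>(u, v). f u v) \<in> borel_measurable (borel \<Otimes>\<^sub>M borel) \<Longrightarrow>
       (\<integral>\<^sup>+z. f (\<Sum>i<Suc n. x i * z i) (\<Sum>i<Suc n. y i * z i) \<partial>gauss_vec (Suc n))
        = (\<integral>\<^sup>+u. \<integral>\<^sup>+v. f (a * u) (b * u + c * v) \<partial>std_gauss \<partial>std_gauss)"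
    using nn_integral_gauss_vec_pair[where k = "Suc n" and x = x and y = y]
    unfolding sinner_sphere[OF x] sinner_sphere[OF y] by blast
  have a1: "a = 1"
    using a by (simp add: power2_eq_1_iff)
  have b: "b = sinner n x y"
    using ab unfolding a1 sinner_eq_sum_lessThan by (simp add: mult.commute)
  let ?I = "\<lambda>u v. indicator {p. sgn1 (fst p) \<noteq> sgn1 (snd p)} (u, v) :: ennreal"
  have "emeasure (gauss_vec (Suc n)) {z \<in> space (gauss_vec (Suc n)). crosses n x y z}
    = (\<integral>\<^sup>+z. indicator {z \<in> space (gauss_vec (Suc n)). crosses n x y z} z \<partial>gauss_vec (Suc n))"
    by (rule nn_integral_indicator[symmetric]) measurable
  also have "\<dots> = (\<integral>\<^sup>+z. ?I (\<Sum>i<Suc n. x i * z i) (\<Sum>i<Suc n. y i * z i) \<partial>gauss_vec (Suc n))"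
    by (intro nn_integral_cong) (simp add: crosses_def sinner_eq_sum_lessThan indicator_def del: sum.lessThan_Suc)
  also have "\<dots> = (\<integral>\<^sup>+u. \<integral>\<^sup>+v. ?I (a * u) (b * u + c * v) \<partial>std_gauss \<partial>std_gauss)"
    by (rule law) measurable
  also have "\<dots> = ennreal (sdist n x y)"
    using nn_integral_wedge[OF bc a(2)] by (simp only: a1 mult_1 b sdist_def)
  finally have e: "emeasure (gauss_vec (Suc n)) {z \<in> space (gauss_vec (Suc n)). crosses n x y z} = ennreal (sdist n x y)" .
  have "\<bar>b\<bar> \<le> 1"
    using bc zero_le_power2[of c] abs_square_le_1[of b] by linarith
  then have "sdist n x y \<ge> 0"
    unfolding sdist_def b[symmetric] by (simp add: arccos_lbound abs_le_iff)
  then show ?thesis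
    using e by (simp add: measure_def)
qed

subsection \<open>The Sudakov-Fernique inequality\<close>

text \<open>Integration by parts: \<open>- std_normal_density x * h x\<close> has derivative
  \<open>std_normal_density x * (x * h x - h' x)\<close> and vanishes at both ends because
  \<open>h\<close> is bounded.\<close>

lemma stein_identity:
  fixes h h' :: "real \<Rightarrow> real"
  assumes d: "\<And>x. (h has_real_derivative h' x) (at x)" and h'c: "continuous_on UNIV h'"
    and hB: "\<And>x. \<bar>h x\<bar> \<le> B" and h'B: "\<And>x. \<bar>h' x\<bar> \<le> B"
  shows "(\<integral>x. x * h x \<partial>std_gauss) = (\<integral>x. h' x \<partial>std_gauss)"
proof -
  let ?d = "std_normal_density"
  have hc: "continuous_on UNIV h"
    using d by (meson DERIV_isCont continuous_at_imp_continuous_on)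
  have [measurable]: "h \<in> borel_measurable borel" "h' \<in> borel_measurable borel"
    using hc h'c by (auto intro: borel_measurable_continuous_onI)
  have i1: "integrable std_gauss (\<lambda>x. x * h x)"
  proof (rule Bochner_Integration.integrable_bound)
    show "integrable std_gauss (\<lambda>x. B * x)"
      by simp
    show "AE x in std_gauss. norm (x * h x) \<le> norm (B * x)"
    proof (rule AE_I2)
      fix x
      have "\<bar>h x\<bar> \<le> \<bar>B\<bar>" using hB[of x] by linarith
      then show "norm (x * h x) \<le> norm (B * x)"
        by (simp add: abs_mult mult.commute[of "\<bar>B\<bar>"] mult_left_mono)
    qed
  qed measurable
  have i2: "integrable std_gauss h'"
    using h'B by (intro std_gauss.integrable_const_bound[where B = B]) auto
  define f where "f x = ?d x * (x * h x) - ?d x * h' x" for x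
  have fi: "integrable lborel f"
    unfolding f_def using i1 i2 by (intro Bochner_Integration.integrable_diff) (simp_all add: integrable_std_gauss)
  have lim: "((\<lambda>x. - (?d x * h x)) \<longlongrightarrow> 0) at_top" "((\<lambda>x. - (?d x * h x)) \<longlongrightarrow> 0) at_bot"
  proof -
    have *: "norm (- (?d x * h x)) \<le> norm (?d x) * B" for x
      using hB[of x] by (simp add: abs_mult mult_left_mono)
    have "(?d \<longlongrightarrow> 0) at_top" "(?d \<longlongrightarrow> 0) at_bot"
      unfolding std_normal_density_def by real_asymp+
    from this[THEN tendsto_norm_zero, THEN tendsto_mult_left_zero]
    show "((\<lambda>x. - (?d x * h x)) \<longlongrightarrow> 0) at_top" "((\<lambda>x. - (?d x * h x)) \<longlongrightarrow> 0) at_bot"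
      by (auto intro: Lim_null_comparison[OF always_eventually[OF allI[OF *]]])
  qed
  have "(LBINT x=-\<infinity>..\<infinity>. f x) = 0 - 0"
  proof (rule interval_integral_FTC_integrable)
    show "((\<lambda>x. - (?d x * h x)) has_vector_derivative f x) (at x)" for x
    proof -
      have "(?d has_real_derivative (- x * ?d x)) (at x)"
      proof -
        have "((\<lambda>x. exp (- x\<^sup>2 / 2)) has_real_derivative (- x * exp (- x\<^sup>2 / 2))) (at x)"
          by (auto intro!: derivative_eq_intros)
        from DERIV_cmult[OF this, of "1 / sqrt (2 * pi)"] show ?thesis
          unfolding std_normal_density_def by (simp only: mult_ac)
      qed
      then show ?thesis
        unfolding has_real_derivative_iff_has_vector_derivative[symmetric] f_def
        by (auto intro!: derivative_eq_intros d simp: algebra_simps)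
    qed
    have "continuous_on UNIV f"
      unfolding f_def std_normal_density_def by (intro continuous_intros hc h'c) auto
    then show "isCont f x" for x
      by (simp add: continuous_on_eq_continuous_at)
    show "set_integrable lborel (einterval (-\<infinity>) \<infinity>) f"
      using fi by (simp add: set_integrable_def)
    show "(((\<lambda>x. - (?d x * h x)) \<circ> real_of_ereal) \<longlongrightarrow> 0) (at_right (-\<infinity>))"
      "(((\<lambda>x. - (?d x * h x)) \<circ> real_of_ereal) \<longlongrightarrow> 0) (at_left \<infinity>)"
      using lim by (simp_all add: ereal_tendsto_simps)
  qed simp
  then have "integral\<^sup>L lborel f = 0"
    by (simp add: interval_lebesgue_integral_def set_lebesgue_integral_def)
  then have "(\<integral>x. ?d x * (x * h x) \<partial>lborel) = (\<integral>x. ?d x * h' x \<partial>lborel)"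
    unfolding f_def using i1 i2 by (subst (asm) Bochner_Integration.integral_diff) (simp_all add: integrable_std_gauss)
  then show ?thesis
    by (simp add: integral_std_gauss)
qed

lemma distr_gauss_vec_component: "i < k \<Longrightarrow> distr (gauss_vec k) std_gauss (\<lambda>z. z i) = std_gauss"
  unfolding gauss_vec_def using gauss.PiM_component[of i "{..<k}"] by simp

lemma integrable_gauss_vec_component:
  assumes "i < k" shows "integrable (gauss_vec k) (\<lambda>z. z i)"
proof -
  have "integrable (distr (gauss_vec k) std_gauss (\<lambda>z. z i)) (\<lambda>x. x)"
    unfolding distr_gauss_vec_component[OF assms] by simp
  then show ?thesis
    using assms by (subst (asm) integrable_distr_eq) (auto simp: gauss_vec_def)
qed

text \<open>Fubini isolates coordinate \<open>i\<close>, where the one-dimensional identity applies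
  with the other coordinates frozen. The integrability statements are exported because the
  interpolation argument exchanges finite sums and integrals.\<close>

lemma stein_identity_gauss_vec:
  fixes p q :: "(nat \<Rightarrow> real) \<Rightarrow> real"
  assumes i: "i < k"
    and d: "\<And>z w. ((\<lambda>w. p (z(i := w))) has_real_derivative q (z(i := w))) (at w)"
    and c: "\<And>z. continuous_on UNIV (\<lambda>w. q (z(i := w)))"
    and B: "\<And>z. \<bar>p z\<bar> \<le> B" "\<And>z. \<bar>q z\<bar> \<le> B"
    and m: "p \<in> borel_measurable (gauss_vec k)" "q \<in> borel_measurable (gauss_vec k)"
  shows "integrable (gauss_vec k) (\<lambda>z. z i * p z)" "integrable (gauss_vec k) q"
    "(\<integral>z. z i * p z \<partial>gauss_vec k) = (\<integral>z. q z \<partial>gauss_vec k)"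
proof -
  let ?I = "{..<k} - {i}"
  have I: "insert i ?I = {..<k}"
    using i by auto
  have [measurable]: "(\<lambda>z. z i) \<in> borel_measurable (gauss_vec k)"
    using i by (simp add: gauss_vec_def)
  show i1: "integrable (gauss_vec k) (\<lambda>z. z i * p z)"
  proof (rule Bochner_Integration.integrable_bound)
    show "integrable (gauss_vec k) (\<lambda>z. B * z i)"
      using integrable_gauss_vec_component[OF i] by simp
    show "AE z in gauss_vec k. norm (z i * p z) \<le> norm (B * z i)"
    proof (rule AE_I2)
      fix z :: "nat \<Rightarrow> real"
      have "\<bar>p z\<bar> \<le> \<bar>B\<bar>" using B(1)[of z] by linarith
      then show "norm (z i * p z) \<le> norm (B * z i)"
        by (simp add: abs_mult mult.commute[of "\<bar>B\<bar>"] mult_left_mono)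
    qed
  qed (intro borel_measurable_times m, measurable)
  show i2: "integrable (gauss_vec k) q"
    using B m by (intro gauss_vec.integrable_const_bound[where B = B]) auto
  have "(\<integral>z. z i * p z \<partial>gauss_vec k) = (\<integral>z. \<integral>w. w * p (z(i := w)) \<partial>std_gauss \<partial>PiM ?I (\<lambda>_. std_gauss))"
    using gauss.product_integral_insert[of ?I i "\<lambda>z. z i * p z"] i1
    unfolding I gauss_vec_def by simp
  also have "\<dots> = (\<integral>z. \<integral>w. q (z(i := w)) \<partial>std_gauss \<partial>PiM ?I (\<lambda>_. std_gauss))"
    by (intro Bochner_Integration.integral_cong stein_identity[OF d c B] refl)
  also have "\<dots> = (\<integral>z. q z \<partial>gauss_vec k)"
    using gauss.product_integral_insert[of ?I i q] i2
    unfolding I gauss_vec_def by simp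
  finally show "(\<integral>z. z i * p z \<partial>gauss_vec k) = (\<integral>z. q z \<partial>gauss_vec k)" .
qed

text \<open>By the mean value theorem the uniform bound \<open>g\<close> on the derivative also
  dominates every difference quotient, so dominated convergence applies along each sequence tending
  to \<open>\<theta>\<close>.\<close>

lemma has_real_derivative_integral:
  fixes f f' :: "real \<Rightarrow> 'a \<Rightarrow> real"
  assumes int: "\<And>\<theta>. integrable M (f \<theta>)"
    and d: "\<And>\<theta> z. z \<in> space M \<Longrightarrow> ((\<lambda>\<theta>. f \<theta> z) has_real_derivative f' \<theta> z) (at \<theta>)"
    and b: "\<And>\<theta> z. z \<in> space M \<Longrightarrow> \<bar>f' \<theta> z\<bar> \<le> g z"
    and g: "integrable M g" and m: "f' \<theta> \<in> borel_measurable M"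
  shows "((\<lambda>\<theta>. \<integral>z. f \<theta> z \<partial>M) has_real_derivative (\<integral>z. f' \<theta> z \<partial>M)) (at \<theta>)"
  unfolding has_field_derivative_iff tendsto_at_iff_sequentially comp_def
proof (intro allI impI)
  fix X :: "nat \<Rightarrow> real"
  assume X: "\<forall>i. X i \<in> UNIV - {\<theta>}" "X \<longlonglongrightarrow> \<theta>"
  have "(\<lambda>n. \<integral>z. (f (X n) z - f \<theta> z) / (X n - \<theta>) \<partial>M) \<longlonglongrightarrow> (\<integral>z. f' \<theta> z \<partial>M)"
  proof (rule integral_dominated_convergence[OF m _ g])
    show "(\<lambda>z. (f (X n) z - f \<theta> z) / (X n - \<theta>)) \<in> borel_measurable M" for n
      using int by (intro borel_measurable_divide borel_measurable_diff) auto
    show "AE z in M. (\<lambda>n. (f (X n) z - f \<theta> z) / (X n - \<theta>)) \<longlonglongrightarrow> f' \<theta> z"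
      using d[of _ \<theta>] X unfolding has_field_derivative_iff tendsto_at_iff_sequentially comp_def
      by (intro AE_I2) blast
    show "AE z in M. norm ((f (X n) z - f \<theta> z) / (X n - \<theta>)) \<le> g z" for n
    proof (rule AE_I2)
      fix z assume z: "z \<in> space M"
      have "norm (f (X n) z - f \<theta> z) \<le> g z * norm (X n - \<theta>)"
        using d[OF z] b[OF z]
        by (intro field_differentiable_bound[where S = UNIV and f' = "\<lambda>\<theta>. f' \<theta> z"]) auto
      then show "norm ((f (X n) z - f \<theta> z) / (X n - \<theta>)) \<le> g z"
        using X by (simp add: divide_le_eq)
    qed
  qed
  moreover have "(\<integral>z. (f (X n) z - f \<theta> z) / (X n - \<theta>) \<partial>M)
     = ((\<integral>z. f (X n) z \<partial>M) - (\<integral>z. f \<theta> z \<partial>M)) / (X n - \<theta>)" for n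
    using int by simp
  ultimately show "(\<lambda>n. ((\<integral>z. f (X n) z \<partial>M) - (\<integral>z. f \<theta> z \<partial>M)) / (X n - \<theta>)) \<longlonglongrightarrow> (\<integral>z. f' \<theta> z \<partial>M)"
    by (simp only:)
qed

section \<open>A smooth substitute for the maximum and its derivatives\<close>

definition softmax :: "real \<Rightarrow> 't set \<Rightarrow> ('t \<Rightarrow> real) \<Rightarrow> 't \<Rightarrow> real" where
  "softmax \<beta> T l t = exp (\<beta> * l t) / (\<Sum>s\<in>T. exp (\<beta> * l s))"

definition log_sum_exp :: "real \<Rightarrow> 't set \<Rightarrow> ('t \<Rightarrow> real) \<Rightarrow> real" where
  "log_sum_exp \<beta> T l = ln (\<Sum>s\<in>T. exp (\<beta> * l s)) / \<beta>"

context
  fixes T :: "'t set" and \<beta> :: real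
  assumes T: "finite T" "T \<noteq> {}" and \<beta>: "\<beta> > 0"
begin

lemma sum_exp_pos: "0 < (\<Sum>s\<in>T. exp (\<beta> * l s))"
  using T by (intro sum_pos) auto

lemma sum_softmax: "(\<Sum>t\<in>T. softmax \<beta> T l t) = 1"
  using sum_exp_pos[of l] by (simp add: softmax_def sum_divide_distrib[symmetric])

lemma softmax_nonneg: "0 \<le> softmax \<beta> T l t"
  using sum_exp_pos[of l] by (simp add: softmax_def)

lemma softmax_le_1: "t \<in> T \<Longrightarrow> softmax \<beta> T l t \<le> 1"
  using sum_softmax[of l] member_le_sum[of t T "softmax \<beta> T l"] softmax_nonneg T by simp

lemma Max_le_log_sum_exp: "Max (l ` T) \<le> log_sum_exp \<beta> T l"
proof -
  have "l t \<le> log_sum_exp \<beta> T l" if "t \<in> T" for t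
  proof -
    have "exp (\<beta> * l t) \<le> (\<Sum>s\<in>T. exp (\<beta> * l s))"
      using T that by (intro member_le_sum) auto
    then have "\<beta> * l t \<le> ln (\<Sum>s\<in>T. exp (\<beta> * l s))"
      using sum_exp_pos by (simp add: ln_ge_iff)
    then show ?thesis
      using \<beta> by (simp add: log_sum_exp_def field_simps)
  qed
  then show ?thesis using T by simp
qed

lemma log_sum_exp_le_Max: "log_sum_exp \<beta> T l \<le> Max (l ` T) + ln (card T) / \<beta>"
proof -
  have "(\<Sum>s\<in>T. exp (\<beta> * l s)) \<le> (\<Sum>s\<in>T. exp (\<beta> * Max (l ` T)))"
    using T \<beta> by (intro sum_mono) auto
  then have "ln (\<Sum>s\<in>T. exp (\<beta> * l s)) \<le> ln (card T * exp (\<beta> * Max (l ` T)))"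
    using sum_exp_pos by (intro ln_mono) auto
  also have "\<dots> = ln (card T) + \<beta> * Max (l ` T)"
    using T by (subst ln_mult) (auto simp: card_gt_0_iff)
  finally show ?thesis
    using \<beta> by (simp add: log_sum_exp_def field_simps)
qed

lemma DERIV_sum_exp:
  assumes "\<And>t. t \<in> T \<Longrightarrow> ((\<lambda>x. l x t) has_real_derivative d t) (at x)"
  shows "((\<lambda>x. \<Sum>s\<in>T. exp (\<beta> * l x s)) has_real_derivative (\<Sum>s\<in>T. exp (\<beta> * l x s) * (\<beta> * d s))) (at x)"
  using assms by (intro DERIV_sum) (auto intro!: derivative_eq_intros)

lemma DERIV_log_sum_exp:
  assumes "\<And>t. t \<in> T \<Longrightarrow> ((\<lambda>x. l x t) has_real_derivative d t) (at x)"
  shows "((\<lambda>x. log_sum_exp \<beta> T (l x)) has_real_derivative (\<Sum>t\<in>T. softmax \<beta> T (l x) t * d t)) (at x)"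
proof -
  let ?S = "\<Sum>s\<in>T. exp (\<beta> * l x s)"
  have "((\<lambda>x. log_sum_exp \<beta> T (l x)) has_real_derivative ((\<Sum>s\<in>T. exp (\<beta> * l x s) * (\<beta> * d s)) / ?S) / \<beta>) (at x)"
    unfolding log_sum_exp_def using sum_exp_pos[of "l x"] \<beta>
    by (auto intro!: derivative_eq_intros DERIV_sum_exp assms simp: mult_ac)
  also have "((\<Sum>s\<in>T. exp (\<beta> * l x s) * (\<beta> * d s)) / ?S) / \<beta> = (\<Sum>t\<in>T. softmax \<beta> T (l x) t * d t)"
    unfolding softmax_def sum_divide_distrib using \<beta> by (intro sum.cong) auto
  finally show ?thesis .
qed

lemma DERIV_softmax:
  assumes d: "\<And>t. t \<in> T \<Longrightarrow> ((\<lambda>x. l x t) has_real_derivative d t) (at x)" and t: "t \<in> T"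
  shows "((\<lambda>x. softmax \<beta> T (l x) t) has_real_derivative
    \<beta> * softmax \<beta> T (l x) t * (d t - (\<Sum>s\<in>T. softmax \<beta> T (l x) s * d s))) (at x)"
proof -
  let ?S = "\<Sum>s\<in>T. exp (\<beta> * l x s)"
  let ?D = "\<Sum>s\<in>T. exp (\<beta> * l x s) * (\<beta> * d s)"
  have S: "?S > 0" by (rule sum_exp_pos)
  have "((\<lambda>x. softmax \<beta> T (l x) t) has_real_derivative
     (exp (\<beta> * l x t) * (\<beta> * d t) * ?S - exp (\<beta> * l x t) * ?D) / (?S * ?S)) (at x)"
    unfolding softmax_def using S
    by (auto intro!: derivative_eq_intros DERIV_sum_exp d t simp: mult_ac)
  also have "(exp (\<beta> * l x t) * (\<beta> * d t) * ?S - exp (\<beta> * l x t) * ?D) / (?S * ?S)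
     = \<beta> * (exp (\<beta> * l x t) / ?S) * (d t - ?D / ?S / \<beta>)"
    using S \<beta> by (simp add: field_simps)
  also have "?D / ?S / \<beta> = (\<Sum>s\<in>T. softmax \<beta> T (l x) s * d s)"
    unfolding softmax_def sum_divide_distrib using \<beta> by (intro sum.cong) auto
  finally show ?thesis
    by (simp add: softmax_def)
qed

end


section \<open>Linear forms and the interpolation behind the comparison inequality\<close>

definition lin_form :: "nat \<Rightarrow> (nat \<Rightarrow> real) \<Rightarrow> (nat \<Rightarrow> real) \<Rightarrow> real" where
  "lin_form k c z = (\<Sum>i<k. c i * z i)"

lemma measurable_lin_form: "lin_form k c \<in> borel_measurable (gauss_vec k)"
  unfolding lin_form_def[abs_def] by (rule measurable_gauss_vec_linear)

lemma integrable_lin_form: "integrable (gauss_vec k) (lin_form k c)"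
  unfolding lin_form_def[abs_def]
  by (intro Bochner_Integration.integrable_sum integrable_mult_right integrable_gauss_vec_component) auto

lemma measurable_Max_finite:
  fixes f :: "'t \<Rightarrow> 'a \<Rightarrow> real"
  assumes "finite T" "T \<noteq> {}" "\<And>t. t \<in> T \<Longrightarrow> f t \<in> borel_measurable M"
  shows "(\<lambda>z. Max ((\<lambda>t. f t z) ` T)) \<in> borel_measurable M"
  using assms
proof (induction rule: finite_ne_induct)
  case (insert t T)
  then have "(\<lambda>z. max (f t z) (Max ((\<lambda>t. f t z) ` T))) \<in> borel_measurable M"
    by (intro borel_measurable_max) auto
  with insert show ?case by simp
qed simp

lemma integrable_Max_finite:
  fixes f :: "'t \<Rightarrow> 'a \<Rightarrow> real"
  assumes "finite T" "T \<noteq> {}" "\<And>t. t \<in> T \<Longrightarrow> integrable M (f t)"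
  shows "integrable M (\<lambda>z. Max ((\<lambda>t. f t z) ` T))"
  using assms
proof (induction rule: finite_ne_induct)
  case (insert t T)
  then have "integrable M (\<lambda>z. max (f t z) (Max ((\<lambda>t. f t z) ` T)))"
    by (intro integrable_max) auto
  with insert show ?case by simp
qed simp

lemma lin_form_upd:
  "i < k \<Longrightarrow> ((\<lambda>w. lin_form k c (z(i := w))) has_real_derivative c i) (at w)"
proof -
  assume i: "i < k"
  have "(\<lambda>w. lin_form k c (z(i := w))) = (\<lambda>w. c i * w + (\<Sum>j\<in>{..<k} - {i}. c j * z j))"
    unfolding lin_form_def using i by (subst sum.remove[of _ i]) auto
  then show ?thesis
    by (auto intro!: derivative_eq_intros)
qed

text \<open>The interpolation argument: along $Z_\theta = \cos\theta\, X + \sin\theta\, Y$ the derivative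
  of the expected soft maximum is, by Stein's identity, a nonnegative combination of the
  differences of squared increments.\<close>

lemma integral_log_sum_exp_mono:
  fixes a b :: "'t \<Rightarrow> nat \<Rightarrow> real"
  assumes T: "finite T" "T \<noteq> {}" and \<beta>: "\<beta> > 0"
    and orth: "\<And>s t. s \<in> T \<Longrightarrow> t \<in> T \<Longrightarrow> (\<Sum>i<k. a s i * b t i) = 0"
    and inc: "\<And>s t. s \<in> T \<Longrightarrow> t \<in> T \<Longrightarrow> (\<Sum>i<k. (a s i - a t i)\<^sup>2) \<le> (\<Sum>i<k. (b s i - b t i)\<^sup>2)"
  shows "(\<integral>z. log_sum_exp \<beta> T (\<lambda>t. lin_form k (a t) z) \<partial>gauss_vec k)
    \<le> (\<integral>z. log_sum_exp \<beta> T (\<lambda>t. lin_form k (b t) z) \<partial>gauss_vec k)"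
proof -
  note [simp] = T(1)
  define c where "c \<theta> t i = cos \<theta> * a t i + sin \<theta> * b t i" for \<theta> t i
  define c' where "c' \<theta> t i = cos \<theta> * b t i - sin \<theta> * a t i" for \<theta> t i
  define F where "F \<theta> z = log_sum_exp \<beta> T (\<lambda>t. lin_form k (c \<theta> t) z)" for \<theta> z
  define p where "p \<theta> t z = softmax \<beta> T (\<lambda>t. lin_form k (c \<theta> t) z) t" for \<theta> t z
  define q where "q \<theta> i t z = \<beta> * p \<theta> t z * (c \<theta> t i - (\<Sum>s\<in>T. p \<theta> s z * c \<theta> s i))" for \<theta> i t z
  define F' where "F' \<theta> z = (\<Sum>t\<in>T. p \<theta> t z * lin_form k (c' \<theta> t) z)" for \<theta> z
  note lse = T \<beta>
  have p0: "0 \<le> p \<theta> t z" for \<theta> t z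
    unfolding p_def by (rule softmax_nonneg[OF lse])
  have p1: "t \<in> T \<Longrightarrow> p \<theta> t z \<le> 1" for \<theta> t z
    unfolding p_def by (rule softmax_le_1[OF lse])
  have psum: "(\<Sum>t\<in>T. p \<theta> t z) = 1" for \<theta> z
    unfolding p_def by (rule sum_softmax[OF lse])
  have lm: "(\<lambda>z. lin_form k c z) \<in> borel_measurable (gauss_vec k)" for c
    by (rule measurable_lin_form)
  have Fm: "F \<theta> \<in> borel_measurable (gauss_vec k)" for \<theta>
    unfolding F_def log_sum_exp_def
    by (intro borel_measurable_divide borel_measurable_ln borel_measurable_sum borel_measurable_exp
        borel_measurable_times lm borel_measurable_const measurable_compose[OF _ borel_measurable_exp])
  have pm: "p \<theta> t \<in> borel_measurable (gauss_vec k)" for \<theta> t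
    unfolding p_def softmax_def
    by (intro borel_measurable_divide borel_measurable_sum
        borel_measurable_times lm borel_measurable_const measurable_compose[OF _ borel_measurable_exp])
  have qm: "q \<theta> i t \<in> borel_measurable (gauss_vec k)" for \<theta> i t
    unfolding q_def by (intro borel_measurable_times borel_measurable_diff borel_measurable_sum pm borel_measurable_const)
  have F'm: "F' \<theta> \<in> borel_measurable (gauss_vec k)" for \<theta>
    unfolding F'_def by (intro borel_measurable_times borel_measurable_sum pm lm)
  have Fi: "integrable (gauss_vec k) (F \<theta>)" for \<theta>
  proof (rule Bochner_Integration.integrable_bound[OF _ Fm])
    let ?M = "\<lambda>z. Max ((\<lambda>t. lin_form k (c \<theta> t) z) ` T)"
    show "integrable (gauss_vec k) (\<lambda>z. \<bar>?M z\<bar> + \<bar>ln (card T) / \<beta>\<bar>)"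
      using T by (intro Bochner_Integration.integrable_add integrable_abs integrable_Max_finite integrable_lin_form) auto
    show "AE z in gauss_vec k. norm (F \<theta> z) \<le> norm (\<bar>?M z\<bar> + \<bar>ln (card T) / \<beta>\<bar>)"
    proof (rule AE_I2)
      fix z
      show "norm (F \<theta> z) \<le> norm (\<bar>?M z\<bar> + \<bar>ln (card T) / \<beta>\<bar>)"
        using Max_le_log_sum_exp[OF lse, of "\<lambda>t. lin_form k (c \<theta> t) z"]
          log_sum_exp_le_Max[OF lse, of "\<lambda>t. lin_form k (c \<theta> t) z"]
        unfolding F_def real_norm_def by linarith
    qed
  qed
  have Fd: "((\<lambda>\<theta>. F \<theta> z) has_real_derivative F' \<theta> z) (at \<theta>)" for \<theta> z
    unfolding F_def F'_def p_def
  proof (rule DERIV_log_sum_exp[OF lse])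
    show "((\<lambda>\<theta>. lin_form k (c \<theta> t) z) has_real_derivative lin_form k (c' \<theta> t) z) (at \<theta>)" for t
      unfolding lin_form_def c_def c'_def
      by (intro DERIV_sum) (auto intro!: derivative_eq_intros simp: algebra_simps)
  qed
  define g where "g z = (\<Sum>t\<in>T. \<Sum>i<k. (\<bar>a t i\<bar> + \<bar>b t i\<bar>) * \<bar>z i\<bar>)" for z :: "nat \<Rightarrow> real"
  have gi: "integrable (gauss_vec k) g"
    unfolding g_def by (intro Bochner_Integration.integrable_sum integrable_mult_right integrable_abs integrable_gauss_vec_component) auto
  have F'b: "\<bar>F' \<theta> z\<bar> \<le> g z" for \<theta> z
  proof -
    have "\<bar>F' \<theta> z\<bar> \<le> (\<Sum>t\<in>T. \<bar>p \<theta> t z * lin_form k (c' \<theta> t) z\<bar>)"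
      unfolding F'_def by (rule sum_abs)
    also have "\<dots> \<le> (\<Sum>t\<in>T. \<Sum>i<k. (\<bar>a t i\<bar> + \<bar>b t i\<bar>) * \<bar>z i\<bar>)"
    proof (rule sum_mono)
      fix t assume t: "t \<in> T"
      have "\<bar>p \<theta> t z * lin_form k (c' \<theta> t) z\<bar> \<le> 1 * \<bar>lin_form k (c' \<theta> t) z\<bar>"
        unfolding abs_mult using p0 p1[OF t] by (intro mult_right_mono) auto
      also have "\<dots> \<le> (\<Sum>i<k. \<bar>c' \<theta> t i * z i\<bar>)"
        unfolding lin_form_def by (simp add: sum_abs)
      also have "\<dots> \<le> (\<Sum>i<k. (\<bar>a t i\<bar> + \<bar>b t i\<bar>) * \<bar>z i\<bar>)"
      proof (rule sum_mono)
        fix i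
        have "\<bar>c' \<theta> t i\<bar> \<le> \<bar>cos \<theta> * b t i\<bar> + \<bar>sin \<theta> * a t i\<bar>"
          unfolding c'_def by linarith
        also have "\<dots> \<le> 1 * \<bar>b t i\<bar> + 1 * \<bar>a t i\<bar>"
          unfolding abs_mult by (intro add_mono mult_right_mono) auto
        finally show "\<bar>c' \<theta> t i * z i\<bar> \<le> (\<bar>a t i\<bar> + \<bar>b t i\<bar>) * \<bar>z i\<bar>"
          unfolding abs_mult by (intro mult_right_mono) auto
      qed
      finally show "\<bar>p \<theta> t z * lin_form k (c' \<theta> t) z\<bar> \<le> (\<Sum>i<k. (\<bar>a t i\<bar> + \<bar>b t i\<bar>) * \<bar>z i\<bar>)" .
    qed
    finally show ?thesis unfolding g_def .
  qed
  have stein: "integrable (gauss_vec k) (\<lambda>z. z i * p \<theta> t z)" "integrable (gauss_vec k) (q \<theta> i t)"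
    "(\<integral>z. z i * p \<theta> t z \<partial>gauss_vec k) = (\<integral>z. q \<theta> i t z \<partial>gauss_vec k)"
    if i: "i < k" and t: "t \<in> T" for i t \<theta>
  proof -
    \<comment> \<open>A single constant dominating both a weight and its derivative, the form in
      which \<open>stein_identity_gauss_vec\<close> takes its bounds.\<close>
    define B where "B = 1 + \<beta> * (\<Sum>s\<in>T. 2 * \<bar>c \<theta> s i\<bar>)"
    have pd: "((\<lambda>w. p \<theta> s (z(i := w))) has_real_derivative q \<theta> i s (z(i := w))) (at w)" if "s \<in> T" for s z w
      unfolding p_def q_def by (intro DERIV_softmax[OF lse] lin_form_upd i that)
    have qc: "continuous_on UNIV (\<lambda>w. q \<theta> i t (z(i := w)))" for z
    proof -
      have "continuous_on UNIV (\<lambda>w. p \<theta> s (z(i := w)))" if "s \<in> T" for s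
        using pd[OF that] by (meson DERIV_isCont continuous_at_imp_continuous_on)
      then show ?thesis
        unfolding q_def using t by (intro continuous_intros) auto
    qed
    have pB: "\<bar>p \<theta> t z\<bar> \<le> B" for z
    proof -
      have "0 \<le> \<beta> * (\<Sum>s\<in>T. 2 * \<bar>c \<theta> s i\<bar>)"
        using \<beta> by (intro mult_nonneg_nonneg sum_nonneg) auto
      then show ?thesis
        using p0[of \<theta> t z] p1[OF t, of \<theta> z] by (simp add: B_def)
    qed
    have qB: "\<bar>q \<theta> i t z\<bar> \<le> B" for z
    proof -
      have "\<bar>\<Sum>s\<in>T. p \<theta> s z * c \<theta> s i\<bar> \<le> (\<Sum>s\<in>T. \<bar>p \<theta> s z * c \<theta> s i\<bar>)"
        by (rule sum_abs)
      also have "\<dots> \<le> (\<Sum>s\<in>T. 1 * \<bar>c \<theta> s i\<bar>)"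
        unfolding abs_mult using p0 p1 by (intro sum_mono mult_right_mono) auto
      finally have 1: "\<bar>\<Sum>s\<in>T. p \<theta> s z * c \<theta> s i\<bar> \<le> (\<Sum>s\<in>T. \<bar>c \<theta> s i\<bar>)" by simp
      have 2: "\<bar>c \<theta> t i\<bar> \<le> (\<Sum>s\<in>T. \<bar>c \<theta> s i\<bar>)"
        using t by (intro member_le_sum) auto
      have "\<bar>q \<theta> i t z\<bar> = \<beta> * (p \<theta> t z * \<bar>c \<theta> t i - (\<Sum>s\<in>T. p \<theta> s z * c \<theta> s i)\<bar>)"
        unfolding q_def abs_mult using \<beta> p0 by simp
      also have "\<dots> \<le> \<beta> * (1 * (2 * (\<Sum>s\<in>T. \<bar>c \<theta> s i\<bar>)))"
        using \<beta> p0 p1[OF t] 1 2 by (intro mult_left_mono mult_mono) auto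
      finally show ?thesis
        unfolding B_def by (simp add: sum_distrib_left)
    qed
    show "integrable (gauss_vec k) (\<lambda>z. z i * p \<theta> t z)" "integrable (gauss_vec k) (q \<theta> i t)"
      "(\<integral>z. z i * p \<theta> t z \<partial>gauss_vec k) = (\<integral>z. q \<theta> i t z \<partial>gauss_vec k)"
      using stein_identity_gauss_vec[OF i pd[OF t] qc pB qB pm qm] by blast+
  qed
  have F'_int: "(\<integral>z. F' \<theta> z \<partial>gauss_vec k) \<ge> 0" if \<theta>: "0 \<le> \<theta>" "\<theta> \<le> pi / 2" for \<theta>
  proof -
    define \<Gamma> where "\<Gamma> t s = (\<Sum>i<k. c' \<theta> t i * c \<theta> s i)" for t s
    have F': "F' \<theta> z = (\<Sum>t\<in>T. \<Sum>i<k. c' \<theta> t i * (z i * p \<theta> t z))" for z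
      unfolding F'_def lin_form_def sum_distrib_left by (intro sum.cong) auto
    have int_sum: "(\<integral>z. (\<Sum>t\<in>T. \<Sum>i<k. c' \<theta> t i * f t i z) \<partial>gauss_vec k)
        = (\<Sum>t\<in>T. \<Sum>i<k. c' \<theta> t i * (\<integral>z. f t i z \<partial>gauss_vec k))"
      if f: "\<And>t i. t \<in> T \<Longrightarrow> i < k \<Longrightarrow> integrable (gauss_vec k) (f t i)" for f
    proof -
      have "(\<integral>z. (\<Sum>t\<in>T. \<Sum>i<k. c' \<theta> t i * f t i z) \<partial>gauss_vec k)
          = (\<Sum>t\<in>T. \<integral>z. (\<Sum>i<k. c' \<theta> t i * f t i z) \<partial>gauss_vec k)"
        by (intro Bochner_Integration.integral_sum Bochner_Integration.integrable_sum integrable_mult_right f) auto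
      also have "\<dots> = (\<Sum>t\<in>T. \<Sum>i<k. \<integral>z. c' \<theta> t i * f t i z \<partial>gauss_vec k)"
        by (intro sum.cong refl Bochner_Integration.integral_sum integrable_mult_right f) auto
      finally show ?thesis by simp
    qed
    have "(\<integral>z. F' \<theta> z \<partial>gauss_vec k) = (\<Sum>t\<in>T. \<Sum>i<k. c' \<theta> t i * (\<integral>z. z i * p \<theta> t z \<partial>gauss_vec k))"
      unfolding F' by (intro int_sum stein(1))
    also have "\<dots> = (\<Sum>t\<in>T. \<Sum>i<k. c' \<theta> t i * (\<integral>z. q \<theta> i t z \<partial>gauss_vec k))"
      by (intro sum.cong) (auto simp: stein(3))
    also have "\<dots> = (\<integral>z. (\<Sum>t\<in>T. \<Sum>i<k. c' \<theta> t i * q \<theta> i t z) \<partial>gauss_vec k)"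
      by (intro int_sum[symmetric] stein(2))
    also have "\<dots> \<ge> 0"
    proof (rule Bochner_Integration.integral_nonneg)
      fix z
      define P where "P t = p \<theta> t z" for t
      have Ps: "(\<Sum>t\<in>T. P t) = 1"
        unfolding P_def by (rule psum)
      have "(\<Sum>t\<in>T. \<Sum>i<k. c' \<theta> t i * q \<theta> i t z)
          = (\<Sum>t\<in>T. \<Sum>i<k. \<beta> * (P t * (c' \<theta> t i * c \<theta> t i) - (\<Sum>s\<in>T. P t * P s * (c' \<theta> t i * c \<theta> s i))))"
        unfolding q_def P_def by (intro sum.cong refl) (simp add: algebra_simps sum_distrib_left)
      also have "\<dots> = \<beta> * (\<Sum>t\<in>T. P t * \<Gamma> t t - (\<Sum>s\<in>T. P t * P s * \<Gamma> t s))"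
        unfolding \<Gamma>_def sum_distrib_left[symmetric]
      proof (intro arg_cong[where f = "(*) \<beta>"] sum.cong refl)
        fix t
        have "(\<Sum>i<k. \<Sum>s\<in>T. P t * P s * (c' \<theta> t i * c \<theta> s i)) = (\<Sum>s\<in>T. P t * P s * (\<Sum>i<k. c' \<theta> t i * c \<theta> s i))"
          unfolding sum_distrib_left by (rule sum.swap)
        then show "(\<Sum>i<k. P t * (c' \<theta> t i * c \<theta> t i) - (\<Sum>s\<in>T. P t * P s * (c' \<theta> t i * c \<theta> s i)))
            = P t * (\<Sum>i<k. c' \<theta> t i * c \<theta> t i) - (\<Sum>s\<in>T. P t * P s * (\<Sum>i<k. c' \<theta> t i * c \<theta> s i))"
          by (simp add: sum_subtractf sum_distrib_left)
      qed
      also have "(\<Sum>t\<in>T. P t * \<Gamma> t t - (\<Sum>s\<in>T. P t * P s * \<Gamma> t s))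
          = (\<Sum>t\<in>T. \<Sum>s\<in>T. P t * P s * (\<Gamma> t t - \<Gamma> t s))"
      proof (rule sum.cong[OF refl])
        fix t
        have "P t * \<Gamma> t t = (\<Sum>s\<in>T. P s) * (P t * \<Gamma> t t)"
          by (simp add: Ps)
        then show "P t * \<Gamma> t t - (\<Sum>s\<in>T. P t * P s * \<Gamma> t s) = (\<Sum>s\<in>T. P t * P s * (\<Gamma> t t - \<Gamma> t s))"
          by (simp add: sum_distrib_left sum_distrib_right right_diff_distrib sum_subtractf mult_ac)
      qed
      \<comment> \<open>Averaging with the same sum after exchanging \<open>s\<close> and
        \<open>t\<close> completes the summand to an inner product of increments, between
        \<open>c' \<theta>\<close> and \<open>c \<theta>\<close>. This is why increments alone, and
        not variances, have to be compared.\<close>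
      also have "\<dots> = (\<Sum>t\<in>T. \<Sum>s\<in>T. P t * P s * (\<Gamma> t t - \<Gamma> t s + (\<Gamma> s s - \<Gamma> s t))) / 2"
      proof -
        have "(\<Sum>t\<in>T. \<Sum>s\<in>T. P t * P s * (\<Gamma> t t - \<Gamma> t s)) = (\<Sum>t\<in>T. \<Sum>s\<in>T. P t * P s * (\<Gamma> s s - \<Gamma> s t))"
          by (subst sum.swap) (simp add: mult.commute)
        then show ?thesis
          by (simp add: distrib_left sum.distrib)
      qed
      also have "\<beta> * (\<dots>) \<ge> 0"
      proof (intro mult_nonneg_nonneg divide_nonneg_nonneg sum_nonneg)
        fix t s assume ts: "t \<in> T" "s \<in> T"
        have "\<Gamma> t t - \<Gamma> t s + (\<Gamma> s s - \<Gamma> s t) = (\<Sum>i<k. (c' \<theta> t i - c' \<theta> s i) * (c \<theta> t i - c \<theta> s i))"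
          unfolding \<Gamma>_def by (simp add: sum_subtractf[symmetric] sum.distrib[symmetric] algebra_simps)
        also have "\<dots> = (\<Sum>i<k. sin \<theta> * cos \<theta> * ((b t i - b s i)\<^sup>2 - (a t i - a s i)\<^sup>2)
            + ((cos \<theta>)\<^sup>2 - (sin \<theta>)\<^sup>2) * (a t i * b t i - a t i * b s i - a s i * b t i + a s i * b s i))"
          unfolding c_def c'_def by (intro sum.cong refl) (simp add: power2_eq_square algebra_simps)
        \<comment> \<open>The mixed terms carry the factor \<open>cos^2 - sin^2\<close> of
          indefinite sign; orthogonality of the two families, that is independence of the two
          processes, removes them.\<close>
        also have "\<dots> = sin \<theta> * cos \<theta> * ((\<Sum>i<k. (b t i - b s i)\<^sup>2) - (\<Sum>i<k. (a t i - a s i)\<^sup>2))"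
        proof -
          have "(\<Sum>i<k. a t i * b t i - a t i * b s i - a s i * b t i + a s i * b s i) = 0"
            using ts by (simp add: sum.distrib sum_subtractf orth)
          then show ?thesis
            by (simp add: sum.distrib sum_distrib_left[symmetric] sum_subtractf[symmetric])
        qed
        also have "\<dots> \<ge> 0"
          using \<theta> inc[OF ts] by (intro mult_nonneg_nonneg sin_ge_zero cos_ge_zero) auto
        finally show "0 \<le> \<Gamma> t t - \<Gamma> t s + (\<Gamma> s s - \<Gamma> s t)" .
      qed (use \<beta> p0 in \<open>auto simp: P_def\<close>)
      finally show "0 \<le> (\<Sum>t\<in>T. \<Sum>i<k. c' \<theta> t i * q \<theta> i t z)" .
    qed
    finally show ?thesis .
  qed
  have "(\<integral>z. F 0 z \<partial>gauss_vec k) \<le> (\<integral>z. F (pi / 2) z \<partial>gauss_vec k)"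
  proof (rule DERIV_nonneg_imp_nondecreasing[of 0 "pi / 2" "\<lambda>\<theta>. \<integral>z. F \<theta> z \<partial>gauss_vec k"])
    fix \<theta> assume "0 \<le> \<theta>" "\<theta> \<le> pi / 2"
    then show "\<exists>y. ((\<lambda>\<theta>. \<integral>z. F \<theta> z \<partial>gauss_vec k) has_real_derivative y) (at \<theta>) \<and> 0 \<le> y"
      using has_real_derivative_integral[OF Fi Fd F'b gi F'm] F'_int by blast
  qed simp
  then show ?thesis
    by (simp add: F_def c_def[abs_def])
qed


text \<open>An injective selection of coordinates of a Gaussian vector is again a Gaussian vector.
  The last and the first block are the two selections that place independent processes on one
  space.\<close>

lemma integral_gauss_vec_block:
  fixes f :: "(nat \<Rightarrow> real) \<Rightarrow> real"
  assumes f: "f \<in> borel_measurable (gauss_vec k)"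
  shows "(\<integral>z. f (\<lambda>i\<in>{..<k}. z (i + l)) \<partial>gauss_vec (k + l)) = (\<integral>z. f z \<partial>gauss_vec k)"
    "(\<integral>z. f (\<lambda>i\<in>{..<k}. z i) \<partial>gauss_vec (k + l)) = (\<integral>z. f z \<partial>gauss_vec k)"
proof -
  have *: "(\<integral>z. f (\<lambda>i\<in>{..<k}. z (h i)) \<partial>gauss_vec (k + l)) = (\<integral>z. f z \<partial>gauss_vec k)"
    if h: "inj_on h {..<k}" "h \<in> {..<k} \<rightarrow> {..<k + l}" for h
  proof -
    have d: "distr (gauss_vec (k + l)) (gauss_vec k) (\<lambda>z. \<lambda>i\<in>{..<k}. z (h i)) = gauss_vec k"
      unfolding gauss_vec_def using distr_PiM_reindex[OF _ h, where M = "\<lambda>_. std_gauss"]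
      by (simp add: prob_space_std_gauss)
    have m: "(\<lambda>z. \<lambda>i\<in>{..<k}. z (h i)) \<in> gauss_vec (k + l) \<rightarrow>\<^sub>M gauss_vec k"
      unfolding gauss_vec_def using h(2) by (intro measurable_restrict measurable_component_singleton) auto
    show ?thesis
      using integral_distr[OF m f] d by simp
  qed
  show "(\<integral>z. f (\<lambda>i\<in>{..<k}. z (i + l)) \<partial>gauss_vec (k + l)) = (\<integral>z. f z \<partial>gauss_vec k)"
    by (rule *) auto
  show "(\<integral>z. f (\<lambda>i\<in>{..<k}. z i) \<partial>gauss_vec (k + l)) = (\<integral>z. f z \<partial>gauss_vec k)"
    by (rule *) auto
qed

text \<open>The processes are made independent by disjoint coordinate blocks, compared through their
  soft maxima, and the soft maximum differs from the maximum by at most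
  \<open>ln (card T) / \<beta>\<close>, which is arbitrarily small.\<close>

theorem sudakov_fernique:
  fixes a b :: "'t \<Rightarrow> nat \<Rightarrow> real"
  assumes T: "finite T" "T \<noteq> {}"
    and inc: "\<And>s t. s \<in> T \<Longrightarrow> t \<in> T \<Longrightarrow> (\<Sum>i<k. (a s i - a t i)\<^sup>2) \<le> (\<Sum>i<l. (b s i - b t i)\<^sup>2)"
  shows "(\<integral>z. Max ((\<lambda>t. lin_form k (a t) z) ` T) \<partial>gauss_vec k)
    \<le> (\<integral>z. Max ((\<lambda>t. lin_form l (b t) z) ` T) \<partial>gauss_vec l)"
proof -
  \<comment> \<open>\<open>A\<close> lives on the last \<open>k\<close> coordinates and
    \<open>B\<close> on the first \<open>l\<close>, so every product \<open>A s i * B t i\<close>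
    vanishes.\<close>
  define A where "A t i = (if i < l then 0 else a t (i - l))" for t i
  define B where "B t i = (if i < l then b t i else 0)" for t i
  let ?N = "gauss_vec (k + l)"
  have split: "(\<Sum>i<k + l. f i) = (\<Sum>i<k. f (i + l)) + (\<Sum>i<l. f i)" for f :: "nat \<Rightarrow> real"
  proof -
    have "(\<Sum>i<k + l. f i) = (\<Sum>i<l. f i) + (\<Sum>i=l..<k + l. f i)"
      using sum.atLeastLessThan_concat[of 0 l "k + l" f] by (simp add: atLeast0LessThan)
    also have "(\<Sum>i=l..<k + l. f i) = (\<Sum>i<k. f (i + l))"
      using sum.shift_bounds_nat_ivl[of f 0 l k] by (simp add: atLeast0LessThan)
    finally show ?thesis by simp
  qed
  have A: "lin_form (k + l) (A t) z = lin_form k (a t) (\<lambda>i\<in>{..<k}. z (i + l))" for t z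
    unfolding lin_form_def split by (simp add: A_def)
  have B: "lin_form (k + l) (B t) z = lin_form l (b t) (\<lambda>i\<in>{..<l}. z i)" for t z
    unfolding lin_form_def split by (simp add: B_def)
  have MA: "(\<integral>z. Max ((\<lambda>t. lin_form (k + l) (A t) z) ` T) \<partial>?N)
      = (\<integral>z. Max ((\<lambda>t. lin_form k (a t) z) ` T) \<partial>gauss_vec k)"
    unfolding A by (rule integral_gauss_vec_block(1)) (intro measurable_Max_finite T measurable_lin_form)
  have MB: "(\<integral>z. Max ((\<lambda>t. lin_form (k + l) (B t) z) ` T) \<partial>?N)
      = (\<integral>z. Max ((\<lambda>t. lin_form l (b t) z) ` T) \<partial>gauss_vec l)"
    unfolding B unfolding add.commute[of k l]
    by (rule integral_gauss_vec_block(2)) (intro measurable_Max_finite T measurable_lin_form)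
  have orth: "(\<Sum>i<k + l. A s i * B t i) = 0" for s t
    by (intro sum.neutral) (auto simp: A_def B_def)
  have inc': "(\<Sum>i<k + l. (A s i - A t i)\<^sup>2) \<le> (\<Sum>i<k + l. (B s i - B t i)\<^sup>2)" if "s \<in> T" "t \<in> T" for s t
    using inc[OF that] unfolding split by (simp add: A_def B_def)
  have i: "integrable ?N (\<lambda>z. Max ((\<lambda>t. lin_form (k + l) (c t) z) ` T))" for c
    by (intro integrable_Max_finite T integrable_lin_form)
  let ?L = "\<lambda>\<beta> c z. log_sum_exp \<beta> T (\<lambda>t. lin_form (k + l) (c t) z)"
  have Li: "integrable ?N (?L \<beta> c)" if \<beta>: "\<beta> > 0" for \<beta> c
  proof (rule Bochner_Integration.integrable_bound)
    let ?M = "\<lambda>z. Max ((\<lambda>t. lin_form (k + l) (c t) z) ` T)"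
    show "integrable ?N (\<lambda>z. \<bar>?M z\<bar> + \<bar>ln (card T) / \<beta>\<bar>)"
      by (intro Bochner_Integration.integrable_add integrable_abs i) auto
    show "?L \<beta> c \<in> borel_measurable ?N"
      unfolding log_sum_exp_def
      by (intro borel_measurable_divide borel_measurable_ln borel_measurable_sum
          borel_measurable_times measurable_lin_form borel_measurable_const measurable_compose[OF _ borel_measurable_exp])
    show "AE z in ?N. norm (?L \<beta> c z) \<le> norm (\<bar>?M z\<bar> + \<bar>ln (card T) / \<beta>\<bar>)"
    proof (rule AE_I2)
      fix z
      show "norm (?L \<beta> c z) \<le> norm (\<bar>?M z\<bar> + \<bar>ln (card T) / \<beta>\<bar>)"
        using Max_le_log_sum_exp[OF T \<beta>, of "\<lambda>t. lin_form (k + l) (c t) z"]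
          log_sum_exp_le_Max[OF T \<beta>, of "\<lambda>t. lin_form (k + l) (c t) z"]
        unfolding real_norm_def by linarith
    qed
  qed
  have "(\<integral>z. Max ((\<lambda>t. lin_form (k + l) (A t) z) ` T) \<partial>?N)
     \<le> (\<integral>z. Max ((\<lambda>t. lin_form (k + l) (B t) z) ` T) \<partial>?N) + e" if e: "e > 0" for e
  proof -
    \<comment> \<open>The summand 1 keeps \<open>\<beta>\<close> positive when \<open>T\<close> is a
      singleton and still leaves an error of at most \<open>e\<close>.\<close>
    define \<beta> where "\<beta> = (ln (card T) + 1) / e"
    have cT: "real (card T) \<ge> 1"
      using T by (simp add: Suc_le_eq card_gt_0_iff)
    have ln0: "ln (real (card T)) \<ge> 0"
      by (rule ln_ge_zero[OF cT])
    have \<beta>: "\<beta> > 0"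
      using e ln0 by (simp add: \<beta>_def)
    have "ln (card T) / \<beta> = e * (ln (card T) / (ln (card T) + 1))"
      by (simp add: \<beta>_def)
    also have "\<dots> \<le> e * 1"
      using e ln0 by (intro mult_left_mono) (auto simp: divide_le_eq)
    finally have \<beta>e: "ln (card T) / \<beta> \<le> e"
      by simp
    have "(\<integral>z. Max ((\<lambda>t. lin_form (k + l) (A t) z) ` T) \<partial>?N) \<le> (\<integral>z. ?L \<beta> A z \<partial>?N)"
      by (intro integral_mono i Li \<beta> Max_le_log_sum_exp T)
    also have "\<dots> \<le> (\<integral>z. ?L \<beta> B z \<partial>?N)"
      by (intro integral_log_sum_exp_mono T \<beta> orth inc')
    also have "\<dots> \<le> (\<integral>z. Max ((\<lambda>t. lin_form (k + l) (B t) z) ` T) + ln (card T) / \<beta> \<partial>?N)"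
      by (intro integral_mono Li \<beta> log_sum_exp_le_Max T Bochner_Integration.integrable_add i) auto
    also have "\<dots> = (\<integral>z. Max ((\<lambda>t. lin_form (k + l) (B t) z) ` T) \<partial>?N) + ln (card T) / \<beta>"
      using i by (subst Bochner_Integration.integral_add) (auto simp: gauss_vec.prob_space)
    finally show ?thesis using \<beta>e by linarith
  qed
  then show ?thesis
    unfolding MA MB by (rule field_le_epsilon)
qed

subsection \<open>Geodesic distance\<close>

definition sqdist :: "nat \<Rightarrow> (nat \<Rightarrow> real) \<Rightarrow> (nat \<Rightarrow> real) \<Rightarrow> real" where
  "sqdist n x y = (\<Sum>i\<le>n. (x i - y i)\<^sup>2)"

lemma sqdist_nonneg: "0 \<le> sqdist n x y"
  unfolding sqdist_def by (intro sum_nonneg) auto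

lemma sphere_sum_squares: "x \<in> sphere_n n \<Longrightarrow> (\<Sum>i\<le>n. (x i)\<^sup>2) = 1"
  using sinner_sphere[of x n] by (simp only: lessThan_Suc_atMost)

lemma sinner_abs_le_1:
  assumes "x \<in> sphere_n n" "y \<in> sphere_n n"
  shows "\<bar>sinner n x y\<bar> \<le> 1"
  using Cauchy_Schwarz_ineq_sum[of x y "{..n}"] assms
  by (simp add: sinner_def sphere_sum_squares abs_square_le_1[symmetric])

lemma sqdist_sphere:
  assumes "x \<in> sphere_n n" "y \<in> sphere_n n"
  shows "sqdist n x y = 2 - 2 * sinner n x y"
proof -
  have "sqdist n x y = (\<Sum>i\<le>n. (x i)\<^sup>2) + (\<Sum>i\<le>n. (y i)\<^sup>2) - 2 * sinner n x y"
    unfolding sqdist_def sinner_def sum_distrib_left sum.distrib[symmetric] sum_subtractf[symmetric]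
    by (intro sum.cong refl) (simp add: power2_eq_square algebra_simps)
  then show ?thesis
    using assms by (simp add: sphere_sum_squares)
qed

lemma sdist_sym: "sdist n x y = sdist n y x"
  by (simp add: sdist_def sinner_def mult.commute)

lemma sdist_self: "x \<in> sphere_n n \<Longrightarrow> sdist n x x = 0"
  by (simp add: sdist_def sphere_n_def)

lemma sdist_nonneg: "x \<in> sphere_n n \<Longrightarrow> y \<in> sphere_n n \<Longrightarrow> 0 \<le> sdist n x y"
  using sinner_abs_le_1[of x n y] by (simp add: sdist_def arccos_lbound abs_le_iff)

text \<open>A hyperplane that separates \<open>x\<close> from \<open>z\<close> separates
  \<open>x\<close> from \<open>y\<close> or \<open>y\<close> from \<open>z\<close>; since distances
  are crossing probabilities, subadditivity of measure is the triangle inequality.\<close>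

lemma sdist_triangle:
  assumes x: "x \<in> sphere_n n" and y: "y \<in> sphere_n n" and z: "z \<in> sphere_n n"
  shows "sdist n x z \<le> sdist n x y + sdist n y z"
proof -
  let ?M = "gauss_vec (Suc n)"
  have m: "{g \<in> space ?M. crosses n u v g} \<in> sets ?M" for u v
    using measurable_crosses[of n u v] unfolding pred_def .
  have "measure ?M {g \<in> space ?M. crosses n x z g}
     \<le> measure ?M ({g \<in> space ?M. crosses n x y g} \<union> {g \<in> space ?M. crosses n y z g})"
    by (intro gauss_vec.finite_measure_mono sets.Un m) (auto simp: crosses_def)
  also have "\<dots> \<le> measure ?M {g \<in> space ?M. crosses n x y g} + measure ?M {g \<in> space ?M. crosses n y z g}"
    by (intro measure_Un_le m)
  finally show ?thesis
    using assms by (simp add: prob_crosses)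
qed

lemma sdist_diff_le:
  assumes "x \<in> sphere_n n" "y \<in> sphere_n n" "x' \<in> sphere_n n" "y' \<in> sphere_n n"
  shows "\<bar>sdist n x y - sdist n x' y'\<bar> \<le> sdist n x x' + sdist n y y'"
  using sdist_triangle[of x n x' y] sdist_triangle[of x' n y' y]
    sdist_triangle[of x' n x y'] sdist_triangle[of x n y y'] assms
    sdist_sym[of n x x'] sdist_sym[of n y y'] by linarith

text \<open>\<open>2 - 2 * cos u\<close> is the squared chord of the angle \<open>u\<close>, so this
  bounds the normalized angle by the chord. For an obtuse angle the left side is at most 1 and the
  right side at least 2; otherwise the half-angle formula reduces to
  \<open>v / pi \<le> sin v\<close> on \<open>[0, pi / 4]\<close>, a mean value estimate.\<close>

lemma one_minus_cos_ge:
  assumes "0 \<le> u" "u \<le> pi"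
  shows "(u / pi)\<^sup>2 \<le> 2 - 2 * cos u"
proof (cases "u \<le> pi / 2")
  case False
  then have "cos u \<le> 0"
    using assms cos_monotone_0_pi_le[of "pi / 2" u] by simp
  moreover have "(u / pi)\<^sup>2 \<le> 1\<^sup>2"
    using assms by (intro power_mono) auto
  ultimately show ?thesis by simp
next
  case True
  define v where "v = u / 2"
  have v: "0 \<le> v" "v \<le> pi / 4"
    using True assms by (auto simp: v_def)
  have "v / pi \<le> sin v"
  proof (cases "v = 0")
    case False
    then have "0 < v" using v by simp
    obtain \<xi> where \<xi>: "0 < \<xi>" "\<xi> < v" "sin v - sin 0 = (v - 0) * cos \<xi>"
      using MVT2[OF \<open>0 < v\<close>, of sin cos] by (auto intro: DERIV_sin)
    have "cos (pi / 4) \<le> cos \<xi>"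
      using \<xi> v by (intro cos_monotone_0_pi_le) auto
    moreover have "1 / pi \<le> sqrt 2 / 2"
    proof -
      have "1 \<le> sqrt 2" by simp
      have "2 * 1 \<le> pi * sqrt 2"
        using pi_gt3 by (intro mult_mono) auto
      then show ?thesis by (simp add: field_simps)
    qed
    ultimately have "1 / pi \<le> cos \<xi>"
      by (simp add: cos_45)
    then have "v * (1 / pi) \<le> v * cos \<xi>"
      using v by (intro mult_left_mono) auto
    then show ?thesis
      using \<xi> by simp
  qed simp
  then have "(v / pi)\<^sup>2 \<le> (sin v)\<^sup>2"
    using v by (intro power_mono) auto
  moreover have "cos u = 1 - 2 * (sin v)\<^sup>2"
    unfolding v_def using cos_double_sin[of "u / 2"] by simp
  ultimately show ?thesis
    by (simp add: v_def power_divide)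
qed

lemma sdist_le_sqrt_sqdist:
  assumes "x \<in> sphere_n n" "y \<in> sphere_n n"
  shows "sdist n x y \<le> sqrt (sqdist n x y)"
proof (rule real_le_rsqrt)
  have "- 1 \<le> sinner n x y" "sinner n x y \<le> 1"
    using sinner_abs_le_1[OF assms] by linarith+
  then show "(sdist n x y)\<^sup>2 \<le> sqdist n x y"
    using one_minus_cos_ge[of "arccos (sinner n x y)"] assms
    by (simp add: sdist_def sqdist_sphere arccos_lbound arccos_ubound)
qed

subsection \<open>Nets of sparse vectors\<close>

text \<open>Coordinates are rounded away from zero, so that a vector and its cell have the same support.\<close>

definition cell :: "nat \<Rightarrow> real \<Rightarrow> (nat \<Rightarrow> real) \<Rightarrow> nat \<Rightarrow> int" where
  "cell n h x = (\<lambda>i\<in>{..n}. if x i > 0 then \<lceil>x i / h\<rceil> else \<lfloor>x i / h\<rfloor>)"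

lemma cell_eq_0_iff: "h > 0 \<Longrightarrow> i \<le> n \<Longrightarrow> cell n h x i = 0 \<longleftrightarrow> x i = 0"
proof -
  assume h: "h > 0" and i: "i \<le> n"
  show ?thesis
  proof (cases "x i > 0")
    case True
    then have "x i / h > 0" using h by simp
    then show ?thesis using True i by (simp add: cell_def ceiling_eq_iff) 
  next
    case False
    then have "x i / h \<le> 0" using h by (simp add: divide_nonpos_pos)
    then show ?thesis using False i h by (auto simp: cell_def floor_eq_iff)
  qed
qed

text \<open>The rounding keeps the sign, so equal cells come from the same branch of the definition
  and the two quotients lie in a common unit interval.\<close>

lemma cell_diff_le:
  assumes h: "h > 0" and i: "i \<le> n" and eq: "cell n h x i = cell n h y i"
  shows "\<bar>x i - y i\<bar> \<le> h"
proof -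
  have pos: "cell n h z i > 0 \<longleftrightarrow> z i > 0" for z
  proof (cases "z i > 0")
    case True
    then show ?thesis using h i by (simp add: cell_def)
  next
    case False
    then have "z i / h \<le> 0" using h by (simp add: divide_nonpos_pos)
    then have "\<lfloor>z i / h\<rfloor> \<le> 0" by (simp add: floor_le_iff)
    then show ?thesis using False i by (simp add: cell_def)
  qed
  have s: "x i > 0 \<longleftrightarrow> y i > 0"
    using pos eq by metis
  have "\<bar>x i / h - y i / h\<bar> \<le> 1"
    using eq i s by (cases "x i > 0") (auto simp: cell_def, linarith+)
  then show ?thesis
    using h by (simp add: diff_divide_distrib[symmetric] divide_le_eq)
qed

lemma abs_cell_le:
  assumes "h > 0" "i \<le> n"
  shows "real_of_int \<bar>cell n h x i\<bar> \<le> \<bar>x i\<bar> / h + 1"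
proof -
  have "\<bar>real_of_int (cell n h x i) - x i / h\<bar> \<le> 1"
    using assms by (auto simp: cell_def) linarith+
  moreover have "\<bar>x i / h\<bar> = \<bar>x i\<bar> / h"
    using assms by simp
  ultimately show ?thesis by linarith
qed

text \<open>The factor \<open>1 - exp (- \<mu> * B)\<close> makes the bound telescope: each new pair
  of terms is dominated through \<open>\<mu> \<le> exp \<mu> - 1\<close>. What is used later is only
  that the right side is at most \<open>1 + 2 / (\<mu> * w)\<close> for every
  \<open>B\<close>.\<close>

lemma sum_exp_int_le:
  fixes \<mu> w :: real
  assumes "\<mu> > 0" "w > 0"
  shows "(\<Sum>a\<in>{- int B..int B}. if a = 0 then 1 else exp (- \<mu> * \<bar>real_of_int a\<bar>) / w)
    \<le> 1 + 2 / (\<mu> * w) * (1 - exp (- \<mu> * real B))"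
proof (induction B)
  case (Suc B)
  let ?u = "\<lambda>a::int. if a = 0 then 1 else exp (- \<mu> * \<bar>real_of_int a\<bar>) / w"
  have "{- int (Suc B)..int (Suc B)} = insert (int (Suc B)) (insert (- int (Suc B)) {- int B..int B})"
    by auto
  then have "(\<Sum>a\<in>{- int (Suc B)..int (Suc B)}. ?u a) = 2 * (exp (- \<mu> * real (Suc B)) / w) + (\<Sum>a\<in>{- int B..int B}. ?u a)"
    by (simp add: add_ac)
  also have "\<dots> \<le> 2 / (\<mu> * w) * (\<mu> * exp (- \<mu> * real (Suc B))) + (1 + 2 / (\<mu> * w) * (1 - exp (- \<mu> * real B)))"
    using Suc assms by simp
  also have "\<dots> \<le> 2 / (\<mu> * w) * (exp (- \<mu> * real B) - exp (- \<mu> * real (Suc B))) + (1 + 2 / (\<mu> * w) * (1 - exp (- \<mu> * real B)))"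
  proof -
    have "\<mu> \<le> exp \<mu> - 1"
      using exp_ge_add_one_self[of \<mu>] by linarith
    then have "\<mu> * exp (- \<mu> * real (Suc B)) \<le> (exp \<mu> - 1) * exp (- \<mu> * real (Suc B))"
      by (rule mult_right_mono) simp
    also have "\<dots> = exp (- \<mu> * real B) - exp (- \<mu> * real (Suc B))"
      by (simp add: algebra_simps exp_add[symmetric])
    finally show ?thesis
      using assms by (intro add_right_mono mult_left_mono) auto
  qed
  also have "\<dots> = 1 + 2 / (\<mu> * w) * (1 - exp (- \<mu> * real (Suc B)))"
    by (simp add: algebra_simps)
  finally show ?case .
qed simp

text \<open>Counting by weights: every lattice point of the set has weight at least
  $e^{-\mu R} w^{-s}$, while the total weight factorises over the coordinates.\<close>

lemma card_sparse_lattice: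
  fixes \<mu> w R :: real and n s :: nat
  assumes \<mu>: "\<mu> > 0" and w: "w \<ge> 1"
  defines "A \<equiv> {k \<in> {..n} \<rightarrow>\<^sub>E UNIV. card {i. i \<le> n \<and> k i \<noteq> (0::int)} \<le> s \<and> (\<Sum>i\<le>n. \<bar>real_of_int (k i)\<bar>) \<le> R}"
  shows "finite A" "real (card A) \<le> exp (\<mu> * R) * w ^ s * exp (real (Suc n) * (2 / (\<mu> * w)))"
proof -
  define B where "B = nat \<lceil>R\<rceil>"
  let ?u = "\<lambda>a::int. if a = 0 then 1 else exp (- \<mu> * \<bar>real_of_int a\<bar>) / w"
  let ?P = "{..n} \<rightarrow>\<^sub>E {- int B..int B}"
  have sub: "A \<subseteq> ?P"
  proof
    fix k assume k: "k \<in> A"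
    have "k i \<in> {- int B..int B}" if "i \<le> n" for i
    proof -
      have "\<bar>real_of_int (k i)\<bar> \<le> (\<Sum>i\<le>n. \<bar>real_of_int (k i)\<bar>)"
        using that by (intro member_le_sum) auto
      also have "\<dots> \<le> R" using k by (simp add: A_def)
      finally show ?thesis
        unfolding B_def by simp linarith
    qed
    then show "k \<in> ?P"
      using k by (auto simp: A_def PiE_iff)
  qed
  show fin: "finite A"
    using sub by (rule finite_subset) (intro finite_PiE, auto)
  have "real (card A) * (exp (- \<mu> * R) / w ^ s) = (\<Sum>k\<in>A. exp (- \<mu> * R) / w ^ s)"
    by simp
  also have "\<dots> \<le> (\<Sum>k\<in>A. \<Prod>i\<in>{..n}. ?u (k i))"
  proof (rule sum_mono)
    fix k assume k: "k \<in> A"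
    let ?Z = "{i. i \<le> n \<and> k i \<noteq> 0}"
    have "(\<Prod>i\<in>{..n}. ?u (k i)) = (\<Prod>i\<in>{..n}. exp (- \<mu> * \<bar>real_of_int (k i)\<bar>) * (if k i \<noteq> 0 then 1 / w else 1))"
      by (intro prod.cong) auto
    also have "\<dots> = exp (- \<mu> * (\<Sum>i\<le>n. \<bar>real_of_int (k i)\<bar>)) * (\<Prod>i\<in>{..n}. if k i \<noteq> 0 then 1 / w else 1)"
      by (simp add: prod.distrib exp_sum sum_distrib_left flip: sum_negf)
    also have "(\<Prod>i\<in>{..n}. if k i \<noteq> 0 then 1 / w else 1) = (\<Prod>i\<in>?Z. 1 / w)"
      by (intro prod.mono_neutral_cong_right) auto
    also have "\<dots> = 1 / w ^ card ?Z"
      by (simp add: power_one_over)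
    finally have e: "(\<Prod>i\<in>{..n}. ?u (k i)) = exp (- \<mu> * (\<Sum>i\<le>n. \<bar>real_of_int (k i)\<bar>)) * (1 / w ^ card ?Z)" .
    have "exp (- \<mu> * R) * (1 / w ^ s) \<le> exp (- \<mu> * (\<Sum>i\<le>n. \<bar>real_of_int (k i)\<bar>)) * (1 / w ^ card ?Z)"
      using k \<mu> w by (intro mult_mono) (auto simp: A_def field_simps intro!: power_increasing divide_left_mono)
    then show "exp (- \<mu> * R) / w ^ s \<le> (\<Prod>i\<in>{..n}. ?u (k i))"
      unfolding e by simp
  qed
  also have "\<dots> \<le> (\<Sum>k\<in>?P. \<Prod>i\<in>{..n}. ?u (k i))"
    using sub w by (intro sum_mono2 finite_PiE prod_nonneg) auto
  also have "\<dots> = (\<Prod>i\<in>{..n}. \<Sum>a\<in>{- int B..int B}. ?u a)"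
    by (rule prod_sum_PiE[symmetric]) auto
  also have "\<dots> = (\<Sum>a\<in>{- int B..int B}. ?u a) ^ Suc n"
    by simp
  also have "\<dots> \<le> (exp (2 / (\<mu> * w))) ^ Suc n"
  proof (intro power_mono sum_nonneg)
    have "(\<Sum>a\<in>{- int B..int B}. ?u a) \<le> 1 + 2 / (\<mu> * w) * (1 - exp (- \<mu> * real B))"
      using \<mu> w by (intro sum_exp_int_le) auto
    also have "\<dots> \<le> 1 + 2 / (\<mu> * w) * 1"
      using \<mu> w by (intro add_left_mono mult_left_mono) auto
    also have "\<dots> \<le> exp (2 / (\<mu> * w))"
      by simp
    finally show "(\<Sum>a\<in>{- int B..int B}. ?u a) \<le> exp (2 / (\<mu> * w))" .
  qed (use w in auto)
  also have "\<dots> = exp (real (Suc n) * (2 / (\<mu> * w)))"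
    by (rule exp_of_nat_mult[symmetric])
  finally have "real (card A) * (exp (- \<mu> * R) / w ^ s) \<le> exp (real (Suc n) * (2 / (\<mu> * w)))" .
  then show "real (card A) \<le> exp (\<mu> * R) * w ^ s * exp (real (Suc n) * (2 / (\<mu> * w)))"
    using w by (simp add: exp_minus field_simps)
qed

lemma log_plus_ge: "1 \<le> log_plus t" "ln t \<le> log_plus t"
  by (auto simp: log_plus_def)

text \<open>Net points are sparse unit vectors, one for each occupied lattice cell, and not the
  lattice points. They have the support of the vectors they approximate, so the difference of a
  vector and its net point is again supported on at most \<open>s\<close> coordinates.\<close>

lemma sparse_net:
  assumes s: "1 \<le> s" "s \<le> n + 1" and \<epsilon>: "0 < \<epsilon>" "\<epsilon> \<le> 1"
  shows "\<exists>N. finite N \<and> N \<subseteq> sparse_sphere n s \<and>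
    real (card N) \<le> exp (real s * log_plus (real n / real s) * (6 + ln (1 / \<epsilon>))) \<and>
    (\<forall>x\<in>sparse_sphere n s. \<exists>t\<in>N. {i. i \<le> n \<and> x i \<noteq> 0} = {i. i \<le> n \<and> t i \<noteq> 0} \<and> sqdist n x t \<le> \<epsilon>\<^sup>2)"
proof -
  \<comment> \<open>With mesh \<open>\<epsilon> / sqrt s\<close>, errors of size \<open>h\<close> on
    \<open>s\<close> coordinates add up to \<open>\<epsilon>^2\<close> in squared distance. By
    Cauchy-Schwarz a cell has absolute coordinate sum at most
    \<open>s / \<epsilon> + s \<le> R\<close>. Counting with \<open>\<mu> = \<epsilon>\<close>, the
    choice of \<open>w\<close> makes the factor of the \<open>n + 1\<close> coordinates equal to
    \<open>exp s\<close>, and \<open>\<mu> * R = 2 * s\<close>.\<close>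
  define h where "h = \<epsilon> / sqrt s"
  define R where "R = 2 * real s / \<epsilon>"
  define w where "w = 2 * real (Suc n) / (\<epsilon> * real s)"
  let ?L = "log_plus (real n / real s)"
  let ?A = "{k \<in> {..n} \<rightarrow>\<^sub>E UNIV. card {i. i \<le> n \<and> k i \<noteq> (0::int)} \<le> s \<and> (\<Sum>i\<le>n. \<bar>real_of_int (k i)\<bar>) \<le> R}"
  have sp: "real s > 0" and h: "h > 0"
    using s \<epsilon> by (auto simp: h_def)
  have w1: "w \<ge> 1"
  proof -
    have "\<epsilon> * real s \<le> 1 * real (Suc n)"
      using \<epsilon> s by (intro mult_mono) auto
    also have "\<dots> \<le> 2 * real (Suc n)" by simp
    finally show ?thesis
      unfolding w_def using \<epsilon> sp by simp
  qed
  note cnt = card_sparse_lattice[OF \<epsilon>(1) w1, of n s R]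
  have cA: "cell n h x \<in> ?A" if x: "x \<in> sparse_sphere n s" for x
  proof -
    let ?S = "{i. i \<le> n \<and> x i \<noteq> 0}"
    have cS: "real (card ?S) \<le> real s"
      using x by (simp add: sparse_sphere_def conj_commute)
    have supp: "{i. i \<le> n \<and> cell n h x i \<noteq> 0} = ?S"
      using h by (auto simp: cell_eq_0_iff)
    have "(\<Sum>i\<le>n. \<bar>real_of_int (cell n h x i)\<bar>) = (\<Sum>i\<in>?S. \<bar>real_of_int (cell n h x i)\<bar>)"
      using h by (intro sum.mono_neutral_right) (auto simp: cell_eq_0_iff)
    also have "\<dots> \<le> (\<Sum>i\<in>?S. \<bar>x i\<bar> / h + 1)"
      using abs_cell_le[OF h] by (intro sum_mono) auto
    also have "\<dots> = (\<Sum>i\<in>?S. \<bar>x i\<bar>) / h + card ?S"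
      by (simp add: sum.distrib sum_divide_distrib)
    also have "\<dots> \<le> sqrt s / h + s"
    proof (intro add_mono divide_right_mono cS)
      have "(\<Sum>i\<in>?S. \<bar>x i\<bar>)\<^sup>2 \<le> (\<Sum>i\<in>?S. \<bar>x i\<bar>\<^sup>2) * card ?S"
        by (rule sum_squared_le_sum_of_squares)
      also have "(\<Sum>i\<in>?S. \<bar>x i\<bar>\<^sup>2) \<le> (\<Sum>i\<le>n. (x i)\<^sup>2)"
        unfolding power2_abs by (intro sum_mono2) auto
      also have "\<dots> = 1"
        using x by (simp add: sparse_sphere_def sphere_sum_squares)
      finally have "(\<Sum>i\<in>?S. \<bar>x i\<bar>)\<^sup>2 \<le> real s"
        using cS by (simp add: mult_right_mono)
      then show "(\<Sum>i\<in>?S. \<bar>x i\<bar>) \<le> sqrt s"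
        by (rule real_le_rsqrt)
    qed (use h in auto)
    also have "\<dots> = s / \<epsilon> + s"
      using sp \<epsilon> by (simp add: h_def field_simps)
    also have "\<dots> \<le> R"
      using sp \<epsilon> by (simp add: R_def field_simps)
    finally show ?thesis
      using cS supp by (simp add: cell_def[of n h x])
  qed
  \<comment> \<open>A representative of the cell \<open>k\<close> in the sparse sphere; its value
    matters only for occupied cells.\<close>
  define r where "r k = (SOME x. x \<in> sparse_sphere n s \<and> cell n h x = k)" for k
  have r: "r (cell n h x) \<in> sparse_sphere n s \<and> cell n h (r (cell n h x)) = cell n h x"
    if "x \<in> sparse_sphere n s" for x
    unfolding r_def by (rule someI[of _ x]) (simp add: that)
  define N where "N = (\<lambda>x. r (cell n h x)) ` sparse_sphere n s"
  have N: "N \<subseteq> r ` ?A"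
    unfolding N_def using cA by auto
  have "finite N"
    using N cnt(1) by (meson finite_imageI finite_subset)
  moreover have "N \<subseteq> sparse_sphere n s"
    unfolding N_def using r by auto
  moreover have "real (card N) \<le> exp (real s * ?L * (6 + ln (1 / \<epsilon>)))"
  proof -
    have lnw: "ln w \<le> 2 + ?L + ln (1 / \<epsilon>)"
    proof -
      have "ln w = ln 2 + ln (real (Suc n) / real s) + ln (1 / \<epsilon>)"
      proof -
        have "w = 2 * (real (Suc n) / real s) * (1 / \<epsilon>)"
          unfolding w_def by simp
        then show ?thesis
          using \<epsilon> sp by (simp only:) (subst ln_mult_pos, simp, simp, subst ln_mult_pos, auto)
      qed
      moreover have "ln (real (Suc n) / real s) \<le> ln 2 + ?L"
      \<comment> \<open>The estimate \<open>n + 1 \<le> 2 * n\<close> fails at \<open>n = 0\<close>,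
        where \<open>s = 1\<close> and the left side is \<open>ln 1\<close>.\<close>
      proof (cases "n = 0")
        case True
        then have "s = 1" using s by simp
        then show ?thesis
          using True log_plus_ge(1)[of "real n / real s"] ln_2_less_1 by (simp add: log_plus_def)
      next
        case False
        then have "real (Suc n) / real s \<le> 2 * (real n / real s)"
          using sp by (simp add: field_simps)
        then have "ln (real (Suc n) / real s) \<le> ln (2 * (real n / real s))"
          using sp by (intro ln_mono) auto
        also have "\<dots> = ln 2 + ln (real n / real s)"
          using False sp by (intro ln_mult_pos) auto
        finally show ?thesis
          using log_plus_ge(2)[of "real n / real s"] by linarith
      qed
      ultimately show ?thesis
        using ln_2_less_1 by linarith
    qed
    have "card N \<le> card ?A"
      using N cnt(1) by (meson card_image_le card_mono finite_imageI le_trans)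
    then have "real (card N) \<le> exp (\<epsilon> * R) * w ^ s * exp (real (Suc n) * (2 / (\<epsilon> * w)))"
      using cnt(2) by linarith
    also have "\<epsilon> * R = 2 * real s"
      using \<epsilon> by (simp add: R_def)
    also have "real (Suc n) * (2 / (\<epsilon> * w)) = real s"
      using \<epsilon> sp by (simp add: w_def del: of_nat_Suc)
    also have "w ^ s = exp (real s * ln w)"
      using w1 by (simp add: exp_of_nat_mult)
    also have "exp (2 * real s) * exp (real s * ln w) * exp (real s) = exp (real s * (3 + ln w))"
      by (simp add: exp_add[symmetric] algebra_simps)
    also have "\<dots> \<le> exp (real s * (?L * (6 + ln (1 / \<epsilon>))))"
    proof -
      have "ln (1 / \<epsilon>) \<ge> 0"
        using \<epsilon> by simp
      \<comment> \<open>This product is exactly the gap between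
        \<open>?L * (6 + ln (1 / \<epsilon>))\<close> and the sum
        \<open>5 + ?L + ln (1 / \<epsilon>)\<close> that bounds \<open>3 + ln w\<close>; it turns
        the additive estimate into a multiplicative one and explains the constant 6.\<close>
      then have "0 \<le> (?L - 1) * (5 + ln (1 / \<epsilon>))"
        using log_plus_ge(1)[of "real n / real s"] by (intro mult_nonneg_nonneg) auto
      then have "3 + ln w \<le> ?L * (6 + ln (1 / \<epsilon>))"
        using lnw by (simp add: algebra_simps)
      then show ?thesis
        using sp by (simp add: mult_left_mono)
    qed
    finally show ?thesis by (simp add: mult.assoc)
  qed
  moreover have "\<exists>t\<in>N. {i. i \<le> n \<and> x i \<noteq> 0} = {i. i \<le> n \<and> t i \<noteq> 0} \<and> sqdist n x t \<le> \<epsilon>\<^sup>2"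
    if x: "x \<in> sparse_sphere n s" for x
  proof (rule bexI)
    let ?t = "r (cell n h x)"
    show "?t \<in> N"
      unfolding N_def using x by blast
    have eq: "cell n h ?t i = cell n h x i" for i
      using r[OF x] by simp
    have supp: "x i \<noteq> 0 \<longleftrightarrow> ?t i \<noteq> 0" if "i \<le> n" for i
      using eq[of i] cell_eq_0_iff[OF h that] by metis
    let ?S = "{i. i \<le> n \<and> x i \<noteq> 0}"
    have "sqdist n x ?t = (\<Sum>i\<in>?S. (x i - ?t i)\<^sup>2)"
      unfolding sqdist_def using supp by (intro sum.mono_neutral_right) auto
    also have "\<dots> \<le> (\<Sum>i\<in>?S. h\<^sup>2)"
    proof (rule sum_mono)
      fix i assume "i \<in> ?S"
      then show "(x i - ?t i)\<^sup>2 \<le> h\<^sup>2"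
        using cell_diff_le[OF h _ eq[of i, symmetric]] h by (intro power2_le_iff_abs_le[THEN iffD2]) auto
    qed
    also have "\<dots> \<le> real s * h\<^sup>2"
      using x by (simp add: sparse_sphere_def conj_commute mult_right_mono)
    also have "\<dots> = \<epsilon>\<^sup>2"
      using sp by (simp add: h_def power_divide)
    finally show "{i. i \<le> n \<and> x i \<noteq> 0} = {i. i \<le> n \<and> ?t i \<noteq> 0} \<and> sqdist n x ?t \<le> \<epsilon>\<^sup>2"
      using supp by auto
  qed
  ultimately show ?thesis
    by (intro exI[of _ N]) blast
qed

subsection \<open>The hemisphere process\<close>

lemma sphere_eq_sparse: "sphere_n n = sparse_sphere n (n + 1)"
proof -
  have "card {j. j \<le> n \<and> x j \<noteq> 0} \<le> card {..n}" for x :: "nat \<Rightarrow> real"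
    by (intro card_mono) auto
  then show ?thesis
    by (auto simp: sparse_sphere_def)
qed

text \<open>Sending each point to a net point within \<open>\<epsilon> / 3\<close> is injective on
  an \<open>\<epsilon>\<close>-separated set, which bounds the size of such sets. One of largest
  cardinality is then \<open>\<epsilon>\<close>-dense, since a far point could be added.\<close>

lemma exists_separated_net:
  assumes K: "K \<subseteq> sphere_n n" and \<epsilon>: "0 < \<epsilon>" "\<epsilon> \<le> 1"
  obtains T where "finite T" "T \<subseteq> K" "\<And>x y. x \<in> T \<Longrightarrow> y \<in> T \<Longrightarrow> x \<noteq> y \<Longrightarrow> \<epsilon> \<le> sdist n x y"
    "\<And>x. x \<in> K \<Longrightarrow> \<exists>t\<in>T. sdist n x t < \<epsilon>"
proof -
  have \<epsilon>3: "0 < \<epsilon> / 3" "\<epsilon> / 3 \<le> 1" "1 \<le> n + 1" "n + 1 \<le> n + 1"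
    using \<epsilon> by auto
  obtain N where N: "finite N" "N \<subseteq> sparse_sphere n (n + 1)"
    and net: "\<forall>x\<in>sparse_sphere n (n + 1).
      \<exists>t\<in>N. {i. i \<le> n \<and> x i \<noteq> 0} = {i. i \<le> n \<and> t i \<noteq> 0} \<and> sqdist n x t \<le> (\<epsilon> / 3)\<^sup>2"
    using sparse_net[of "n + 1" n "\<epsilon> / 3"] \<epsilon>3 by blast
  note N = N[folded sphere_eq_sparse]
  have N_net: "\<exists>t\<in>N. sqdist n x t \<le> (\<epsilon> / 3)\<^sup>2" if "x \<in> sphere_n n" for x
    using net that sphere_eq_sparse[of n] by blast
  define \<pi> where "\<pi> x = (SOME t. t \<in> N \<and> sqdist n x t \<le> (\<epsilon> / 3)\<^sup>2)" for x
  have \<pi>: "\<pi> x \<in> N \<and> sqdist n x (\<pi> x) \<le> (\<epsilon> / 3)\<^sup>2" if "x \<in> sphere_n n" for x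
    using someI_ex[of "\<lambda>t. t \<in> N \<and> sqdist n x t \<le> (\<epsilon> / 3)\<^sup>2"] N_net[OF that]
    unfolding \<pi>_def by blast
  have d\<pi>: "sdist n x (\<pi> x) \<le> \<epsilon> / 3" if x: "x \<in> sphere_n n" for x
  proof -
    have "sdist n x (\<pi> x) \<le> sqrt (sqdist n x (\<pi> x))"
      using x \<pi>[OF x] N by (intro sdist_le_sqrt_sqdist) auto
    also have "\<dots> \<le> \<epsilon> / 3"
      using \<pi>[OF x] \<epsilon> by (intro real_le_lsqrt) auto
    finally show ?thesis .
  qed
  define sep where "sep T \<longleftrightarrow> finite T \<and> T \<subseteq> K \<and> (\<forall>x\<in>T. \<forall>y\<in>T. x \<noteq> y \<longrightarrow> \<epsilon> \<le> sdist n x y)" for T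
  have card_le: "card T \<le> card N" if T: "sep T" for T
  proof (rule card_inj_on_le[of \<pi>])
    show "inj_on \<pi> T"
    proof (rule inj_onI, rule ccontr)
      fix x y assume xy: "x \<in> T" "y \<in> T" "\<pi> x = \<pi> y" "x \<noteq> y"
      have S: "x \<in> sphere_n n" "y \<in> sphere_n n" "\<pi> x \<in> sphere_n n"
    proof -
        show S1: "x \<in> sphere_n n" "y \<in> sphere_n n"
          using xy T K unfolding sep_def by blast+
        show "\<pi> x \<in> sphere_n n"
          using \<pi>[OF S1(1)] N(2) by blast
      qed
      have "sdist n x y \<le> sdist n x (\<pi> x) + sdist n (\<pi> x) y"
        by (intro sdist_triangle S)
      also have "\<dots> \<le> \<epsilon> / 3 + \<epsilon> / 3"
        using d\<pi>[OF S(1)] d\<pi>[OF S(2)] xy(3) sdist_sym[of n "\<pi> x" y] by simp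
      finally show False
        using T xy \<epsilon> unfolding sep_def by fastforce
    qed
    show "\<pi> ` T \<subseteq> N"
    proof (rule image_subsetI)
      fix x assume "x \<in> T"
      then have "x \<in> sphere_n n" using K T unfolding sep_def by blast
      then show "\<pi> x \<in> N" using \<pi> by blast
    qed
  qed (rule N)
  have "\<exists>T. sep T \<and> (\<forall>T'. sep T' \<longrightarrow> card T' \<le> card T)"
  proof (rule ex_has_greatest_nat[of sep "{}" card "Suc (card N)"])
    show "sep {}" by (simp add: sep_def)
    show "\<forall>T. sep T \<longrightarrow> card T < Suc (card N)" using card_le by (simp add: less_Suc_eq_le)
  qed
  then obtain T where T: "sep T" "\<And>T'. sep T' \<Longrightarrow> card T' \<le> card T"
    by blast
  have "\<exists>t\<in>T. sdist n x t < \<epsilon>" if x: "x \<in> K" for x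
  proof (rule ccontr)
    assume *: "\<not> ?thesis"
    have "sdist n x x = 0"
      using x K by (intro sdist_self) auto
    then have xT: "x \<notin> T"
      using * \<epsilon> by auto
    have far: "\<epsilon> \<le> sdist n x t" "\<epsilon> \<le> sdist n t x" if "t \<in> T" for t
      using * that sdist_sym[of n x t] by auto
    have "sep (insert x T)"
      unfolding sep_def
    proof (intro conjI ballI impI)
      show "finite (insert x T)" "insert x T \<subseteq> K"
        using T(1) x unfolding sep_def by auto
      fix a b assume "a \<in> insert x T" "b \<in> insert x T" "a \<noteq> b"
      then consider "a = x" "b \<in> T" | "a \<in> T" "b = x" | "a \<in> T" "b \<in> T" by blast
      then show "\<epsilon> \<le> sdist n a b"
        using far T(1) \<open>a \<noteq> b\<close> unfolding sep_def by cases auto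
    qed
    then have "Suc (card T) \<le> card T"
      using xT T(1) T(2)[of "insert x T"] unfolding sep_def by simp
    then show False by simp
  qed
  note dense = this
  show ?thesis
  proof (rule that[of T])
    show "finite T" "T \<subseteq> K"
      using T(1) unfolding sep_def by auto
    show "\<epsilon> \<le> sdist n x y" if "x \<in> T" "y \<in> T" "x \<noteq> y" for x y
      using T(1) that unfolding sep_def by auto
    show "\<exists>t\<in>T. sdist n x t < \<epsilon>" if "x \<in> K" for x
      using that by (rule dense)
  qed
qed

text \<open>On a finite set only the sign patterns of the random hyperplane matter; a pattern is
  the set of points on its positive side.\<close>

lemma pattern_probabilities:
  assumes T: "finite T" "T \<subseteq> sphere_n n"
  obtains P :: "(nat \<Rightarrow> real) set \<Rightarrow> real"
  where "\<And>U. 0 \<le> P U" "(\<Sum>U\<in>Pow T. P U) = 1"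
    "\<And>x y. x \<in> T \<Longrightarrow> y \<in> T \<Longrightarrow> (\<Sum>U\<in>Pow T. P U * of_bool ((x \<in> U) \<noteq> (y \<in> U))) = sdist n x y"
proof -
  let ?M = "gauss_vec (Suc n)"
  define pat where "pat z = {t \<in> T. sgn1 (sinner n z t) = 1}" for z
  define E where "E U = {z \<in> space ?M. pat z = U}" for U
  define P where "P U = measure ?M (E U)" for U
  have Em: "E U \<in> sets ?M" if "U \<in> Pow T" for U
  proof -
    have m: "{z \<in> space ?M. sgn1 (sinner n z t) = c} \<in> sets ?M" for t c
      using measurable_compose[OF measurable_sinner[of n t] measurable_sgn1]
      by (rule borel_measurable_eq) simp
    have "E U = {z \<in> space ?M. \<forall>t\<in>T. (sgn1 (sinner n z t) = 1) = (t \<in> U)}"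
      using that unfolding E_def pat_def by auto
    moreover have "{z \<in> space ?M. \<forall>t\<in>T. (sgn1 (sinner n z t) = 1) = (t \<in> U)} \<in> sets ?M"
    proof (rule sets.sets_Collect_finite_All[OF _ T(1)])
      show "{z \<in> space ?M. (sgn1 (sinner n z t) = 1) = (t \<in> U)} \<in> sets ?M" for t
        using m[of t 1] sets.sets_Collect_neg[OF m[of t 1]] by (cases "t \<in> U") auto
    qed
    ultimately show ?thesis by simp
  qed
  have sum_P: "(\<Sum>U\<in>V. P U) = measure ?M (\<Union>U\<in>V. E U)" if V: "V \<subseteq> Pow T" for V
  proof -
    have "finite V" using V T(1) finite_subset by auto
    then show ?thesis
      unfolding P_def
    proof (rule gauss_vec.finite_measure_finite_Union[symmetric])
      show "E ` V \<subseteq> sets ?M"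
        using V Em by blast
      show "disjoint_family_on E V"
        by (auto simp: disjoint_family_on_def E_def)
    qed
  qed
  have patT: "pat z \<in> Pow T" for z
    by (auto simp: pat_def)
  show ?thesis
  proof (rule that)
    show "0 \<le> P U" for U by (simp add: P_def)
    have "(\<Union>U\<in>Pow T. E U) = space ?M"
      using patT unfolding E_def by blast
    then show "(\<Sum>U\<in>Pow T. P U) = 1"
      by (simp add: sum_P gauss_vec.prob_space)
    fix x y assume xy: "x \<in> T" "y \<in> T"
    let ?V = "{U \<in> Pow T. (x \<in> U) \<noteq> (y \<in> U)}"
    have "(\<Sum>U\<in>Pow T. P U * of_bool ((x \<in> U) \<noteq> (y \<in> U))) = (\<Sum>U\<in>?V. P U)"
      using T(1) by (intro sum.mono_neutral_cong_right) auto
    also have "\<dots> = measure ?M (\<Union>U\<in>?V. E U)"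
      by (rule sum_P) auto
    also have "(\<Union>U\<in>?V. E U) = {z \<in> space ?M. crosses n x y z}"
    proof -
      have "(x \<in> pat z) \<noteq> (y \<in> pat z) \<longleftrightarrow> crosses n x y z" for z
        using xy by (simp add: pat_def crosses_def sgn1_def)
      then show ?thesis
        using patT unfolding E_def by blast
    qed
    also have "measure ?M \<dots> = sdist n x y"
      using xy T by (intro prob_crosses) auto
    finally show "(\<Sum>U\<in>Pow T. P U * of_bool ((x \<in> U) \<noteq> (y \<in> U))) = sdist n x y" .
  qed
qed

section \<open>Finite realizations of the hemisphere process and finiteness of its width\<close>

definition hemi_gram :: "nat \<Rightarrow> (nat \<Rightarrow> real) set \<Rightarrow> nat \<Rightarrow> ((nat \<Rightarrow> real) \<Rightarrow> nat \<Rightarrow> real) \<Rightarrow> bool" where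
  "hemi_gram n F k v \<longleftrightarrow> (\<forall>x\<in>F. \<forall>y\<in>F. (\<Sum>i<k. v x i * v y i) = 1/4 - sdist n x y / 2)"

text \<open>Positive semidefiniteness of the hemisphere covariance: it is the Gram matrix of the
  functions equal to \<open>1/2\<close> on patterns containing \<open>x\<close> and
  \<open>-1/2\<close> on the others, in the \<open>L2\<close> space of the pattern probabilities.
  The square root of the weights turns them into coordinate vectors.\<close>

lemma exists_hemi_gram:
  assumes T: "finite T" "T \<subseteq> sphere_n n"
  obtains k v where "hemi_gram n T k v"
proof -
  obtain P where P: "\<And>U. 0 \<le> P U" "(\<Sum>U\<in>Pow T. P U) = 1"
    "\<And>x y. x \<in> T \<Longrightarrow> y \<in> T \<Longrightarrow> (\<Sum>U\<in>Pow T. P U * of_bool ((x \<in> U) \<noteq> (y \<in> U))) = sdist n x y"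
    using pattern_probabilities[OF T] by blast
  have "finite (Pow T)" using T by simp
  then obtain e where e: "bij_betw e {0..<card (Pow T)} (Pow T)"
    using ex_bij_betw_nat_finite by blast
  define v where "v x i = (if x \<in> e i then 1/2 else -1/2) * sqrt (P (e i))" for x i
  have "(\<Sum>i<card (Pow T). v x i * v y i) = 1/4 - sdist n x y / 2" if xy: "x \<in> T" "y \<in> T" for x y
  proof -
    have "(\<Sum>i<card (Pow T). v x i * v y i)
        = (\<Sum>i\<in>{0..<card (Pow T)}. (\<lambda>U. P U * (1/4 - of_bool ((x \<in> U) \<noteq> (y \<in> U)) / 2)) (e i))"
      unfolding atLeast0LessThan v_def using P(1) by (intro sum.cong refl) auto
    also have "\<dots> = (\<Sum>U\<in>Pow T. P U * (1/4 - of_bool ((x \<in> U) \<noteq> (y \<in> U)) / 2))"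
      using e by (rule sum.reindex_bij_betw)
    also have "\<dots> = (\<Sum>U\<in>Pow T. P U) / 4 - (\<Sum>U\<in>Pow T. P U * of_bool ((x \<in> U) \<noteq> (y \<in> U))) / 2"
      by (simp add: right_diff_distrib sum_subtractf sum_divide_distrib)
    finally show ?thesis
      using P(2,3) xy by simp
  qed
  then show ?thesis
    using that[of "card (Pow T)" v] by (simp add: hemi_gram_def)
qed

lemma hemi_gram_increment:
  assumes "hemi_gram n F k v" "F \<subseteq> sphere_n n" "x \<in> F" "y \<in> F"
  shows "(\<Sum>i<k. (v x i - v y i)\<^sup>2) = sdist n x y"
proof -
  have "(\<Sum>i<k. (v x i - v y i)\<^sup>2) = (\<Sum>i<k. v x i * v x i) + (\<Sum>i<k. v y i * v y i) - 2 * (\<Sum>i<k. v x i * v y i)"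
    unfolding sum_distrib_left sum.distrib[symmetric] sum_subtractf[symmetric]
    by (intro sum.cong refl) (simp add: power2_eq_square algebra_simps)
  also have "\<dots> = (1/4 - sdist n x x / 2) + (1/4 - sdist n y y / 2) - 2 * (1/4 - sdist n x y / 2)"
    using assms by (simp add: hemi_gram_def)
  finally show ?thesis
    using assms by (simp add: sdist_self subset_iff)
qed

definition gram_width :: "(nat \<Rightarrow> real) set \<Rightarrow> nat \<Rightarrow> ((nat \<Rightarrow> real) \<Rightarrow> nat \<Rightarrow> real) \<Rightarrow> real" where
  "gram_width F k v = (\<integral>z. Max ((\<lambda>p. lin_form k (\<lambda>i. v (fst p) i - v (snd p) i) z) ` (F \<times> F)) \<partial>gauss_vec k)"

lemma hemi_width_eq:
  "hemi_width n K = Sup {gram_width F k v | F k v. finite F \<and> F \<noteq> {} \<and> F \<subseteq> K \<and> hemi_gram n F k v}"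
  unfolding hemi_width_def gram_width_def hemi_gram_def lin_form_def case_prod_unfold ..

lemma lin_form_diff: "lin_form k (\<lambda>i. a i - b i) z = lin_form k a z - lin_form k b z"
  by (simp add: lin_form_def left_diff_distrib sum_subtractf)

lemma lin_form_uminus: "lin_form k (\<lambda>i. - a i) z = - lin_form k a z"
  by (simp add: lin_form_def sum_negf)

lemma gram_width_le:
  assumes F: "finite F" "F \<noteq> {}"
  shows "gram_width F k v \<le> (\<integral>z. Max ((\<lambda>x. lin_form k (v x) z) ` F) \<partial>gauss_vec k)
     + (\<integral>z. Max ((\<lambda>x. lin_form k (\<lambda>i. - v x i) z) ` F) \<partial>gauss_vec k)"
proof -
  have i: "integrable (gauss_vec k) (\<lambda>z. Max ((\<lambda>x. lin_form k (c x) z) ` F))" for c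
    by (intro integrable_Max_finite F integrable_lin_form)
  have "gram_width F k v \<le> (\<integral>z. Max ((\<lambda>x. lin_form k (v x) z) ` F) + Max ((\<lambda>x. lin_form k (\<lambda>i. - v x i) z) ` F) \<partial>gauss_vec k)"
    unfolding gram_width_def
  proof (intro integral_mono Bochner_Integration.integrable_add i)
    show "integrable (gauss_vec k) (\<lambda>z. Max ((\<lambda>p. lin_form k (\<lambda>i. v (fst p) i - v (snd p) i) z) ` (F \<times> F)))"
      using F by (intro integrable_Max_finite integrable_lin_form) auto
    fix z
    show "Max ((\<lambda>p. lin_form k (\<lambda>i. v (fst p) i - v (snd p) i) z) ` (F \<times> F))
        \<le> Max ((\<lambda>x. lin_form k (v x) z) ` F) + Max ((\<lambda>x. lin_form k (\<lambda>i. - v x i) z) ` F)"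
    proof (rule Max.boundedI)
      fix r assume "r \<in> (\<lambda>p. lin_form k (\<lambda>i. v (fst p) i - v (snd p) i) z) ` (F \<times> F)"
      then obtain x y where xy: "x \<in> F" "y \<in> F" "r = lin_form k (v x) z + lin_form k (\<lambda>i. - v y i) z"
        by (auto simp: lin_form_diff lin_form_uminus)
      then show "r \<le> Max ((\<lambda>x. lin_form k (v x) z) ` F) + Max ((\<lambda>x. lin_form k (\<lambda>i. - v x i) z) ` F)"
        unfolding xy(3) using F by (intro add_mono Max_ge) auto
    qed (use F in auto)
  qed
  then show ?thesis
    using i by simp
qed

text \<open>Comparison with the lacunary process
  $\sum_{i \le n} \sum_{k < N} 2 (3/4)^k (g_{ik} \cos 2^k x_i + g'_{ik} \sin 2^k x_i)$,
  whose supremum has expectation bounded independently of $N$, shows that the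
  hemisphere width of every subset of the sphere is finite.\<close>

lemma lacunary_increment:
  fixes t :: real
  assumes t: "0 \<le> t" "t \<le> 2" "t = 0 \<or> 2 < 2 ^ N * t"
  shows "t / 4 \<le> (\<Sum>k<N. ((3/4) ^ k)\<^sup>2 * (2 - 2 * cos (2 ^ k * t)))"
proof (cases "t = 0")
  case False
  then have t3: "2 < 2 ^ N * t" using t by simp
  \<comment> \<open>The first frequency at which \<open>2 ^ k * t\<close> exceeds 2. Just before it,
    at \<open>j\<close>, the phase lies between 1 and 2, where the cosine is bounded away from 1;
    this single summand already suffices.\<close>
  define k where "k = (LEAST k. 2 < 2 ^ k * t)"
  have k: "2 < 2 ^ k * t"
    unfolding k_def using t3 by (rule LeastI)
  have "k \<noteq> 0"
    using k t by (intro notI) simp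
  then obtain j where j: "k = Suc j"
    using not0_implies_Suc by blast
  have "k \<le> N"
    unfolding k_def using t3 by (rule Least_le)
  then have "j < N" using j by simp
  have le2: "2 ^ j * t \<le> 2"
    using not_less_Least[of j "\<lambda>k. 2 < 2 ^ k * t"] j by (simp add: k_def not_less)
  have ge1: "1 \<le> 2 ^ j * t"
    using k j by simp
  have cos: "cos (2 ^ j * t) \<le> 3 / 4"
  proof -
    have "cos (2 ^ j * t) \<le> cos (pi / 4)"
      using ge1 le2 pi_less_4 pi_gt3 by (intro cos_monotone_0_pi_le) auto
    also have "\<dots> \<le> 3 / 4"
    proof -
      have "sqrt 2 \<le> 3 / 2" by (rule real_le_lsqrt) (auto simp: power2_eq_square)
      then show ?thesis by (simp add: cos_45)
    qed
    finally show ?thesis .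
  qed
  \<comment> \<open>The base \<open>3/4\<close> is chosen between two demands: its square exceeds
    \<open>1/2\<close>, so the summand at \<open>j\<close> beats \<open>t\<close>, while its powers
    are summable, so the expected supremum stays bounded.\<close>
  have "t / 2 \<le> ((3/4) ^ j)\<^sup>2"
  proof -
    have "t / 2 \<le> (1 / 2) ^ j"
      using le2 by (simp add: field_simps power_one_over)
    also have "\<dots> \<le> ((3/4)\<^sup>2) ^ j"
      by (intro power_mono) (auto simp: power2_eq_square)
    finally show ?thesis
      by (simp add: power_mult[symmetric] mult.commute)
  qed
  then have "t / 2 * (1 / 2) \<le> ((3/4) ^ j)\<^sup>2 * (2 - 2 * cos (2 ^ j * t))"
    using cos by (intro mult_mono) auto
  also have "\<dots> \<le> (\<Sum>k<N. ((3/4) ^ k)\<^sup>2 * (2 - 2 * cos (2 ^ k * t)))"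
    using \<open>j < N\<close> by (intro member_le_sum) auto
  finally show ?thesis by simp
qed (auto intro: sum_nonneg)

lemma integral_gauss_vec_component:
  fixes f :: "real \<Rightarrow> real"
  assumes "i < k" "f \<in> borel_measurable borel"
  shows "(\<integral>z. f (z i) \<partial>gauss_vec k) = (\<integral>x. f x \<partial>std_gauss)"
proof -
  have "(\<integral>x. f x \<partial>distr (gauss_vec k) std_gauss (\<lambda>z. z i)) = (\<integral>z. f (z i) \<partial>gauss_vec k)"
    using assms by (intro integral_distr) (auto simp: gauss_vec_def)
  then show ?thesis
    by (simp add: distr_gauss_vec_component[OF assms(1)])
qed

lemma integral_lin_form: "(\<integral>z. lin_form k c z \<partial>gauss_vec k) = 0"
proof -
  have "(\<integral>x. x \<partial>std_gauss) = 0"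
    using integral_std_normal_moment_odd[of 0] by (subst integral_std_gauss) auto
  then have "(\<integral>z. z i \<partial>gauss_vec k) = 0" if "i < k" for i
    using integral_gauss_vec_component[OF that, of "\<lambda>x. x"] by simp
  then show ?thesis
    unfolding lin_form_def
    by (subst Bochner_Integration.integral_sum)
      (auto intro!: integrable_mult_right integrable_gauss_vec_component)
qed

lemma sum_geometric_three_quarters: "(\<Sum>k<N. (3/4::real) ^ k) \<le> 4"
proof -
  have "(\<Sum>k<N. (3/4::real) ^ k) = 4 * (1 - (3/4) ^ N)"
    by (induction N) (simp_all add: algebra_simps)
  also have "\<dots> \<le> 4 * 1"
    by (intro mult_left_mono) auto
  finally show ?thesis by simp
qed

text \<open>The geodesic distance is at most the Euclidean one, hence at most the sum of the
  coordinate differences, each of which is dominated by the increments of its own lacunary series.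
  The bound does not see the size of \<open>F\<close>: the number \<open>N\<close> of frequencies
  enters only through a geometric sum at most 4, and cosine and sine together contribute
  \<open>4 * 4\<close> per coordinate.\<close>

lemma integral_Max_le_lacunary:
  assumes F: "finite F" "F \<noteq> {}" "F \<subseteq> sphere_n n"
    and inc: "\<And>x y. x \<in> F \<Longrightarrow> y \<in> F \<Longrightarrow> (\<Sum>i<k. (a x i - a y i)\<^sup>2) \<le> sdist n x y"
  shows "(\<integral>z. Max ((\<lambda>x. lin_form k (a x) z) ` F) \<partial>gauss_vec k) \<le> 16 * real (Suc n)"
proof -
  \<comment> \<open>\<open>F\<close> has only finitely many nonzero coordinate differences, so one
    number of frequencies resolves them all.\<close>
  obtain N where N: "\<And>x y i. x \<in> F \<Longrightarrow> y \<in> F \<Longrightarrow> i \<le> n \<Longrightarrow> x i \<noteq> y i \<Longrightarrow> 2 < 2 ^ N * \<bar>x i - y i\<bar>"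
  proof -
    define D where "D = (\<lambda>(x, y, i). \<bar>x i - y i\<bar>) ` (F \<times> F \<times> {..n}) - {0}"
    have D: "finite D" "\<And>d. d \<in> D \<Longrightarrow> 0 < d"
      using F by (auto simp: D_def)
    have "\<exists>N. \<forall>d\<in>D. 2 < 2 ^ N * d"
    proof (cases "D = {}")
      case False
      then have M: "0 < Min D" "\<And>d. d \<in> D \<Longrightarrow> Min D \<le> d"
        using D by auto
      obtain N where "2 / Min D < 2 ^ N"
        using real_arch_pow[of 2] by auto
      then have "2 < 2 ^ N * Min D"
        using M by (simp add: field_simps)
      then have "2 < 2 ^ N * d" if "d \<in> D" for d
        using M(2)[OF that] by (meson less_le_trans mult_left_mono zero_le_numeral zero_le_power)
      then show ?thesis by blast
    qed simp
    then obtain N where N: "\<forall>d\<in>D. 2 < 2 ^ N * d" by blast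
    have "2 < 2 ^ N * \<bar>x i - y i\<bar>" if "x \<in> F" "y \<in> F" "i \<le> n" "x i \<noteq> y i" for x y i
    proof -
      have "\<bar>x i - y i\<bar> \<in> D"
        unfolding D_def using that by (auto intro!: image_eqI[of _ _ "(x, y, i)"])
      then show ?thesis using N by blast
    qed
    then show ?thesis using that by blast
  qed
  define J where "J = {..n} \<times> {..<N} \<times> (UNIV :: bool set)"
  define q where "q x = (\<lambda>(i, k, c). 2 * (3/4) ^ k * (if c then cos (2 ^ k * x i) else sin (2 ^ k * x i)))"
    for x :: "nat \<Rightarrow> real"
  define r where "r = (\<lambda>(i :: nat, k, c :: bool). 2 * (3/4 :: real) ^ k)"
  have "finite J" by (simp add: J_def)
  then obtain e where e: "bij_betw e {0..<card J} J"
    using ex_bij_betw_nat_finite by blast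
  define l where "l = card J"
  define b where "b x j = q x (e j)" for x j
  have reidx: "(\<Sum>j<l. f (e j)) = (\<Sum>p\<in>J. f p)" for f :: "_ \<Rightarrow> real"
    using sum.reindex_bij_betw[OF e, of f] by (simp add: l_def atLeast0LessThan)
  have sumJ: "(\<Sum>p\<in>J. f p) = (\<Sum>i\<le>n. \<Sum>k<N. f (i, k, True) + f (i, k, False))" for f :: "_ \<Rightarrow> real"
    unfolding J_def by (simp add: sum.cartesian_product' UNIV_bool add.commute)
  have "(\<Sum>i<k. (a x i - a y i)\<^sup>2) \<le> (\<Sum>j<l. (b x j - b y j)\<^sup>2)" if xy: "x \<in> F" "y \<in> F" for x y
  proof -
    have S: "x \<in> sphere_n n" "y \<in> sphere_n n" using xy F by auto
    have le1: "\<bar>z i\<bar> \<le> 1" if "z \<in> sphere_n n" "i \<le> n" for z i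
    proof -
      have "(z i)\<^sup>2 \<le> (\<Sum>i\<le>n. (z i)\<^sup>2)"
        using that(2) by (intro member_le_sum) auto
      then show ?thesis
        using sphere_sum_squares[OF that(1)] by (simp add: abs_square_le_1)
    qed
    have "(\<Sum>i<k. (a x i - a y i)\<^sup>2) \<le> sqrt (sqdist n x y)"
      using inc[OF xy] sdist_le_sqrt_sqdist[OF S] by linarith
    also have "\<dots> \<le> (\<Sum>i\<le>n. \<bar>x i - y i\<bar>)"
      unfolding sqdist_def using L2_set_le_sum_abs[of "\<lambda>i. x i - y i" "{..n}"] by (simp add: L2_set_def)
    also have "\<dots> \<le> (\<Sum>i\<le>n. \<Sum>k<N. 4 * (((3/4) ^ k)\<^sup>2 * (2 - 2 * cos (2 ^ k * \<bar>x i - y i\<bar>))))"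
    proof (rule sum_mono)
      fix i assume i: "i \<in> {..n}"
      have "\<bar>x i - y i\<bar> / 4 \<le> (\<Sum>k<N. ((3/4) ^ k)\<^sup>2 * (2 - 2 * cos (2 ^ k * \<bar>x i - y i\<bar>)))"
        using N[OF xy, of i] i le1[OF S(1), of i] le1[OF S(2), of i] by (intro lacunary_increment) auto
      then show "\<bar>x i - y i\<bar> \<le> (\<Sum>k<N. 4 * (((3/4) ^ k)\<^sup>2 * (2 - 2 * cos (2 ^ k * \<bar>x i - y i\<bar>))))"
        by (simp add: sum_distrib_left[symmetric])
    qed
    also have "\<dots> = (\<Sum>p\<in>J. (q x p - q y p)\<^sup>2)"
      unfolding sumJ
    proof (intro sum.cong refl)
      fix i k
      define u where "u = 2 ^ k * x i"
      define w where "w = 2 ^ k * y i"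
      have "cos (2 ^ k * \<bar>x i - y i\<bar>) = cos \<bar>u - w\<bar>"
        by (simp add: u_def w_def right_diff_distrib[symmetric] abs_mult)
      then have c: "cos (2 ^ k * \<bar>x i - y i\<bar>) = cos u * cos w + sin u * sin w"
        by (simp add: cos_diff)
      have "(cos u - cos w)\<^sup>2 + (sin u - sin w)\<^sup>2 = 2 - 2 * (cos u * cos w + sin u * sin w)"
        using sin_cos_squared_add[of u] sin_cos_squared_add[of w]
        by (simp add: power2_eq_square algebra_simps)
      then have eq: "2 - 2 * cos (2 ^ k * \<bar>x i - y i\<bar>) = (cos u - cos w)\<^sup>2 + (sin u - sin w)\<^sup>2"
        by (simp only: c)
      define \<kappa> where "\<kappa> = (3/4 :: real) ^ k"
      have "4 * (\<kappa>\<^sup>2 * ((cos u - cos w)\<^sup>2 + (sin u - sin w)\<^sup>2))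
          = (2 * \<kappa> * cos u - 2 * \<kappa> * cos w)\<^sup>2 + (2 * \<kappa> * sin u - 2 * \<kappa> * sin w)\<^sup>2"
        by algebra
      then show "4 * (((3/4) ^ k)\<^sup>2 * (2 - 2 * cos (2 ^ k * \<bar>x i - y i\<bar>)))
          = (q x (i, k, True) - q y (i, k, True))\<^sup>2 + (q x (i, k, False) - q y (i, k, False))\<^sup>2"
        unfolding eq by (simp only: q_def u_def w_def \<kappa>_def prod.case if_True if_False)
    qed
    also have "\<dots> = (\<Sum>j<l. (b x j - b y j)\<^sup>2)"
      unfolding b_def by (rule reidx[symmetric])
    finally show ?thesis .
  qed
  then have "(\<integral>z. Max ((\<lambda>x. lin_form k (a x) z) ` F) \<partial>gauss_vec k)
      \<le> (\<integral>z. Max ((\<lambda>x. lin_form l (b x) z) ` F) \<partial>gauss_vec l)"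
    by (intro sudakov_fernique F) auto
  also have "\<dots> \<le> (\<integral>z. (\<Sum>j<l. r (e j) * \<bar>z j\<bar>) \<partial>gauss_vec l)"
  proof (intro integral_mono integrable_Max_finite integrable_lin_form F)
    show "integrable (gauss_vec l) (\<lambda>z. \<Sum>j<l. r (e j) * \<bar>z j\<bar>)"
      by (intro Bochner_Integration.integrable_sum integrable_mult_right integrable_abs integrable_gauss_vec_component) auto
    fix z
    show "Max ((\<lambda>x. lin_form l (b x) z) ` F) \<le> (\<Sum>j<l. r (e j) * \<bar>z j\<bar>)"
    proof (rule Max.boundedI)
      fix m assume "m \<in> (\<lambda>x. lin_form l (b x) z) ` F"
      then obtain x where m: "m = lin_form l (b x) z" by blast
      have "\<bar>q x p\<bar> \<le> r p" for p
        by (cases p) (auto simp: q_def r_def abs_mult mult_left_le)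
      then have "b x j * z j \<le> r (e j) * \<bar>z j\<bar>" for j
        unfolding b_def by (metis abs_ge_self abs_ge_zero abs_mult mult_right_mono order_trans)
      then show "m \<le> (\<Sum>j<l. r (e j) * \<bar>z j\<bar>)"
        unfolding m lin_form_def by (intro sum_mono) auto
    qed (use F in auto)
  qed
  also have "\<dots> = (\<Sum>j<l. r (e j) * (\<integral>z. \<bar>z j\<bar> \<partial>gauss_vec l))"
    by (subst Bochner_Integration.integral_sum)
      (auto intro!: integrable_mult_right integrable_abs integrable_gauss_vec_component)
  also have "\<dots> \<le> (\<Sum>j<l. r (e j) * 1)"
  proof (intro sum_mono mult_left_mono)
    show "(\<integral>z. \<bar>z j\<bar> \<partial>gauss_vec l) \<le> 1" if "j \<in> {..<l}" for j
      using that integral_gauss_vec_component[of j l abs] std_gauss_abs_bounds by simp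
    show "0 \<le> r (e j)" for j
      by (cases "e j") (simp add: r_def)
  qed
  also have "\<dots> = (\<Sum>p\<in>J. r p)"
    using reidx[of r] by simp
  also have "\<dots> = real (Suc n) * (4 * (\<Sum>k<N. (3/4) ^ k))"
    unfolding sumJ by (simp add: r_def sum_distrib_left)
  also have "\<dots> \<le> real (Suc n) * (4 * 4)"
    using sum_geometric_three_quarters[of N] by (intro mult_left_mono) auto
  finally show ?thesis by simp
qed

text \<open>The real \<open>Sup\<close> dominates its members only when they are bounded above. The
  bound must not depend on the finite set or on the realization \<open>v\<close>, which is what the
  lacunary comparison provides, applied to the process and to its negative.\<close>

lemma gram_width_le_hemi_width:
  assumes K: "K \<subseteq> sphere_n n" and F: "finite F" "F \<noteq> {}" "F \<subseteq> K" and g: "hemi_gram n F k v"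
  shows "gram_width F k v \<le> hemi_width n K"
  unfolding hemi_width_eq
proof (rule cSup_upper)
  show "gram_width F k v \<in> {gram_width F k v |F k v. finite F \<and> F \<noteq> {} \<and> F \<subseteq> K \<and> hemi_gram n F k v}"
    using F g by blast
  show "bdd_above {gram_width F k v |F k v. finite F \<and> F \<noteq> {} \<and> F \<subseteq> K \<and> hemi_gram n F k v}"
  proof (rule bdd_aboveI[of _ "32 * real (Suc n)"])
    fix W
    assume "W \<in> {gram_width F k v |F k v. finite F \<and> F \<noteq> {} \<and> F \<subseteq> K \<and> hemi_gram n F k v}"
    then obtain F k v where W: "W = gram_width F k v"
      and F: "finite F" "F \<noteq> {}" "F \<subseteq> K" and g: "hemi_gram n F k v"
      by blast
    have FS: "F \<subseteq> sphere_n n" using F K by blast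
    have "(\<integral>z. Max ((\<lambda>x. lin_form k (v x) z) ` F) \<partial>gauss_vec k) \<le> 16 * real (Suc n)"
      by (intro integral_Max_le_lacunary F(1,2) FS) (simp add: hemi_gram_increment[OF g FS])
    moreover have "(\<integral>z. Max ((\<lambda>x. lin_form k (\<lambda>i. - v x i) z) ` F) \<partial>gauss_vec k) \<le> 16 * real (Suc n)"
    proof (intro integral_Max_le_lacunary F(1,2) FS)
      fix x y assume "x \<in> F" "y \<in> F"
      then show "(\<Sum>i<k. (- v x i - - v y i)\<^sup>2) \<le> sdist n x y"
        using hemi_gram_increment[OF g FS, of x y] by (simp add: power2_commute)
    qed
    ultimately show "W \<le> 32 * real (Suc n)"
      unfolding W using gram_width_le[OF F(1,2), of k v] by linarith
  qed
qed

text \<open>Subtracting the value at a fixed point \<open>x0\<close>, which has mean zero, turns the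
  maximum over points into one particular family of pairs.\<close>

lemma integral_Max_le_gram_width:
  assumes F: "finite F" "F \<noteq> {}"
  shows "(\<integral>z. Max ((\<lambda>x. lin_form k (v x) z) ` F) \<partial>gauss_vec k) \<le> gram_width F k v"
proof -
  obtain x0 where x0: "x0 \<in> F" using F by blast
  have i: "integrable (gauss_vec k) (\<lambda>z. Max ((\<lambda>x. lin_form k (v x) z) ` F))"
    by (intro integrable_Max_finite F integrable_lin_form)
  have "(\<integral>z. Max ((\<lambda>x. lin_form k (v x) z) ` F) \<partial>gauss_vec k)
      = (\<integral>z. Max ((\<lambda>x. lin_form k (v x) z) ` F) - lin_form k (v x0) z \<partial>gauss_vec k)"
    using i integrable_lin_form by (simp add: integral_lin_form)
  also have "\<dots> \<le> gram_width F k v"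
    unfolding gram_width_def
  proof (intro integral_mono Bochner_Integration.integrable_diff i integrable_lin_form)
    show "integrable (gauss_vec k) (\<lambda>z. Max ((\<lambda>p. lin_form k (\<lambda>i. v (fst p) i - v (snd p) i) z) ` (F \<times> F)))"
      using F by (intro integrable_Max_finite integrable_lin_form) auto
    fix z
    have "Max ((\<lambda>x. lin_form k (v x) z) ` F) \<in> (\<lambda>x. lin_form k (v x) z) ` F"
      using F by (intro Max_in) auto
    then obtain x where x: "x \<in> F" "Max ((\<lambda>x. lin_form k (v x) z) ` F) = lin_form k (v x) z"
      by auto
    have "lin_form k (v x) z - lin_form k (v x0) z
       = (\<lambda>p. lin_form k (\<lambda>i. v (fst p) i - v (snd p) i) z) (x, x0)"
      by (simp add: lin_form_diff)
    also have "\<dots> \<le> Max ((\<lambda>p. lin_form k (\<lambda>i. v (fst p) i - v (snd p) i) z) ` (F \<times> F))"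
      using F x x0 by (intro Max_ge imageI finite_imageI finite_cartesian_product SigmaI) auto
    finally show "Max ((\<lambda>x. lin_form k (v x) z) ` F) - lin_form k (v x0) z
       \<le> Max ((\<lambda>p. lin_form k (\<lambda>i. v (fst p) i - v (snd p) i) z) ` (F \<times> F))"
      using x by simp
  qed
  finally show ?thesis .
qed

text \<open>For a two-point set the maximum over pairs is \<open>\<bar>G_x - G_y\<bar>\<close>,
  whose mean is a positive multiple of the square root of the distance. This handles
  \<open>m = 0\<close>, where the hypothesis on \<open>m\<close> forces zero width.\<close>

lemma hemi_width_zero_imp:
  assumes K: "K \<subseteq> sphere_n n" and H: "hemi_width n K = 0" and xy: "x \<in> K" "y \<in> K"
  shows "sdist n x y = 0"
proof -
  let ?F = "{x, y}"
  have F: "finite ?F" "?F \<noteq> {}" "?F \<subseteq> K" "?F \<subseteq> sphere_n n"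
    using xy K by auto
  obtain k v where g: "hemi_gram n ?F k v"
    using exists_hemi_gram[OF F(1,4)] .
  let ?c = "\<lambda>i. v x i - v y i"
  have "(\<integral>z. \<bar>lin_form k ?c z\<bar> \<partial>gauss_vec k) \<le> gram_width ?F k v"
    unfolding gram_width_def
  proof (intro integral_mono integrable_abs integrable_lin_form)
    show "integrable (gauss_vec k) (\<lambda>z. Max ((\<lambda>p. lin_form k (\<lambda>i. v (fst p) i - v (snd p) i) z) ` (?F \<times> ?F)))"
      by (intro integrable_Max_finite integrable_lin_form) auto
    show "\<bar>lin_form k ?c z\<bar> \<le> Max ((\<lambda>p. lin_form k (\<lambda>i. v (fst p) i - v (snd p) i) z) ` (?F \<times> ?F))" for z
      by (auto simp: lin_form_diff)
  qed
  also have "\<dots> \<le> 0"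
    using gram_width_le_hemi_width[OF K F(1,2,3) g] H by simp
  also have "(\<integral>z. \<bar>lin_form k ?c z\<bar> \<partial>gauss_vec k) = sqrt (\<Sum>i<k. (?c i)\<^sup>2) * (\<integral>u. \<bar>u\<bar> \<partial>std_gauss)"
    unfolding lin_form_def by (subst integral_gauss_vec_linear) (auto simp: abs_mult sum_nonneg)
  finally have "sqrt (\<Sum>i<k. (?c i)\<^sup>2) \<le> 0"
    using std_gauss_abs_bounds(1) by (simp add: mult_le_0_iff)
  then show ?thesis
    using hemi_gram_increment[OF g F(4), of x y] sdist_nonneg[of x n y] K xy by auto
qed

subsection \<open>Gaussian symmetrization over a finite probability space\<close>

text \<open>The expectation of \<open>h\<close> over \<open>m\<close> independent samples from the
  weights \<open>P\<close>. Written as a finite sum it exists for every \<open>h\<close>, maxima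
  included, and commutes freely with Gaussian integrals.\<close>

definition iid_avg :: "'s set \<Rightarrow> ('s \<Rightarrow> real) \<Rightarrow> nat \<Rightarrow> ((nat \<Rightarrow> 's) \<Rightarrow> real) \<Rightarrow> real" where
  "iid_avg S P m h = (\<Sum>\<omega>\<in>{..<m} \<rightarrow>\<^sub>E S. (\<Prod>j<m. P (\<omega> j)) * h \<omega>)"

lemma iid_avg_add: "iid_avg S P m (\<lambda>\<omega>. g \<omega> + h \<omega>) = iid_avg S P m g + iid_avg S P m h"
  by (simp add: iid_avg_def distrib_left sum.distrib)

lemma iid_avg_cmult: "iid_avg S P m (\<lambda>\<omega>. c * h \<omega>) = c * iid_avg S P m h"
  by (simp add: iid_avg_def sum_distrib_left mult_ac)

lemma iid_avg_sum: "iid_avg S P m (\<lambda>\<omega>. \<Sum>i\<in>I. h i \<omega>) = (\<Sum>i\<in>I. iid_avg S P m (h i))"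
  unfolding iid_avg_def sum_distrib_left by (rule sum.swap)

lemma integral_iid_avg:
  assumes "\<And>\<omega>. integrable M (h \<omega>)"
  shows "integrable M (\<lambda>z. iid_avg S P m (\<lambda>\<omega>. h \<omega> z))"
    "(\<integral>z. iid_avg S P m (\<lambda>\<omega>. h \<omega> z) \<partial>M) = iid_avg S P m (\<lambda>\<omega>. \<integral>z. h \<omega> z \<partial>M)"
  unfolding iid_avg_def using assms by (auto simp: Bochner_Integration.integral_sum)

context
  fixes S :: "'s set" and P :: "'s \<Rightarrow> real" and m :: nat
  assumes S: "finite S" and P: "\<And>s. 0 \<le> P s" "(\<Sum>s\<in>S. P s) = 1"
begin

abbreviation (input) avg :: "((nat \<Rightarrow> 's) \<Rightarrow> real) \<Rightarrow> real" where
  "avg \<equiv> iid_avg S P m"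

lemma iid_avg_mono: "(\<And>\<omega>. \<omega> \<in> {..<m} \<rightarrow>\<^sub>E S \<Longrightarrow> g \<omega> \<le> h \<omega>) \<Longrightarrow> avg g \<le> avg h"
  unfolding iid_avg_def by (intro sum_mono mult_left_mono prod_nonneg) (auto simp: P)

lemma iid_avg_abs: "\<bar>avg h\<bar> \<le> avg (\<lambda>\<omega>. \<bar>h \<omega>\<bar>)"
proof -
  have "\<bar>avg h\<bar> \<le> (\<Sum>\<omega>\<in>{..<m} \<rightarrow>\<^sub>E S. \<bar>(\<Prod>j<m. P (\<omega> j)) * h \<omega>\<bar>)"
    unfolding iid_avg_def by (rule sum_abs)
  also have "\<dots> = avg (\<lambda>\<omega>. \<bar>h \<omega>\<bar>)"
    unfolding iid_avg_def by (intro sum.cong refl) (simp add: abs_mult abs_prod P)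
  finally show ?thesis .
qed

lemma iid_avg_const: "avg (\<lambda>_. c) = c"
proof -
  have "(\<Sum>\<omega>\<in>{..<m} \<rightarrow>\<^sub>E S. \<Prod>j<m. P (\<omega> j)) = (\<Prod>j\<in>{..<m}. \<Sum>s\<in>S. P s)"
    using S by (intro prod_sum_PiE[symmetric]) auto
  then show ?thesis
    by (simp add: iid_avg_def sum_distrib_right[symmetric] P)
qed

lemma iid_avg_coordinate:
  assumes j: "j < m"
  shows "avg (\<lambda>\<omega>. h (\<omega> j)) = (\<Sum>s\<in>S. P s * h s)"
proof -
  have "avg (\<lambda>\<omega>. h (\<omega> j)) = (\<Sum>\<omega>\<in>{..<m} \<rightarrow>\<^sub>E S. \<Prod>i<m. P (\<omega> i) * (if i = j then h (\<omega> i) else 1))"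
    unfolding iid_avg_def using j by (simp add: prod.distrib)
  also have "\<dots> = (\<Prod>i\<in>{..<m}. \<Sum>s\<in>S. P s * (if i = j then h s else 1))"
    using S by (intro prod_sum_PiE[symmetric]) auto
  also have "\<dots> = (\<Prod>i\<in>{..<m}. if i = j then \<Sum>s\<in>S. P s * h s else 1)"
    by (intro prod.cong refl) (simp add: P)
  finally show ?thesis
    using j by simp
qed

text \<open>Exchanging the entries of two independent samples on the coordinates in \<open>J\<close>
  is an involution that preserves the product weights. It plays the part of the random signs in the
  usual symmetrization.\<close>

lemma iid_avg_swap:
  "avg (\<lambda>\<omega>. avg (\<lambda>\<omega>'. h (\<lambda>j. if j \<in> J then \<omega>' j else \<omega> j) (\<lambda>j. if j \<in> J then \<omega> j else \<omega>' j)))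
    = avg (\<lambda>\<omega>. avg (\<lambda>\<omega>'. h \<omega> \<omega>'))"
proof -
  let ?O = "{..<m} \<rightarrow>\<^sub>E S"
  define sw where "sw = (\<lambda>(\<omega>, \<omega>'). ((\<lambda>j. if j \<in> J then \<omega>' j else \<omega> j), (\<lambda>j. if j \<in> J then \<omega> j else (\<omega>' j :: 's))))"
  define w where "w p = (\<Prod>j<m. P (fst p j)) * (\<Prod>j<m. P (snd p j))" for p :: "(nat \<Rightarrow> 's) \<times> (nat \<Rightarrow> 's)"
  have eq: "avg (\<lambda>\<omega>. avg (\<lambda>\<omega>'. g (\<omega>, \<omega>'))) = (\<Sum>p\<in>?O \<times> ?O. w p * g p)" for g
    unfolding iid_avg_def sum_distrib_left sum.cartesian_product' by (simp add: w_def mult.assoc)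
  have swsw: "sw (sw p) = p" for p
    by (cases p) (auto simp: sw_def)
  have swO: "sw p \<in> ?O \<times> ?O" if "p \<in> ?O \<times> ?O" for p
    using that by (cases p) (auto simp: sw_def PiE_iff extensional_def)
  have wsw: "w (sw p) = w p" for p
    unfolding w_def prod.distrib[symmetric]
    by (intro prod.cong refl) (cases p, auto simp: sw_def)
  have "(\<Sum>p\<in>?O \<times> ?O. w p * case_prod h (sw p)) = (\<Sum>p\<in>?O \<times> ?O. w p * case_prod h p)"
    by (rule sum.reindex_bij_witness[of _ sw sw]) (auto simp: swsw swO wsw)
  then show ?thesis
    using eq[of "\<lambda>p. case_prod h (sw p)"] eq[of "case_prod h"] by (simp add: sw_def)
qed

text \<open>A second independent sample replaces the mean, Gaussian moduli are inserted by Jensen,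
  and the swap symmetry turns moduli into signed Gaussians. The constant is a factor 2 for
  \<open>1 / c\<close>, where \<open>c \<ge> 1/2\<close> is the mean modulus, times 2 for separating
  the two samples.\<close>

lemma gaussian_symmetrization:
  fixes f :: "'q \<Rightarrow> 's \<Rightarrow> real"
  assumes Q: "finite Q" "Q \<noteq> {}"
  shows "avg (\<lambda>\<omega>. Max ((\<lambda>q. \<bar>\<Sum>j<m. f q (\<omega> j) - (\<Sum>s\<in>S. P s * f q s)\<bar>) ` Q))
    \<le> 4 * avg (\<lambda>\<omega>. \<integral>z. Max ((\<lambda>q. \<bar>lin_form m (\<lambda>j. f q (\<omega> j)) z\<bar>) ` Q) \<partial>gauss_vec m)"
proof -
  define c where "c = integral\<^sup>L std_gauss abs"
  have c: "1/2 \<le> c"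
    unfolding c_def by (rule std_gauss_abs_bounds)
  define \<mu> where "\<mu> q = (\<Sum>s\<in>S. P s * f q s)" for q
  define Z where "Z \<omega> = Max ((\<lambda>q. \<bar>\<Sum>j<m. f q (\<omega> j) - \<mu> q\<bar>) ` Q)" for \<omega>
  define D where "D q \<omega> \<omega>' j = f q (\<omega> j) - f q (\<omega>' j)" for q and \<omega> \<omega>' :: "nat \<Rightarrow> 's" and j
  define X where "X z \<omega> = Max ((\<lambda>q. \<bar>lin_form m (\<lambda>j. f q (\<omega> j)) z\<bar>) ` Q)" for z \<omega>
  define \<Psi> where "\<Psi> z \<omega> \<omega>' = Max ((\<lambda>q. \<bar>lin_form m (D q \<omega> \<omega>') z\<bar>) ` Q)" for z \<omega> \<omega>'
  let ?G = "gauss_vec m"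
  have Xi: "integrable ?G (\<lambda>z. X z \<omega>)" for \<omega>
    unfolding X_def by (intro integrable_Max_finite Q integrable_abs integrable_lin_form)
  have \<Psi>i: "integrable ?G (\<lambda>z. \<Psi> z \<omega> \<omega>')" for \<omega> \<omega>'
    unfolding \<Psi>_def by (intro integrable_Max_finite Q integrable_abs integrable_lin_form)
  have absi: "integrable ?G (\<lambda>z. lin_form m d (\<lambda>j. \<bar>z j\<bar>))" for d
    unfolding lin_form_def
    by (intro Bochner_Integration.integrable_sum integrable_mult_right integrable_abs integrable_gauss_vec_component) auto
  have \<Psi>ai: "integrable ?G (\<lambda>z. \<Psi> (\<lambda>j. \<bar>z j\<bar>) \<omega> \<omega>')" for \<omega> \<omega>'
    unfolding \<Psi>_def by (intro integrable_Max_finite Q integrable_abs absi)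
  \<comment> \<open>Two applications of Jensen at a maximizing \<open>q\<close>: the mean
    \<open>\<mu> q\<close> is an average over the second sample, and the constant \<open>c\<close>
    is the mean of each \<open>\<bar>z j\<bar>\<close>.\<close>
  have A: "c * Z \<omega> \<le> avg (\<lambda>\<omega>'. \<integral>z. \<Psi> (\<lambda>j. \<bar>z j\<bar>) \<omega> \<omega>' \<partial>?G)" for \<omega>
  proof -
    have "Z \<omega> \<in> (\<lambda>q. \<bar>\<Sum>j<m. f q (\<omega> j) - \<mu> q\<bar>) ` Q"
      unfolding Z_def using Q by (intro Max_in) auto
    then obtain q where q: "q \<in> Q" "Z \<omega> = \<bar>\<Sum>j<m. f q (\<omega> j) - \<mu> q\<bar>"
      by auto
    have "avg (\<lambda>\<omega>'. c * (\<Sum>j<m. D q \<omega> \<omega>' j)) = c * (\<Sum>j<m. f q (\<omega> j) - \<mu> q)"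
    proof -
      have "avg (\<lambda>\<omega>'. D q \<omega> \<omega>' j) = f q (\<omega> j) - \<mu> q" if "j < m" for j
      proof -
        have "avg (\<lambda>\<omega>'. D q \<omega> \<omega>' j) = avg (\<lambda>_. f q (\<omega> j)) + (- 1) * avg (\<lambda>\<omega>'. f q (\<omega>' j))"
          unfolding iid_avg_cmult[symmetric] iid_avg_add[symmetric] by (simp add: D_def)
        then show ?thesis
          unfolding iid_avg_const iid_avg_coordinate[OF that] \<mu>_def by simp
      qed
      then show ?thesis
        unfolding iid_avg_cmult iid_avg_sum by simp
    qed
    then have "c * Z \<omega> = \<bar>avg (\<lambda>\<omega>'. c * (\<Sum>j<m. D q \<omega> \<omega>' j))\<bar>"
      using c by (simp add: q abs_mult)
    also have "\<dots> \<le> avg (\<lambda>\<omega>'. \<bar>c * (\<Sum>j<m. D q \<omega> \<omega>' j)\<bar>)"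
      by (rule iid_avg_abs)
    also have "\<dots> \<le> avg (\<lambda>\<omega>'. \<integral>z. \<Psi> (\<lambda>j. \<bar>z j\<bar>) \<omega> \<omega>' \<partial>?G)"
    proof (rule iid_avg_mono)
      fix \<omega>'
      have "(\<integral>z. \<bar>z j\<bar> \<partial>?G) = c" if "j < m" for j
        using integral_gauss_vec_component[OF that, of abs] by (simp add: c_def)
      then have "(\<integral>z. lin_form m (D q \<omega> \<omega>') (\<lambda>j. \<bar>z j\<bar>) \<partial>?G) = (\<Sum>j<m. D q \<omega> \<omega>' j * c)"
        unfolding lin_form_def
        by (subst Bochner_Integration.integral_sum)
          (auto intro!: integrable_mult_right integrable_abs integrable_gauss_vec_component)
      then have "\<bar>c * (\<Sum>j<m. D q \<omega> \<omega>' j)\<bar> = \<bar>\<integral>z. lin_form m (D q \<omega> \<omega>') (\<lambda>j. \<bar>z j\<bar>) \<partial>?G\<bar>"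
        by (simp add: sum_distrib_left mult.commute)
      also have "\<dots> \<le> (\<integral>z. \<bar>lin_form m (D q \<omega> \<omega>') (\<lambda>j. \<bar>z j\<bar>)\<bar> \<partial>?G)"
        by (rule integral_abs_bound)
      also have "\<dots> \<le> (\<integral>z. \<Psi> (\<lambda>j. \<bar>z j\<bar>) \<omega> \<omega>' \<partial>?G)"
        using q(1) Q by (intro integral_mono \<Psi>ai integrable_abs absi) (auto simp: \<Psi>_def)
      finally show "\<bar>c * (\<Sum>j<m. D q \<omega> \<omega>' j)\<bar> \<le> (\<integral>z. \<Psi> (\<lambda>j. \<bar>z j\<bar>) \<omega> \<omega>' \<partial>?G)" .
    qed
    finally show ?thesis .
  qed
  \<comment> \<open>\<open>D q\<close> is antisymmetric in the two samples, so swapping them where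
    \<open>z j < 0\<close> changes \<open>\<bar>z j\<bar>\<close> into \<open>z j\<close> without
    changing the double average, for every fixed \<open>z\<close>.\<close>
  have B: "avg (\<lambda>\<omega>. avg (\<Psi> (\<lambda>j. \<bar>z j\<bar>) \<omega>)) = avg (\<lambda>\<omega>. avg (\<Psi> z \<omega>))" for z
  proof -
    let ?J = "{j. z j < 0}"
    have "lin_form m (D q \<omega> \<omega>') (\<lambda>j. \<bar>z j\<bar>)
      = lin_form m (D q (\<lambda>j. if j \<in> ?J then \<omega>' j else \<omega> j) (\<lambda>j. if j \<in> ?J then \<omega> j else \<omega>' j)) z" for q \<omega> \<omega>'
      unfolding lin_form_def D_def by (intro sum.cong refl) (auto simp: algebra_simps)
    then have "\<Psi> (\<lambda>j. \<bar>z j\<bar>) = (\<lambda>\<omega> \<omega>'.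
      \<Psi> z (\<lambda>j. if j \<in> ?J then \<omega>' j else \<omega> j) (\<lambda>j. if j \<in> ?J then \<omega> j else \<omega>' j))"
      unfolding \<Psi>_def by (intro ext) (simp only:)
    then show ?thesis
      using iid_avg_swap[of "\<Psi> z" ?J] by (simp only:)
  qed
  have C: "\<Psi> z \<omega> \<omega>' \<le> X z \<omega> + X z \<omega>'" for z \<omega> \<omega>'
    unfolding \<Psi>_def
  proof (rule Max.boundedI)
    fix r assume "r \<in> (\<lambda>q. \<bar>lin_form m (D q \<omega> \<omega>') z\<bar>) ` Q"
    then obtain q where q: "q \<in> Q" "r = \<bar>lin_form m (D q \<omega> \<omega>') z\<bar>" by auto
    have "r \<le> \<bar>lin_form m (\<lambda>j. f q (\<omega> j)) z\<bar> + \<bar>lin_form m (\<lambda>j. f q (\<omega>' j)) z\<bar>"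
      unfolding q(2) D_def lin_form_diff by linarith
    also have "\<dots> \<le> X z \<omega> + X z \<omega>'"
      unfolding X_def using q(1) Q by (intro add_mono Max_ge) auto
    finally show "r \<le> X z \<omega> + X z \<omega>'" .
  qed (use Q in auto)
  have "1/2 * avg Z \<le> avg (\<lambda>\<omega>. c * Z \<omega>)"
  proof -
    have Z0: "0 \<le> Z \<omega>" for \<omega>
    proof -
      obtain q where "q \<in> Q" using Q by blast
      then have "\<bar>\<Sum>j<m. f q (\<omega> j) - \<mu> q\<bar> \<le> Z \<omega>"
        unfolding Z_def using Q by (intro Max_ge) auto
      then show ?thesis by linarith
    qed
    show ?thesis
      unfolding iid_avg_cmult[symmetric] using c Z0 by (intro iid_avg_mono mult_right_mono) auto
  qed
  also have "\<dots> \<le> avg (\<lambda>\<omega>. avg (\<lambda>\<omega>'. \<integral>z. \<Psi> (\<lambda>j. \<bar>z j\<bar>) \<omega> \<omega>' \<partial>?G))"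
    by (intro iid_avg_mono A)
  also have "\<dots> = (\<integral>z. avg (\<lambda>\<omega>. avg (\<Psi> (\<lambda>j. \<bar>z j\<bar>) \<omega>)) \<partial>?G)"
    by (simp add: integral_iid_avg \<Psi>ai)
  also have "\<dots> = (\<integral>z. avg (\<lambda>\<omega>. avg (\<Psi> z \<omega>)) \<partial>?G)"
    by (simp only: B)
  also have "\<dots> \<le> (\<integral>z. avg (\<lambda>\<omega>. avg (\<lambda>\<omega>'. X z \<omega> + X z \<omega>')) \<partial>?G)"
    by (intro integral_mono integral_iid_avg(1) iid_avg_mono C \<Psi>i Xi Bochner_Integration.integrable_add)
  also have "\<dots> = 2 * avg (\<lambda>\<omega>. \<integral>z. X z \<omega> \<partial>?G)"
    by (simp add: iid_avg_add iid_avg_const integral_iid_avg Xi)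
  finally show ?thesis
    by (simp add: Z_def[symmetric] X_def[symmetric] \<mu>_def[symmetric])
qed

end

subsection \<open>General sets\<close>

text \<open>The indicator of a pair changes only if one of its two points changes side, so the
  increments of the pair process are at most those of \<open>sqrt A\<close> times a sum of two
  independent hemisphere processes, one for each point. The factor 4 comes from these two copies and
  from treating the absolute value as a process and its negative.\<close>

lemma crossing_process_bound:
  fixes U :: "nat \<Rightarrow> (nat \<Rightarrow> real) set"
  assumes T: "finite T" "T \<noteq> {}" "T \<subseteq> sphere_n n" and g: "hemi_gram n T k v" and A: "A \<ge> 0"
    and le: "\<And>x y. x \<in> T \<Longrightarrow> y \<in> T \<Longrightarrow> (\<Sum>j<m. of_bool ((x \<in> U j) \<noteq> (y \<in> U j))) \<le> A * sdist n x y"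
  shows "(\<integral>z. Max ((\<lambda>p. \<bar>lin_form m (\<lambda>j. of_bool ((fst p \<in> U j) \<noteq> (snd p \<in> U j))) z\<bar>) ` (T \<times> T)) \<partial>gauss_vec m)
    \<le> 4 * sqrt A * gram_width T k v"
proof -
  define a where "a p j = (of_bool ((fst p \<in> U j) \<noteq> (snd p \<in> U j)) :: real)" for p j
  \<comment> \<open>The two independent copies occupy two blocks of \<open>k\<close> coordinates,
    one for \<open>fst p\<close> and one for \<open>snd p\<close>.\<close>
  define b where "b p i = sqrt A * (if i < k then v (fst p) i else v (snd p) (i - k))" for p i
  let ?Q = "T \<times> T"
  have Q: "finite ?Q" "?Q \<noteq> {}" using T by auto
  let ?M = "\<lambda>z. Max ((\<lambda>x. lin_form k (v x) z) ` T)"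
  have Mm: "?M \<in> borel_measurable (gauss_vec k)"
    by (intro measurable_Max_finite T measurable_lin_form)
  have Mi: "integrable (gauss_vec k) ?M"
    by (intro integrable_Max_finite T integrable_lin_form)
  have splitsum: "(\<Sum>i<k + k. f i) = (\<Sum>i<k. f i) + (\<Sum>i<k. f (i + k))" for f :: "nat \<Rightarrow> real"
  proof -
    have "(\<Sum>i<k + k. f i) = (\<Sum>i<k. f i) + (\<Sum>i=k..<k + k. f i)"
      using sum.atLeastLessThan_concat[of 0 k "k + k" f] by (simp add: atLeast0LessThan)
    also have "(\<Sum>i=k..<k + k. f i) = (\<Sum>i<k. f (i + k))"
      using sum.shift_bounds_nat_ivl[of f 0 k k] by (simp add: atLeast0LessThan)
    finally show ?thesis .
  qed
  have inc: "(\<Sum>j<m. (a p j - a q j)\<^sup>2) \<le> (\<Sum>i<k + k. (b p i - b q i)\<^sup>2)" if pq: "p \<in> ?Q" "q \<in> ?Q" for p q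
  proof -
    have "(\<Sum>j<m. (a p j - a q j)\<^sup>2)
        \<le> (\<Sum>j<m. of_bool ((fst p \<in> U j) \<noteq> (fst q \<in> U j)) + of_bool ((snd p \<in> U j) \<noteq> (snd q \<in> U j)))"
      by (intro sum_mono) (auto simp: a_def)
    also have "\<dots> \<le> A * sdist n (fst p) (fst q) + A * sdist n (snd p) (snd q)"
      unfolding sum.distrib using pq by (intro add_mono le) auto
    also have "\<dots> = (\<Sum>i<k + k. (b p i - b q i)\<^sup>2)"
    proof -
      have "(\<Sum>i<k + k. (b p i - b q i)\<^sup>2)
          = A * (\<Sum>i<k. (v (fst p) i - v (fst q) i)\<^sup>2) + A * (\<Sum>i<k. (v (snd p) i - v (snd q) i)\<^sup>2)"
        unfolding splitsum sum_distrib_left using A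
        by (simp add: b_def right_diff_distrib[symmetric] power_mult_distrib)
      then show ?thesis
        using pq T by (auto simp: hemi_gram_increment[OF g])
    qed
    finally show ?thesis .
  qed
  have inc': "(\<Sum>j<m. (- a p j - - a q j)\<^sup>2) \<le> (\<Sum>i<k + k. (b p i - b q i)\<^sup>2)" if "p \<in> ?Q" "q \<in> ?Q" for p q
    using inc[OF that] by (simp add: power2_commute)
  let ?Y = "\<integral>z. Max ((\<lambda>p. lin_form (k + k) (b p) z) ` ?Q) \<partial>gauss_vec (k + k)"
  have Y: "?Y \<le> 2 * sqrt A * gram_width T k v"
  proof -
    have blk: "integrable (gauss_vec (k + k)) (\<lambda>z. ?M (\<lambda>i\<in>{..<k}. z (i + k)))"
      "integrable (gauss_vec (k + k)) (\<lambda>z. ?M (\<lambda>i\<in>{..<k}. z i))"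
      unfolding lin_form_def
      by (intro integrable_Max_finite T Bochner_Integration.integrable_sum integrable_mult_right;
          auto intro: integrable_gauss_vec_component)+
    have "?Y \<le> (\<integral>z. sqrt A * (?M (\<lambda>i\<in>{..<k}. z i) + ?M (\<lambda>i\<in>{..<k}. z (i + k))) \<partial>gauss_vec (k + k))"
    proof (rule integral_mono)
      show "integrable (gauss_vec (k + k)) (\<lambda>z. Max ((\<lambda>p. lin_form (k + k) (b p) z) ` ?Q))"
        by (intro integrable_Max_finite Q integrable_lin_form)
      show "integrable (gauss_vec (k + k)) (\<lambda>z. sqrt A * (?M (\<lambda>i\<in>{..<k}. z i) + ?M (\<lambda>i\<in>{..<k}. z (i + k))))"
        using blk by simp
      fix z
      show "Max ((\<lambda>p. lin_form (k + k) (b p) z) ` ?Q) \<le> sqrt A * (?M (\<lambda>i\<in>{..<k}. z i) + ?M (\<lambda>i\<in>{..<k}. z (i + k)))"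
      proof (rule Max.boundedI)
        fix r assume "r \<in> (\<lambda>p. lin_form (k + k) (b p) z) ` ?Q"
        then obtain x y where xy: "x \<in> T" "y \<in> T" "r = lin_form (k + k) (b (x, y)) z" by auto
        have "r = sqrt A * (lin_form k (v x) (\<lambda>i\<in>{..<k}. z i) + lin_form k (v y) (\<lambda>i\<in>{..<k}. z (i + k)))"
          unfolding xy(3) lin_form_def splitsum by (simp add: b_def sum_distrib_left mult_ac distrib_left)
        also have "\<dots> \<le> sqrt A * (?M (\<lambda>i\<in>{..<k}. z i) + ?M (\<lambda>i\<in>{..<k}. z (i + k)))"
          using A xy T by (intro mult_left_mono add_mono Max_ge) auto
        finally show "r \<le> sqrt A * (?M (\<lambda>i\<in>{..<k}. z i) + ?M (\<lambda>i\<in>{..<k}. z (i + k)))" .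
      qed (use Q in auto)
    qed
    also have "\<dots> = sqrt A * ((\<integral>z. ?M (\<lambda>i\<in>{..<k}. z i) \<partial>gauss_vec (k + k)) + (\<integral>z. ?M (\<lambda>i\<in>{..<k}. z (i + k)) \<partial>gauss_vec (k + k)))"
      using blk by simp
    also have "\<dots> = 2 * sqrt A * (\<integral>z. ?M z \<partial>gauss_vec k)"
      unfolding integral_gauss_vec_block(1)[OF Mm, of k] integral_gauss_vec_block(2)[OF Mm, of k] by simp
    also have "\<dots> \<le> 2 * sqrt A * gram_width T k v"
      using A by (intro mult_left_mono integral_Max_le_gram_width T) auto
    finally show ?thesis .
  qed
  have i: "integrable (gauss_vec m) (\<lambda>z. Max ((\<lambda>p. lin_form m (c p) z) ` ?Q))" for c
    by (intro integrable_Max_finite Q integrable_lin_form)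
  have "(\<integral>z. Max ((\<lambda>p. \<bar>lin_form m (a p) z\<bar>) ` ?Q) \<partial>gauss_vec m)
    \<le> (\<integral>z. Max ((\<lambda>p. lin_form m (a p) z) ` ?Q) + Max ((\<lambda>p. lin_form m (\<lambda>j. - a p j) z) ` ?Q) \<partial>gauss_vec m)"
  proof (intro integral_mono Bochner_Integration.integrable_add i)
    show "integrable (gauss_vec m) (\<lambda>z. Max ((\<lambda>p. \<bar>lin_form m (a p) z\<bar>) ` ?Q))"
      by (intro integrable_Max_finite Q integrable_abs integrable_lin_form)
    fix z
    \<comment> \<open>A diagonal pair gives the zero form, so both maxima are nonnegative and their
      sum dominates the absolute value.\<close>
    obtain x0 where "x0 \<in> T" using T by blast
    then have x0: "(x0, x0) \<in> ?Q" "lin_form m (a (x0, x0)) z = 0"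
      by (auto simp: lin_form_def a_def)
    show "Max ((\<lambda>p. \<bar>lin_form m (a p) z\<bar>) ` ?Q)
       \<le> Max ((\<lambda>p. lin_form m (a p) z) ` ?Q) + Max ((\<lambda>p. lin_form m (\<lambda>j. - a p j) z) ` ?Q)"
    proof (rule Max.boundedI)
      fix r assume "r \<in> (\<lambda>p. \<bar>lin_form m (a p) z\<bar>) ` ?Q"
      then obtain p where p: "p \<in> ?Q" "r = \<bar>lin_form m (a p) z\<bar>" by blast
      have ge: "lin_form m (a q) z \<le> Max ((\<lambda>p. lin_form m (a p) z) ` ?Q)"
        "lin_form m (\<lambda>j. - a q j) z \<le> Max ((\<lambda>p. lin_form m (\<lambda>j. - a p j) z) ` ?Q)" if "q \<in> ?Q" for q
        using that Q by (auto intro!: Max_ge imageI)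
      show "r \<le> Max ((\<lambda>p. lin_form m (a p) z) ` ?Q) + Max ((\<lambda>p. lin_form m (\<lambda>j. - a p j) z) ` ?Q)"
        using ge[OF p(1)] ge[OF x0(1)] x0(2) unfolding p(2) lin_form_uminus by linarith
    qed (use Q in auto)
  qed
  also have "\<dots> = (\<integral>z. Max ((\<lambda>p. lin_form m (a p) z) ` ?Q) \<partial>gauss_vec m)
      + (\<integral>z. Max ((\<lambda>p. lin_form m (\<lambda>j. - a p j) z) ` ?Q) \<partial>gauss_vec m)"
    using i by simp
  also have "\<dots> \<le> ?Y + ?Y"
    by (intro add_mono sudakov_fernique Q inc inc')
  also have "\<dots> \<le> 4 * sqrt A * gram_width T k v"
    using Y by simp
  finally show ?thesis
    unfolding a_def .
qed

text \<open>\<open>2 ^ 14 = 128^2\<close> is chosen so that the symmetrized process is at most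
  \<open>m * \<delta> / 32 + Z / 8\<close>. The factor 4 of symmetrization gives
  \<open>avg Z \<le> m * \<delta> / 8 + avg Z / 2\<close>, and the second term is absorbed. Some
  sample then has \<open>Z < m * \<delta> / 2\<close>, and passing to net points at distance below
  \<open>\<delta> / 4\<close> uses the other half of the error.\<close>

lemma exists_RIP_general:
  fixes \<delta> :: real
  assumes \<delta>: "0 < \<delta>" "\<delta> < 1" and K: "K \<subseteq> sphere_n n" and m: "real m \<ge> 2 ^ 14 * \<delta> powr (-2) * (hemi_width n K)\<^sup>2"
  shows "\<exists>\<phi>. is_RIP n m K \<phi> \<delta>"
proof -
  let ?H = "hemi_width n K"
  have \<delta>2: "\<delta> powr (-2) = 1 / \<delta>\<^sup>2"
    using \<delta> by (simp add: powr_minus powr_numeral divide_inverse)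
  consider "K = {}" | "K \<noteq> {}" "m = 0" | "K \<noteq> {}" "m > 0" by blast
  then show ?thesis
  proof cases
    case 1
    then show ?thesis by (simp add: is_RIP_def)
  next
    \<comment> \<open>With \<open>m = 0\<close> the Hamming distance is \<open>0 / 0 = 0\<close>, so
      all distances in \<open>K\<close> have to vanish; the hypothesis gives zero width and hence
      exactly that.\<close>
    case 2
    then have "?H = 0"
      using m \<delta> by (simp add: \<delta>2 divide_le_0_iff)
    then have "is_RIP n m K (\<lambda>x j. 1) \<delta>"
      using hemi_width_zero_imp[OF K] \<delta> by (simp add: is_RIP_def cube_def hamming_def)
    then show ?thesis by blast
  next
    case 3
    have mp: "real m > 0" using 3 by simp
    have "\<delta> / 4 > 0" "\<delta> / 4 \<le> 1" using \<delta> by auto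
    from exists_separated_net[OF K this] obtain T where T: "finite T" "T \<subseteq> K"
      and sep: "\<And>x y. x \<in> T \<Longrightarrow> y \<in> T \<Longrightarrow> x \<noteq> y \<Longrightarrow> \<delta> / 4 \<le> sdist n x y"
      and dense: "\<And>x. x \<in> K \<Longrightarrow> \<exists>t\<in>T. sdist n x t < \<delta> / 4"
      by metis
    have T0: "T \<noteq> {}" using dense 3 by blast
    have TS: "T \<subseteq> sphere_n n" using T K by blast
    obtain k v where g: "hemi_gram n T k v"
      using exists_hemi_gram[OF T(1) TS] .
    have W: "gram_width T k v \<le> ?H"
      by (rule gram_width_le_hemi_width[OF K T(1) T0 T(2) g])
    obtain P where P: "\<And>U. 0 \<le> P U" "(\<Sum>U\<in>Pow T. P U) = 1"
      and Pd: "\<And>x y. x \<in> T \<Longrightarrow> y \<in> T \<Longrightarrow> (\<Sum>U\<in>Pow T. P U * of_bool ((x \<in> U) \<noteq> (y \<in> U))) = sdist n x y"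
      using pattern_probabilities[OF T(1) TS] by blast
    have fin: "finite (Pow T)" using T by simp
    define f where "f p U = (of_bool ((fst p \<in> U) \<noteq> (snd p \<in> U)) :: real)" for p :: "(nat \<Rightarrow> real) \<times> (nat \<Rightarrow> real)" and U
    let ?Q = "T \<times> T"
    have Q: "finite ?Q" "?Q \<noteq> {}" using T T0 by auto
    let ?avg = "iid_avg (Pow T) P m"
    define Z where "Z \<omega> = Max ((\<lambda>q. \<bar>\<Sum>j<m. f q (\<omega> j) - (\<Sum>U\<in>Pow T. P U * f q U)\<bar>) ` ?Q)" for \<omega>
    have Zge: "\<bar>(\<Sum>j<m. of_bool ((x \<in> \<omega> j) \<noteq> (y \<in> \<omega> j))) - m * sdist n x y\<bar> \<le> Z \<omega>"
      if xy: "x \<in> T" "y \<in> T" for x y \<omega>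
    proof -
      have "(\<Sum>U\<in>Pow T. P U * f (x, y) U) = sdist n x y"
        unfolding f_def using Pd[OF xy] by simp
      then have "\<bar>(\<Sum>j<m. of_bool ((x \<in> \<omega> j) \<noteq> (y \<in> \<omega> j))) - m * sdist n x y\<bar>
        = (\<lambda>q. \<bar>\<Sum>j<m. f q (\<omega> j) - (\<Sum>U\<in>Pow T. P U * f q U)\<bar>) (x, y)"
        by (simp add: sum_subtractf f_def)
      also have "\<dots> \<le> Z \<omega>"
        unfolding Z_def using Q xy by (intro Max_ge imageI finite_imageI SigmaI) auto
      finally show ?thesis .
    qed
    have Z0: "0 \<le> Z \<omega>" for \<omega>
    proof -
      obtain x where "x \<in> T" using T0 by blast
      then show ?thesis using Zge[of x x \<omega>] by linarith
    qed
    have mH: "sqrt m * ?H \<le> m * \<delta> / 128"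
    proof (cases "?H \<le> 0")
      case True
      then have "sqrt m * ?H \<le> 0" by (simp add: mult_nonneg_nonpos)
      also have "0 \<le> m * \<delta> / 128" using \<delta> by simp
      finally show ?thesis .
    next
      case False
      have "(128 * ?H)\<^sup>2 \<le> (sqrt m * \<delta>)\<^sup>2"
        using m \<delta> by (simp add: \<delta>2 power_mult_distrib field_simps)
      then have "128 * ?H \<le> sqrt m * \<delta>"
        using \<delta> by (intro power2_le_imp_le[of "128 * ?H"]) auto
      then have "sqrt m * (128 * ?H) \<le> sqrt m * (sqrt m * \<delta>)"
        by (intro mult_left_mono) auto
      then show ?thesis by (simp add: mult.assoc[symmetric])
    qed
    have process: "(\<integral>z. Max ((\<lambda>q. \<bar>lin_form m (\<lambda>j. f q (\<omega> j)) z\<bar>) ` ?Q) \<partial>gauss_vec m)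
       \<le> m * \<delta> / 32 + Z \<omega> / 8" for \<omega>
    proof -
      \<comment> \<open>For distinct net points \<open>Z \<le> (4 * Z / \<delta>) * d\<close> by
        separation, so the number of crossings, at most \<open>m * d + Z\<close>, is at most
        \<open>A * d\<close>.\<close>
      define A where "A = m + 4 * Z \<omega> / \<delta>"
      have A: "A \<ge> 0" unfolding A_def using Z0[of \<omega>] \<delta> by simp
      have "(\<integral>z. Max ((\<lambda>q. \<bar>lin_form m (\<lambda>j. f q (\<omega> j)) z\<bar>) ` ?Q) \<partial>gauss_vec m) \<le> 4 * sqrt A * gram_width T k v"
        unfolding f_def
      proof (rule crossing_process_bound[OF T(1) T0 TS g A])
        fix x y assume xy: "x \<in> T" "y \<in> T"
        show "(\<Sum>j<m. of_bool ((x \<in> \<omega> j) \<noteq> (y \<in> \<omega> j))) \<le> A * sdist n x y"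
        proof (cases "x = y")
          case False
          have "Z \<omega> = (4 * Z \<omega> / \<delta>) * (\<delta> / 4)"
            using \<delta> by simp
          also have "\<dots> \<le> (4 * Z \<omega> / \<delta>) * sdist n x y"
            using Z0 \<delta> sep[OF xy False] by (intro mult_left_mono) auto
          finally show ?thesis
            using Zge[OF xy, of \<omega>] unfolding A_def distrib_right by linarith
        next
          case True
          then show ?thesis using sdist_self xy TS by auto
        qed
      qed
      also have "\<dots> \<le> 4 * sqrt A * ?H"
        using W A by (intro mult_left_mono) auto
      also have "\<dots> \<le> 4 * (1 + 4 * Z \<omega> / (\<delta> * m)) * (m * \<delta> / 128)"
      proof -
        \<comment> \<open>Since \<open>B \<ge> 1\<close>, \<open>sqrt B \<le> B\<close>. The
          estimate becomes linear in \<open>Z \<omega>\<close> and can be averaged to an inequality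
          for \<open>avg Z\<close> itself.\<close>
        define B where "B = 1 + 4 * Z \<omega> / (\<delta> * m)"
        have B1: "B \<ge> 1" unfolding B_def using Z0[of \<omega>] \<delta> by simp
        have "A = m * B"
          unfolding A_def B_def using mp by (simp add: distrib_left)
        then have sA: "sqrt A = sqrt m * sqrt B" by (simp add: real_sqrt_mult)
        have sB: "sqrt B \<le> B"
          using B1 by (intro real_le_lsqrt) (auto simp: power2_eq_square)
        have "sqrt B * (sqrt m * ?H) \<le> sqrt B * (m * \<delta> / 128)"
          using B1 by (intro mult_left_mono mH) auto
        also have "\<dots> \<le> B * (m * \<delta> / 128)"
          using sB \<delta> by (intro mult_right_mono) auto
        finally show ?thesis
          unfolding sA B_def[symmetric] by (simp add: mult_ac)
      qed
      also have "\<dots> = m * \<delta> / 32 + Z \<omega> / 8"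
        using \<delta> mp by (simp add: field_simps)
      finally show ?thesis .
    qed
    have "?avg Z \<le> 4 * ?avg (\<lambda>\<omega>. \<integral>z. Max ((\<lambda>q. \<bar>lin_form m (\<lambda>j. f q (\<omega> j)) z\<bar>) ` ?Q) \<partial>gauss_vec m)"
      unfolding Z_def by (rule gaussian_symmetrization[OF fin P Q])
    also have "\<dots> \<le> 4 * ?avg (\<lambda>\<omega>. m * \<delta> / 32 + 1 / 8 * Z \<omega>)"
      using process by (intro mult_left_mono iid_avg_mono[OF fin P]) auto
    also have "\<dots> = m * \<delta> / 8 + ?avg Z / 2"
      unfolding iid_avg_add iid_avg_cmult iid_avg_const[OF fin P] by simp
    finally have avgZ: "?avg Z \<le> m * \<delta> / 4" by simp
    have "\<exists>\<omega>. Z \<omega> < m * \<delta> / 2"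
    proof (rule ccontr)
      assume "\<not> ?thesis"
      then have "?avg (\<lambda>_. m * \<delta> / 2) \<le> ?avg Z"
        by (intro iid_avg_mono[OF fin P]) (auto simp: not_less)
      moreover have "0 < m * \<delta>" using mp \<delta> by simp
      ultimately show False
        using avgZ unfolding iid_avg_const[OF fin P] by linarith
    qed
    then obtain \<omega> where \<omega>: "Z \<omega> < m * \<delta> / 2" by blast
    define \<pi> where "\<pi> x = (SOME t. t \<in> T \<and> sdist n x t < \<delta> / 4)" for x
    have \<pi>: "\<pi> x \<in> T \<and> sdist n x (\<pi> x) < \<delta> / 4" if "x \<in> K" for x
      using someI_ex[of "\<lambda>t. t \<in> T \<and> sdist n x t < \<delta> / 4"] dense[OF that]
      unfolding \<pi>_def by blast
    define \<phi> where "\<phi> x j = (if \<pi> x \<in> \<omega> j then 1 else -1 :: real)" for x j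
    have "is_RIP n m K \<phi> \<delta>"
      unfolding is_RIP_def
    proof (intro conjI ballI)
      show "\<phi> x \<in> cube m" for x
        by (simp add: cube_def \<phi>_def)
      fix x y assume xy: "x \<in> K" "y \<in> K"
      have pT: "\<pi> x \<in> T" "\<pi> y \<in> T" using \<pi> xy by blast+
      have "real (card {j. j < m \<and> \<phi> x j \<noteq> \<phi> y j}) = (\<Sum>j<m. of_bool ((\<pi> x \<in> \<omega> j) \<noteq> (\<pi> y \<in> \<omega> j)))"
        by (auto simp: \<phi>_def sum_of_bool_eq Int_def intro!: arg_cong[where f = card])
      then have "\<bar>m * hamming m (\<phi> x) (\<phi> y) - m * sdist n (\<pi> x) (\<pi> y)\<bar> < m * (\<delta> / 2)"
        using Zge[OF pT, of \<omega>] \<omega> mp by (simp add: hamming_def)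
      then have "m * \<bar>hamming m (\<phi> x) (\<phi> y) - sdist n (\<pi> x) (\<pi> y)\<bar> < m * (\<delta> / 2)"
        using mp by (simp add: right_diff_distrib[symmetric] abs_mult)
      then have "\<bar>hamming m (\<phi> x) (\<phi> y) - sdist n (\<pi> x) (\<pi> y)\<bar> < \<delta> / 2"
        using mp by (simp only: mult_less_cancel_left_pos)
      moreover have "\<bar>sdist n x y - sdist n (\<pi> x) (\<pi> y)\<bar> \<le> sdist n x (\<pi> x) + sdist n y (\<pi> y)"
        using xy pT K TS by (intro sdist_diff_le) auto
      ultimately show "\<bar>sdist n x y - hamming m (\<phi> x) (\<phi> y)\<bar> < \<delta>"
        using \<pi>[OF xy(1)] \<pi>[OF xy(2)] by linarith
    qed
    then show ?thesis by blast
  qed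
qed

subsection \<open>Concentration for independent samples\<close>

lemma measure_exp_bound:
  assumes "prob_space M" and m: "X \<in> borel_measurable M" and i: "integrable M (\<lambda>x. exp (X x))"
  shows "measure M {x \<in> space M. a \<le> X x} \<le> exp (- a) * (\<integral>x. exp (X x) \<partial>M)"
proof -
  interpret prob_space M by fact
  let ?A = "{x \<in> space M. a \<le> X x}"
  have A: "?A \<in> sets M"
    using m by measurable
  have "measure M ?A = (\<integral>x. indicator ?A x \<partial>M)"
    using A by simp
  also have "\<dots> \<le> (\<integral>x. exp (- a) * exp (X x) \<partial>M)"
  proof (rule integral_mono)
    show "integrable M (indicator ?A :: _ \<Rightarrow> real)"
      using A by (simp add: emeasure_eq_measure)
    show "integrable M (\<lambda>x. exp (- a) * exp (X x))"
      using i by simp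
    show "indicator ?A x \<le> exp (- a) * exp (X x)" for x
      by (auto simp: indicator_def exp_add[symmetric])
  qed
  finally show ?thesis by simp
qed

lemma iid_chernoff:
  assumes "prob_space M" and D: "D \<in> borel_measurable M"
    and i: "integrable M (\<lambda>x. exp (l * D x))" and b: "(\<integral>x. exp (l * D x) \<partial>M) \<le> exp \<kappa>" and l: "0 < l"
  shows "measure (PiM {..<m} (\<lambda>_. M)) {\<omega> \<in> space (PiM {..<m} (\<lambda>_. M)). a \<le> (\<Sum>j<m. D (\<omega> j))}
    \<le> exp (real m * \<kappa> - l * a)"
proof -
  interpret prob_space M by fact
  interpret P: product_prob_space "\<lambda>_::nat. M" UNIV ..
  let ?P = "PiM {..<m} (\<lambda>_. M)"
  have pP: "prob_space ?P"
    by (intro prob_space_PiM prob_space_axioms)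
  have Dm: "(\<lambda>\<omega>. D (\<omega> j)) \<in> borel_measurable ?P" if "j \<in> {..<m}" for j
    using that D by (intro measurable_compose[OF measurable_component_singleton])
  have e: "exp (l * (\<Sum>j<m. D (\<omega> j))) = (\<Prod>j<m. exp (l * D (\<omega> j)))" for \<omega>
    by (simp add: sum_distrib_left exp_sum)
  have ii: "integrable ?P (\<lambda>\<omega>. exp (l * (\<Sum>j<m. D (\<omega> j))))"
    unfolding e by (intro P.product_integrable_prod i) auto
  have "measure ?P {\<omega> \<in> space ?P. l * a \<le> l * (\<Sum>j<m. D (\<omega> j))}
    \<le> exp (- (l * a)) * (\<integral>\<omega>. exp (l * (\<Sum>j<m. D (\<omega> j))) \<partial>?P)"
    by (intro measure_exp_bound pP ii borel_measurable_times borel_measurable_sum Dm borel_measurable_const)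
  also have "(\<integral>\<omega>. exp (l * (\<Sum>j<m. D (\<omega> j))) \<partial>?P) = (\<Prod>j\<in>{..<m}. \<integral>x. exp (l * D x) \<partial>M)"
    unfolding e by (intro P.product_integral_prod i) auto
  also have "\<dots> \<le> (\<Prod>j\<in>{..<m}. exp \<kappa>)"
    by (intro prod_mono) (auto simp: b)
  also have "\<dots> = exp (real m * \<kappa>)"
    by (simp add: exp_of_nat_mult)
  finally show ?thesis
    using l by (simp add: exp_add[symmetric] mult_left_le_imp_le)
qed

text \<open>For negative \<open>x = - y\<close> the inequality follows from
  \<open>(1 + y) * (1 - y + y^2) = 1 + y^3 \<ge> 1\<close> and
  \<open>1 + y \<le> exp y\<close>.\<close>

lemma exp_le_quadratic:
  fixes x :: real
  assumes "\<bar>x\<bar> \<le> 1"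
  shows "exp x \<le> 1 + x + x\<^sup>2"
proof (cases "x \<ge> 0")
  case True
  then show ?thesis using exp_bound[of x] assms by simp
next
  case False
  define y where "y = - x"
  have y: "0 \<le> y" using False by (simp add: y_def)
  have "1 \<le> 1 + y ^ 3" using y by simp
  also have "\<dots> = (1 + y) * (1 - y + y\<^sup>2)"
    by (simp add: power2_eq_square power3_eq_cube algebra_simps)
  also have "\<dots> \<le> exp y * (1 - y + y\<^sup>2)"
  proof (rule mult_right_mono[OF exp_ge_add_one_self])
    have "0 \<le> 1 - y" using assms False by (simp add: y_def)
    then show "0 \<le> 1 - y + y\<^sup>2" by (simp add: add_nonneg_nonneg)
  qed
  finally have "exp (- y) \<le> 1 - y + y\<^sup>2"
    by (simp add: exp_minus field_simps)
  then show ?thesis by (simp add: y_def)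
qed

text \<open>The quadratic bound on the exponential controls the moment generating function, and
  \<open>l \<le> 1\<close> keeps \<open>l * D\<close> in its range. The parameter \<open>l\<close>
  stays free because each level of the chain picks its own.\<close>

lemma iid_bernstein:
  assumes "prob_space M" and D: "D \<in> borel_measurable M" and D1: "\<And>x. \<bar>D x\<bar> \<le> 1"
    and v: "(\<integral>x. (D x)\<^sup>2 \<partial>M) \<le> v" and l: "0 < l" "l \<le> 1"
  shows "measure (PiM {..<m} (\<lambda>_. M)) {\<omega> \<in> space (PiM {..<m} (\<lambda>_. M)). real m * ((\<integral>x. D x \<partial>M) + t) \<le> (\<Sum>j<m. D (\<omega> j))}
    \<le> exp (- real m * (l * t - l\<^sup>2 * v))"
proof -
  interpret prob_space M by fact
  let ?E = "\<integral>x. D x \<partial>M"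
  have iD: "integrable M D"
    using D D1 by (intro integrable_const_bound[where B = 1]) auto
  have D2: "(D x)\<^sup>2 \<le> 1" for x
    using D1[of x] by (simp add: abs_square_le_1)
  have iD2: "integrable M (\<lambda>x. (D x)\<^sup>2)"
    using D D2 by (intro integrable_const_bound[where B = 1]) auto
  have lD: "\<bar>l * D x\<bar> \<le> 1" for x
    using D1[of x] l mult_le_one[of l "\<bar>D x\<bar>"] by (simp add: abs_mult)
  have ie: "integrable M (\<lambda>x. exp (l * D x))"
  proof (rule integrable_const_bound[where B = "exp 1"])
    show "AE x in M. norm (exp (l * D x)) \<le> exp 1"
      using lD by (intro AE_I2) (auto simp: abs_le_iff)
    show "(\<lambda>x. exp (l * D x)) \<in> borel_measurable M"
      using D by measurable
  qed
  have "(\<integral>x. exp (l * D x) \<partial>M) \<le> (\<integral>x. 1 + l * D x + l\<^sup>2 * (D x)\<^sup>2 \<partial>M)"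
    using iD iD2 exp_le_quadratic[OF lD] by (intro integral_mono ie) (auto simp: power_mult_distrib)
  also have "\<dots> = 1 + l * ?E + l\<^sup>2 * (\<integral>x. (D x)\<^sup>2 \<partial>M)"
    using iD iD2 by (simp add: prob_space)
  also have "\<dots> \<le> 1 + (l * ?E + l\<^sup>2 * v)"
    using v by (simp add: mult_left_mono)
  also have "\<dots> \<le> exp (l * ?E + l\<^sup>2 * v)"
    by (rule exp_ge_add_one_self)
  finally have b: "(\<integral>x. exp (l * D x) \<partial>M) \<le> exp (l * ?E + l\<^sup>2 * v)" .
  have "real m * (l * ?E + l\<^sup>2 * v) - l * (real m * (?E + t)) = - real m * (l * t - l\<^sup>2 * v)"
    by (simp add: algebra_simps)
  then show ?thesis
    using iid_chernoff[OF prob_space_axioms D ie b l(1), of m "real m * (?E + t)"] by simp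
qed

lemma measure_union_bound:
  assumes "prob_space M" "finite I" "\<And>i. i \<in> I \<Longrightarrow> A i \<in> sets M" "\<And>i. i \<in> I \<Longrightarrow> measure M (A i) \<le> b"
  shows "measure M (\<Union>i\<in>I. A i) \<le> real (card I) * b"
proof -
  interpret prob_space M by fact
  have "measure M (\<Union>i\<in>I. A i) \<le> (\<Sum>i\<in>I. measure M (A i))"
    using assms by (intro finite_measure_subadditive_finite) auto
  also have "\<dots> \<le> (\<Sum>i\<in>I. b)"
    by (intro sum_mono assms)
  finally show ?thesis by simp
qed

text \<open>The one-sided bound for \<open>D\<close> and for \<open>- D\<close>, united over the
  finite family; the exceptional set is also shown measurable because it is removed later from the
  good event.\<close>

lemma iid_family_bernstein:
  fixes m :: nat
  assumes M: "prob_space M" and F: "finite F"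
    and D: "\<And>D. D \<in> F \<Longrightarrow> D \<in> borel_measurable M" "\<And>D x. D \<in> F \<Longrightarrow> \<bar>D x\<bar> \<le> 1"
    and v: "\<And>D. D \<in> F \<Longrightarrow> (\<integral>x. (D x)\<^sup>2 \<partial>M) \<le> v" and l: "0 < l" "l \<le> 1"
  defines "P \<equiv> PiM {..<m} (\<lambda>_. M)"
  shows "{\<omega> \<in> space P. \<exists>D\<in>F. real m * t \<le> \<bar>(\<Sum>j<m. D (\<omega> j)) - real m * (\<integral>x. D x \<partial>M)\<bar>} \<in> sets P" (is "?A \<in> _")
    "measure P {\<omega> \<in> space P. \<exists>D\<in>F. real m * t \<le> \<bar>(\<Sum>j<m. D (\<omega> j)) - real m * (\<integral>x. D x \<partial>M)\<bar>}
      \<le> 2 * real (card F) * exp (- real m * (l * t - l\<^sup>2 * v))"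
proof -
  have pP: "prob_space P"
    unfolding P_def by (intro prob_space_PiM M)
  interpret P: prob_space P by fact
  have Dm: "(\<lambda>\<omega>. \<Sum>j<m. D (\<omega> j)) \<in> borel_measurable P" if "D \<in> F" for D
    unfolding P_def by (intro borel_measurable_sum measurable_compose[OF measurable_component_singleton] D(1) that)
  let ?U = "\<lambda>D. {\<omega> \<in> space P. real m * ((\<integral>x. D x \<partial>M) + t) \<le> (\<Sum>j<m. D (\<omega> j))}"
  let ?L = "\<lambda>D. {\<omega> \<in> space P. real m * ((\<integral>x. - D x \<partial>M) + t) \<le> (\<Sum>j<m. - D (\<omega> j))}"
  have mU: "?U D \<in> sets P" if "D \<in> F" for D
    using Dm[OF that] by measurable
  have mL: "?L D \<in> sets P" if "D \<in> F" for D
    unfolding sum_negf using Dm[OF that] by measurable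
  have eq: "?A = (\<Union>D\<in>F. ?U D \<union> ?L D)"
  proof -
    have "real m * t \<le> \<bar>S - real m * E\<bar> \<longleftrightarrow> real m * (E + t) \<le> S \<or> real m * (- E + t) \<le> - S" for S E :: real
      by (auto simp: algebra_simps abs_if)
    then show ?thesis
      by (auto simp: sum_negf)
  qed
  show "?A \<in> sets P"
    unfolding eq using F mU mL by (intro sets.finite_UN sets.Un) auto
  have "measure P ?A \<le> real (card F) * (exp (- real m * (l * t - l\<^sup>2 * v)) + exp (- real m * (l * t - l\<^sup>2 * v)))"
    unfolding eq
  proof (rule measure_union_bound[OF pP F])
    fix D assume DF: "D \<in> F"
    show "?U D \<union> ?L D \<in> sets P"
      using mU[OF DF] mL[OF DF] by (rule sets.Un)
    have "measure P (?U D \<union> ?L D) \<le> measure P (?U D) + measure P (?L D)"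
      using mU[OF DF] mL[OF DF] by (rule measure_Un_le)
    also have "measure P (?U D) \<le> exp (- real m * (l * t - l\<^sup>2 * v))"
      unfolding P_def by (rule iid_bernstein[OF M D(1,2)[OF DF] v[OF DF] l])
    also have "measure P (?L D) \<le> exp (- real m * (l * t - l\<^sup>2 * v))"
      unfolding P_def by (rule iid_bernstein[OF M _ _ _ l]) (use D[OF DF] v[OF DF] in auto)
    finally show "measure P (?U D \<union> ?L D) \<le> exp (- real m * (l * t - l\<^sup>2 * v)) + exp (- real m * (l * t - l\<^sup>2 * v))"
      by simp
  qed
  then show "measure P ?A \<le> 2 * real (card F) * exp (- real m * (l * t - l\<^sup>2 * v))"
    by simp
qed

subsection \<open>One-dimensional Gaussian estimates\<close>

lemma sinner_gauss_law:
  assumes "f \<in> borel_measurable borel" "x \<in> sphere_n n"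
  shows "(\<integral>\<^sup>+z. f (sinner n z x) \<partial>gauss_vec (Suc n)) = (\<integral>\<^sup>+u. f u \<partial>std_gauss)"
  unfolding sinner_eq_sum_lessThan using nn_integral_gauss_vec_linear[OF assms(1), where x = x and k = "Suc n"]
  by (simp only: sinner_sphere[OF assms(2)] real_sqrt_one mult_1)

text \<open>The Gaussian density is at most \<open>1 / sqrt (2 * pi) \<le> 1/2\<close> and the slab
  is an interval of length \<open>2 * \<tau>\<close>.\<close>

lemma prob_slab_le:
  assumes x: "x \<in> sphere_n n" and \<tau>: "0 \<le> \<tau>"
  shows "measure (gauss_vec (Suc n)) {z \<in> space (gauss_vec (Suc n)). \<bar>sinner n z x\<bar> \<le> \<tau>} \<le> \<tau>"
proof -
  let ?M = "gauss_vec (Suc n)"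
  let ?A = "{z \<in> space ?M. \<bar>sinner n z x\<bar> \<le> \<tau>}"
  have A: "?A \<in> sets ?M"
    using measurable_sinner[of n x] by measurable
  have "emeasure ?M ?A = (\<integral>\<^sup>+z. indicator {- \<tau>..\<tau>} (sinner n z x) \<partial>?M)"
    unfolding nn_integral_indicator[OF A, symmetric]
    by (intro nn_integral_cong) (auto simp: indicator_def abs_le_iff)
  also have "\<dots> = (\<integral>\<^sup>+u. indicator {- \<tau>..\<tau>} u \<partial>std_gauss)"
    using x by (intro sinner_gauss_law) auto
  also have "\<dots> = (\<integral>\<^sup>+u. ennreal (std_normal_density u) * indicator {- \<tau>..\<tau>} u \<partial>lborel)"
    by (intro nn_integral_std_gauss) auto
  also have "\<dots> \<le> (\<integral>\<^sup>+u. ennreal (1 / 2) * indicator {- \<tau>..\<tau>} u \<partial>lborel)"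
  proof (intro nn_integral_mono mult_right_mono ennreal_leI)
    fix u :: real
    have "2 \<le> sqrt (2 * pi)"
      using pi_gt3 by (intro real_le_rsqrt) simp
    then have "1 / sqrt (2 * pi) \<le> 1 / 2"
      by (intro divide_left_mono) auto
    then have "1 / sqrt (2 * pi) * exp (- u\<^sup>2 / 2) \<le> 1 / 2 * 1"
      by (intro mult_mono) auto
    then show "std_normal_density u \<le> 1 / 2"
      by (simp add: std_normal_density_def)
  qed auto
  also have "\<dots> = ennreal \<tau>"
  proof -
    have "ennreal (1 / 2) * ennreal (2 * \<tau>) = ennreal \<tau>"
      using \<tau> by (subst ennreal_mult[symmetric]) auto
    moreover have "emeasure lborel {- \<tau>..\<tau>} = ennreal (2 * \<tau>)"
      using \<tau> by simp
    ultimately show ?thesis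
      by (subst nn_integral_cmult_indicator) (auto simp only: sets_lborel borel_closed closed_atLeastAtMost)
  qed
  finally show ?thesis
    using \<tau> gauss_vec.emeasure_eq_measure[of "Suc n" ?A] by (simp add: ennreal_le_iff)
qed

text \<open>The weight \<open>exp (u^2 / 4)\<close> turns the standard density into
  \<open>sqrt 2\<close> times the normal density of variance 2, so the integral is
  \<open>sqrt 2\<close>. It is rounded up to \<open>exp 1\<close> to fit \<open>iid_chernoff\<close>
  with \<open>\<kappa> = 1\<close>.\<close>

lemma exp_square_sinner:
  assumes x: "x \<in> sphere_n n"
  shows "integrable (gauss_vec (Suc n)) (\<lambda>z. exp (1 / 4 * (sinner n z x)\<^sup>2))"
    "(\<integral>z. exp (1 / 4 * (sinner n z x)\<^sup>2) \<partial>gauss_vec (Suc n)) \<le> exp 1"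
proof -
  let ?M = "gauss_vec (Suc n)"
  have m: "(\<lambda>z. exp (1 / 4 * (sinner n z x)\<^sup>2)) \<in> borel_measurable ?M"
    using measurable_sinner[of n x] by measurable
  have "(\<integral>\<^sup>+z. ennreal (exp (1 / 4 * (sinner n z x)\<^sup>2)) \<partial>?M) = (\<integral>\<^sup>+u. ennreal (exp (1 / 4 * u\<^sup>2)) \<partial>std_gauss)"
    using sinner_gauss_law[OF _ x, of "\<lambda>u. ennreal (exp (1 / 4 * u\<^sup>2))"] by simp
  also have "\<dots> = (\<integral>\<^sup>+u. ennreal (std_normal_density u) * ennreal (exp (1 / 4 * u\<^sup>2)) \<partial>lborel)"
    by (intro nn_integral_std_gauss) auto
  also have "\<dots> = (\<integral>\<^sup>+u. ennreal (sqrt 2) * ennreal (normal_density 0 (sqrt 2) u) \<partial>lborel)"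
  proof (intro nn_integral_cong)
    fix u :: real
    have "std_normal_density u * exp (1 / 4 * u\<^sup>2) = 1 / sqrt (2 * pi) * exp (- u\<^sup>2 / 4)"
      by (simp add: std_normal_density_def exp_add[symmetric])
    also have "\<dots> = sqrt 2 * normal_density 0 (sqrt 2) u"
    proof -
      have r: "sqrt (2 * pi * (sqrt 2)\<^sup>2) = sqrt (2 * pi) * sqrt 2"
        by (subst real_sqrt_mult) simp
      have e: "- (u - 0)\<^sup>2 / (2 * (sqrt 2)\<^sup>2) = - u\<^sup>2 / 4"
        by simp
      show ?thesis
        unfolding normal_density_def r e by simp
    qed
    finally show "ennreal (std_normal_density u) * ennreal (exp (1 / 4 * u\<^sup>2))
        = ennreal (sqrt 2) * ennreal (normal_density 0 (sqrt 2) u)"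
      by (simp add: ennreal_mult[symmetric])
  qed
  also have "\<dots> = ennreal (sqrt 2)"
    using prob_space.emeasure_space_1[OF prob_space_normal_density[of "sqrt 2" 0]]
    by (simp add: nn_integral_cmult emeasure_density)
  finally have nn: "(\<integral>\<^sup>+z. ennreal (exp (1 / 4 * (sinner n z x)\<^sup>2)) \<partial>?M) = ennreal (sqrt 2)" .
  show "integrable ?M (\<lambda>z. exp (1 / 4 * (sinner n z x)\<^sup>2))"
    using m by (rule integrableI_nn_integral_finite[OF _ _ nn]) auto
  have "(\<integral>z. exp (1 / 4 * (sinner n z x)\<^sup>2) \<partial>?M) = sqrt 2"
    using m nn by (subst integral_eq_nn_integral) auto
  also have "\<dots> \<le> 1 + 1"
    by (intro real_le_lsqrt) auto
  also have "\<dots> \<le> exp 1"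
    by (rule exp_ge_add_one_self)
  finally show "(\<integral>z. exp (1 / 4 * (sinner n z x)\<^sup>2) \<partial>?M) \<le> exp 1" .
qed

subsection \<open>Sparse vectors: the deterministic part\<close>

definition crossing :: "nat \<Rightarrow> (nat \<Rightarrow> real) \<Rightarrow> (nat \<Rightarrow> real) \<Rightarrow> (nat \<Rightarrow> real) \<Rightarrow> real" where
  "crossing n x y z = of_bool (crosses n x y z)"

lemma measurable_crossing: "crossing n x y \<in> borel_measurable (gauss_vec (Suc n))"
  using measurable_crosses[of n x y] unfolding crossing_def[abs_def] by measurable

lemma integrable_crossing: "integrable (gauss_vec (Suc n)) (crossing n x y)"
  by (rule gauss_vec.integrable_const_bound[where B = 1]) (auto simp: crossing_def measurable_crossing)

lemma integral_crossing:
  assumes "x \<in> sphere_n n" "y \<in> sphere_n n"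
  shows "(\<integral>z. crossing n x y z \<partial>gauss_vec (Suc n)) = sdist n x y"
proof -
  let ?M = "gauss_vec (Suc n)"
  have m: "{z \<in> space ?M. crosses n x y z} \<in> sets ?M"
    using measurable_crosses[of n x y] unfolding pred_def .
  have "(\<integral>z. crossing n x y z \<partial>?M) = (\<integral>z. indicator {z \<in> space ?M. crosses n x y z} z \<partial>?M)"
    by (intro Bochner_Integration.integral_cong) (auto simp: crossing_def indicator_def)
  also have "\<dots> = measure ?M {z \<in> space ?M. crosses n x y z}"
    using m by simp
  finally show ?thesis
    using prob_crosses[OF assms] by simp
qed

lemma crossing_diff_le:
  "\<bar>crossing n x' y' z - crossing n x y z\<bar> \<le> crossing n x x' z + crossing n y y' z"
  by (auto simp: crossing_def crosses_def)

text \<open>The increments of the chaining argument: between two consecutive scales the indicator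
  that a hyperplane separates a pair of net points changes only if the hyperplane separates one
  of the points from its successor.\<close>

definition scale :: "nat \<Rightarrow> real" where
  "scale k = (1 / 16) ^ k / 16384"

fun links :: "nat \<Rightarrow> (nat \<Rightarrow> (nat \<Rightarrow> real) set) \<Rightarrow> nat \<Rightarrow> ((nat \<Rightarrow> real) \<Rightarrow> real) set" where
  "links n N 0 = (\<lambda>(a, b). crossing n a b) ` (N 0 \<times> N 0)"
| "links n N (Suc k) = (\<lambda>((a, b), (a', b')) z. crossing n a' b' z - crossing n a b z) `
    {((a, b), (a', b')) \<in> (N k \<times> N k) \<times> (N (Suc k) \<times> N (Suc k)).
      sdist n a a' \<le> 2 * scale k \<and> sdist n b b' \<le> 2 * scale k}"

lemma finite_links:
  assumes "\<And>k. finite (N k)"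
  shows "finite (links n N k)"
proof (cases k)
  case (Suc i)
  have "finite ((N i \<times> N i) \<times> (N (Suc i) \<times> N (Suc i)))"
    using assms by simp
  then show ?thesis
    unfolding Suc links.simps by (intro finite_imageI) (rule finite_subset[rotated], auto)
qed (use assms in auto)

text \<open>A link is given by at most four net points, two at each of two consecutive levels;
  monotonicity of \<open>c\<close> bounds the coarser net by the finer exponent.\<close>

lemma card_links:
  assumes N: "\<And>k. finite (N k)" and c: "\<And>k. real (card (N k)) \<le> exp (c k)" "mono c" "\<And>k. 0 \<le> c k"
  shows "real (card (links n N k)) \<le> exp (4 * c k)"
proof (cases k)
  case 0
  have "card (links n N 0) \<le> card (N 0 \<times> N 0)"
    unfolding links.simps using N by (intro card_image_le) auto
  then have "real (card (links n N 0)) \<le> real (card (N 0)) * real (card (N 0))"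
    by (simp add: card_cartesian_product flip: of_nat_mult)
  also have "\<dots> \<le> exp (c 0) * exp (c 0)"
    using c by (intro mult_mono) auto
  also have "\<dots> \<le> exp (4 * c 0)"
    using c(3)[of 0] by (simp add: exp_add[symmetric])
  finally show ?thesis using 0 by simp
next
  case (Suc i)
  let ?P = "(N i \<times> N i) \<times> (N (Suc i) \<times> N (Suc i))"
  have fin: "finite ?P" using N by simp
  have "card (links n N k) \<le> card ?P"
    unfolding Suc links.simps
    by (rule order_trans[OF card_image_le card_mono]) (use fin in \<open>auto intro: finite_subset[OF _ fin]\<close>)
  then have "real (card (links n N k)) \<le> (real (card (N i)) * real (card (N i))) * (real (card (N (Suc i))) * real (card (N (Suc i))))"
    by (simp add: card_cartesian_product flip: of_nat_mult)
  also have "\<dots> \<le> (exp (c k) * exp (c k)) * (exp (c k) * exp (c k))"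
  proof -
    have "c i \<le> c k" using c(2) Suc by (simp add: mono_def)
    then have "real (card (N i)) \<le> exp (c k)"
      using c(1)[of i] by (meson exp_le_cancel_iff order_trans)
    moreover have "real (card (N (Suc i))) \<le> exp (c k)"
      using c(1)[of "Suc i"] Suc by simp
    ultimately show ?thesis
      by (intro mult_mono) auto
  qed
  also have "\<dots> = exp (4 * c k)"
    by (simp add: exp_add[symmetric])
  finally show ?thesis .
qed

text \<open>A difference of two indicators has square equal to its modulus, which is at most the sum
  of the two crossings between successive net points. The second moment is therefore at most the sum
  of their distances, \<open>4 * scale i\<close>, and this decays at least as fast as
  \<open>(1 / 8) ^ k\<close>.\<close>

lemma links_properties:
  assumes N: "\<And>k. N k \<subseteq> sphere_n n" and D: "D \<in> links n N k"
  shows "D \<in> borel_measurable (gauss_vec (Suc n))" "\<bar>D z\<bar> \<le> 1"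
    "(\<integral>z. (D z)\<^sup>2 \<partial>gauss_vec (Suc n)) \<le> (1 / 8) ^ k"
proof -
  let ?M = "gauss_vec (Suc n)"
  have "D \<in> borel_measurable ?M \<and> \<bar>D z\<bar> \<le> 1 \<and> (\<integral>z. (D z)\<^sup>2 \<partial>?M) \<le> (1 / 8) ^ k"
  proof (cases k)
    case 0
    then obtain a b where ab: "D = crossing n a b"
      using D by auto
    have "(D z)\<^sup>2 \<le> 1" for z by (simp add: ab crossing_def)
    then have "(\<integral>z. (D z)\<^sup>2 \<partial>?M) \<le> (\<integral>z. 1 \<partial>?M)"
      using measurable_crossing[of n a b]
      by (intro integral_mono gauss_vec.integrable_const_bound[where B = 1]) (auto simp: ab)
    then show ?thesis
      using 0 measurable_crossing[of n a b] by (simp add: ab crossing_def gauss_vec.prob_space)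
  next
    case (Suc i)
    then obtain a b a' b' where ab: "a \<in> N i" "b \<in> N i" "a' \<in> N (Suc i)" "b' \<in> N (Suc i)"
      and d: "sdist n a a' \<le> 2 * scale i" "sdist n b b' \<le> 2 * scale i"
      and D: "D = (\<lambda>z. crossing n a' b' z - crossing n a b z)"
      using D by auto
    have m: "D \<in> borel_measurable ?M"
      unfolding D by (intro borel_measurable_diff measurable_crossing)
    have D1: "\<bar>D z\<bar> \<le> 1" for z
      unfolding D by (auto simp: crossing_def)
    have D2: "(D z)\<^sup>2 = \<bar>D z\<bar>" for z
      unfolding D by (auto simp: crossing_def)
    have "(\<integral>z. (D z)\<^sup>2 \<partial>?M) \<le> (\<integral>z. crossing n a a' z + crossing n b b' z \<partial>?M)"
    proof (intro integral_mono Bochner_Integration.integrable_add integrable_crossing)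
      show "integrable ?M (\<lambda>z. (D z)\<^sup>2)"
        using m D1 by (intro gauss_vec.integrable_const_bound[where B = 1]) (auto simp: D2)
      show "(D z)\<^sup>2 \<le> crossing n a a' z + crossing n b b' z" for z
        unfolding D2 unfolding D by (rule crossing_diff_le)
    qed
    also have "\<dots> = sdist n a a' + sdist n b b'"
      using ab N by (simp add: integrable_crossing integral_crossing subset_iff)
    also have "\<dots> \<le> 4 * scale i"
      using d by simp
    also have "\<dots> \<le> (1 / 8) ^ k"
    proof -
      have "(1 / 16 :: real) ^ i \<le> (1 / 8) ^ i" by (intro power_mono) auto
      moreover have "0 \<le> (1 / 8 :: real) ^ i" by simp
      ultimately show ?thesis
        unfolding Suc power_Suc scale_def by linarith
    qed
    finally show ?thesis
      using m D1 by blast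
  qed
  then show "D \<in> borel_measurable ?M" "\<bar>D z\<bar> \<le> 1" "(\<integral>z. (D z)\<^sup>2 \<partial>?M) \<le> (1 / 8) ^ k"
    by auto
qed

text \<open>Telescoping along two chains simultaneously. The permitted deviations form a geometric
  series, hence the invariant \<open>2 - (1 / 2) ^ k\<close>: the total stays below
  \<open>\<delta> / 4\<close> per sample for any number of levels.\<close>

lemma chaining:
  fixes \<theta> :: "nat \<Rightarrow> nat \<Rightarrow> real"
  assumes N: "\<And>k. N k \<subseteq> sphere_n n"
    and H: "\<And>k D. k \<le> K \<Longrightarrow> D \<in> links n N k \<Longrightarrow>
      \<bar>(\<Sum>j<m. D (\<theta> j)) - real m * (\<integral>z. D z \<partial>gauss_vec (Suc n))\<bar> < real m * (\<delta> / 8 * (1 / 2) ^ k)"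
    and p: "\<And>k. p k \<in> N k" "\<And>k. sdist n (p k) (p (Suc k)) \<le> 2 * scale k"
    and q: "\<And>k. q k \<in> N k" "\<And>k. sdist n (q k) (q (Suc k)) \<le> 2 * scale k"
    and k: "k \<le> K"
  shows "\<bar>(\<Sum>j<m. crossing n (p k) (q k) (\<theta> j)) - real m * sdist n (p k) (q k)\<bar>
    \<le> real m * (\<delta> / 8 * (2 - (1 / 2) ^ k))"
  using k
proof (induction k)
  case 0
  have "crossing n (p 0) (q 0) \<in> links n N 0"
    using p(1)[of 0] q(1)[of 0] by (auto intro: image_eqI[of _ _ "(p 0, q 0)"])
  from H[OF _ this] show ?case
    using integral_crossing[of "p 0" n "q 0"] N p(1)[of 0] q(1)[of 0] by (simp add: subset_iff)
next
  case (Suc k)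
  let ?D = "\<lambda>z. crossing n (p (Suc k)) (q (Suc k)) z - crossing n (p k) (q k) z"
  have S: "p i \<in> sphere_n n" "q i \<in> sphere_n n" for i
    using N[of i] p(1)[of i] q(1)[of i] by auto
  have "?D \<in> links n N (Suc k)"
    unfolding links.simps using p[of k] q[of k] p(1)[of "Suc k"] q(1)[of "Suc k"]
    by (intro image_eqI[of _ _ "((p k, q k), (p (Suc k), q (Suc k)))"]) auto
  from H[OF Suc.prems this]
  have "\<bar>(\<Sum>j<m. ?D (\<theta> j)) - real m * (sdist n (p (Suc k)) (q (Suc k)) - sdist n (p k) (q k))\<bar>
      < real m * (\<delta> / 8 * (1 / 2) ^ Suc k)"
    by (simp add: integrable_crossing integral_crossing S)
  moreover have "(\<Sum>j<m. ?D (\<theta> j)) - real m * (sdist n (p (Suc k)) (q (Suc k)) - sdist n (p k) (q k))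
    = (\<Sum>j<m. crossing n (p (Suc k)) (q (Suc k)) (\<theta> j)) - real m * sdist n (p (Suc k)) (q (Suc k))
      - ((\<Sum>j<m. crossing n (p k) (q k) (\<theta> j)) - real m * sdist n (p k) (q k))"
    by (simp add: sum_subtractf right_diff_distrib)
  moreover have "\<bar>(\<Sum>j<m. crossing n (p k) (q k) (\<theta> j)) - real m * sdist n (p k) (q k)\<bar>
    \<le> real m * (\<delta> / 8 * (2 - (1 / 2) ^ k))"
    using Suc by simp
  moreover have "real m * (\<delta> / 8 * (1 / 2) ^ Suc k) + real m * (\<delta> / 8 * (2 - (1 / 2) ^ k))
    = real m * (\<delta> / 8 * (2 - (1 / 2) ^ Suc k))"
    by (simp add: algebra_simps)
  ultimately show ?case by linarith
qed

abbreviation support :: "nat \<Rightarrow> (nat \<Rightarrow> real) \<Rightarrow> nat set" where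
  "support n x \<equiv> {i. i \<le> n \<and> x i \<noteq> 0}"

lemma sparse_sphere_iff: "x \<in> sparse_sphere n s \<longleftrightarrow> x \<in> sphere_n n \<and> card (support n x) \<le> s"
  by (simp add: sparse_sphere_def)

text \<open>Equal supports make the difference as sparse as the vectors themselves, so after
  normalization it is again in the sparse sphere. Estimates over that sphere can thus be applied to
  increments without doubling \<open>s\<close>.\<close>

lemma sparse_direction:
  assumes x: "x \<in> sparse_sphere n s" and t: "t \<in> sparse_sphere n s"
    and supp: "support n x = support n t" and d: "sqdist n x t \<noteq> 0"
  shows "\<exists>w\<in>sparse_sphere n s. \<forall>z. sinner n z x - sinner n z t = sqrt (sqdist n x t) * sinner n z w"
proof -
  define \<rho> where "\<rho> = sqrt (sqdist n x t)"
  have \<rho>: "\<rho> > 0" "\<rho>\<^sup>2 = sqdist n x t"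
    using d sqdist_nonneg[of n x t] by (auto simp: \<rho>_def)
  define w where "w i = (x i - t i) / \<rho>" for i
  have "sinner n w w = (\<Sum>i\<le>n. (x i - t i)\<^sup>2) / \<rho>\<^sup>2"
    unfolding sinner_def sum_divide_distrib by (intro sum.cong) (auto simp: w_def power2_eq_square)
  also have "\<dots> = 1"
    using \<rho> d by (simp add: sqdist_def)
  finally have "w \<in> sphere_n n"
    using x t by (simp add: sphere_n_def w_def sparse_sphere_def)
  moreover have "support n w \<subseteq> support n x"
  proof
    fix i assume i: "i \<in> support n w"
    then have "x i \<noteq> 0 \<or> t i \<noteq> 0" by (auto simp: w_def)
    then show "i \<in> support n x" using i supp by blast
  qed
  then have "card (support n w) \<le> card (support n x)"
    by (intro card_mono) auto
  ultimately have "w \<in> sparse_sphere n s"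
    using x by (simp add: sparse_sphere_iff)
  moreover have "sinner n z x - sinner n z t = \<rho> * sinner n z w" for z
  proof -
    have xw: "x i - t i = \<rho> * w i" for i
      using \<rho> by (simp add: w_def)
    show ?thesis
      unfolding sinner_def sum_subtractf[symmetric] sum_distrib_left right_diff_distrib[symmetric] xw
      by (simp add: mult.left_commute)
  qed
  ultimately show ?thesis
    unfolding \<rho>_def by blast
qed

lemma sinner_eq_of_sqdist_0:
  assumes "sqdist n x t = 0" shows "sinner n z x = sinner n z t"
proof -
  have "\<forall>i\<in>{..n}. (x i - t i)\<^sup>2 = 0"
    using assms unfolding sqdist_def by (subst (asm) sum_nonneg_eq_0_iff) auto
  then show ?thesis
    unfolding sinner_def by (intro sum.cong) auto
qed

text \<open>A bound on a net of mesh one half self-improves: if $S$ is the supremum over all sparse unit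
  vectors then $S \le 4 \sqrt m + S / 2$.\<close>

lemma sparse_operator_bound:
  fixes \<theta> :: "nat \<Rightarrow> nat \<Rightarrow> real" and r :: "nat \<Rightarrow> real"
  assumes N: "N \<subseteq> sparse_sphere n s"
    and net: "\<And>x. x \<in> sparse_sphere n s \<Longrightarrow> \<exists>t\<in>N. support n x = support n t \<and> sqdist n x t \<le> (1 / 2)\<^sup>2"
    and H: "\<And>t. t \<in> N \<Longrightarrow> (\<Sum>j<m. (r j * sinner n (\<theta> j) t)\<^sup>2) \<le> 16 * real m"
    and x: "x \<in> sparse_sphere n s"
  shows "(\<Sum>j<m. (r j * sinner n (\<theta> j) x)\<^sup>2) \<le> 64 * real m"
proof -
  define Q where "Q x = L2_set (\<lambda>j. r j * sinner n (\<theta> j) x) {..<m}" for x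
  let ?K = "sparse_sphere n s"
  have Q2: "(Q x)\<^sup>2 = (\<Sum>j<m. (r j * sinner n (\<theta> j) x)\<^sup>2)" for x
    unfolding Q_def L2_set_def by (simp add: sum_nonneg)
  \<comment> \<open>The self-improving inequality for \<open>S\<close> yields a bound only once
    \<open>S\<close> is finite; a crude estimate by the entries of \<open>\<theta>\<close> supplies
    this.\<close>
  have bdd: "bdd_above (Q ` ?K)"
  proof (rule bdd_aboveI2)
    fix x assume "x \<in> ?K"
    then have xS: "x \<in> sphere_n n" by (simp add: sparse_sphere_iff)
    have x1: "\<bar>x i\<bar> \<le> 1" if "i \<le> n" for i
    proof -
      have "(x i)\<^sup>2 \<le> (\<Sum>i\<le>n. (x i)\<^sup>2)"
        using that by (intro member_le_sum) auto
      then show ?thesis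
        using sphere_sum_squares[OF xS] by (simp add: abs_square_le_1)
    qed
    have "Q x \<le> (\<Sum>j<m. \<bar>r j * sinner n (\<theta> j) x\<bar>)"
      unfolding Q_def by (rule L2_set_le_sum_abs)
    also have "\<dots> \<le> (\<Sum>j<m. \<bar>r j\<bar> * (\<Sum>i\<le>n. \<bar>\<theta> j i\<bar>))"
      unfolding abs_mult
    proof (intro sum_mono mult_left_mono)
      fix j
      have "\<bar>sinner n (\<theta> j) x\<bar> \<le> (\<Sum>i\<le>n. \<bar>\<theta> j i * x i\<bar>)"
        unfolding sinner_def by (rule sum_abs)
      also have "\<dots> \<le> (\<Sum>i\<le>n. \<bar>\<theta> j i\<bar>)"
        using x1 by (intro sum_mono) (auto simp: abs_mult intro!: mult_left_le)
      finally show "\<bar>sinner n (\<theta> j) x\<bar> \<le> (\<Sum>i\<le>n. \<bar>\<theta> j i\<bar>)" .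
    qed auto
    finally show "Q x \<le> (\<Sum>j<m. \<bar>r j\<bar> * (\<Sum>i\<le>n. \<bar>\<theta> j i\<bar>))" .
  qed
  define S where "S = (SUP x\<in>?K. Q x)"
  have le_S: "Q x \<le> S" if "x \<in> ?K" for x
    unfolding S_def using that by (rule cSUP_upper[OF _ bdd])
  have S0: "0 \<le> S"
    using le_S[OF x] L2_set_nonneg[of "\<lambda>j. r j * sinner n (\<theta> j) x" "{..<m}"] unfolding Q_def by linarith
  have "S \<le> 4 * sqrt m + S / 2"
    unfolding S_def
  proof (rule cSUP_least)
    show "?K \<noteq> {}" using x by blast
    fix x assume x: "x \<in> ?K"
    obtain t where t: "t \<in> N" "support n x = support n t" "sqdist n x t \<le> (1 / 2)\<^sup>2"
      using net[OF x] by blast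
    have tK: "t \<in> ?K" using t N by blast
    have Qt: "Q t \<le> 4 * sqrt m"
    proof (rule power2_le_imp_le)
      show "(Q t)\<^sup>2 \<le> (4 * sqrt (real m))\<^sup>2"
        using H[OF t(1)] by (simp add: Q2 power_mult_distrib)
    qed simp
    have "Q x \<le> 4 * sqrt m + S / 2"
    proof (cases "sqdist n x t = 0")
      case True
      then have "Q x = Q t"
        unfolding Q_def by (simp add: sinner_eq_of_sqdist_0[OF True])
      then show ?thesis using Qt S0 by simp
    next
      case False
      obtain w where w: "w \<in> ?K" "\<And>z. sinner n z x - sinner n z t = sqrt (sqdist n x t) * sinner n z w"
        using sparse_direction[OF x tK t(2) False] by blast
      have r: "sqrt (sqdist n x t) \<le> 1 / 2"
        using t(3) by (intro real_le_lsqrt) auto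
      have "Q x = L2_set (\<lambda>j. r j * sinner n (\<theta> j) t + sqrt (sqdist n x t) * (r j * sinner n (\<theta> j) w)) {..<m}"
      proof -
        have "r j * sinner n (\<theta> j) x = r j * sinner n (\<theta> j) t + sqrt (sqdist n x t) * (r j * sinner n (\<theta> j) w)" for j
          using w(2)[of "\<theta> j"] by algebra
        then show ?thesis unfolding Q_def by simp
      qed
      also have "\<dots> \<le> Q t + L2_set (\<lambda>j. sqrt (sqdist n x t) * (r j * sinner n (\<theta> j) w)) {..<m}"
        unfolding Q_def by (rule L2_set_triangle_ineq)
      also have "\<dots> = Q t + sqrt (sqdist n x t) * Q w"
        unfolding Q_def by (subst L2_set_right_distrib) (auto simp: sqdist_nonneg)
      also have "\<dots> \<le> 4 * sqrt m + 1 / 2 * S"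
        using Qt r le_S[OF w(1)] by (intro add_mono mult_mono) (auto simp: Q_def)
      finally show ?thesis by simp
    qed
    then show "Q x \<le> 4 * sqrt m + (SUP x\<in>?K. Q x) / 2"
      unfolding S_def .
  qed
  then have "Q x \<le> 8 * sqrt m"
    using le_S[OF x] by linarith
  then have "(Q x)\<^sup>2 \<le> (8 * sqrt m)\<^sup>2"
    by (intro power_mono) (auto simp: Q_def)
  then show ?thesis
    by (simp add: Q2 power_mult_distrib)
qed

lemma sgn1_mult_pos: "0 < r \<Longrightarrow> sgn1 (r * a) = sgn1 a"
  by (simp add: sgn1_def zero_le_mult_iff)

text \<open>A deterministic Chebyshev argument: outside the slab a sign flip needs an increment of
  at least \<open>\<tau>\<close>, so the number of such rows is at most the sum of squared
  increments over \<open>\<tau>^2\<close>. Positive factors \<open>r j\<close> leave the signs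
  alone.\<close>

lemma sum_crossing_close:
  fixes \<theta> :: "nat \<Rightarrow> nat \<Rightarrow> real" and r :: "nat \<Rightarrow> real"
  assumes op: "\<And>x. x \<in> sparse_sphere n s \<Longrightarrow> (\<Sum>j<m. (r j * sinner n (\<theta> j) x)\<^sup>2) \<le> 64 * real m"
    and r: "\<And>j. j < m \<Longrightarrow> 0 < r j" and \<tau>: "\<tau> > 0"
    and x: "x \<in> sparse_sphere n s" and t: "t \<in> sparse_sphere n s" and supp: "support n x = support n t"
    and slab: "(\<Sum>j<m. of_bool (\<bar>r j * sinner n (\<theta> j) t\<bar> \<le> \<tau>)) \<le> b"
  shows "(\<Sum>j<m. crossing n x t (\<theta> j)) \<le> b + 64 * real m * sqdist n x t / \<tau>\<^sup>2"
proof -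
  let ?a = "\<lambda>j. r j * sinner n (\<theta> j) x" and ?b = "\<lambda>j. r j * sinner n (\<theta> j) t"
  have "crossing n x t (\<theta> j) \<le> of_bool (\<bar>?b j\<bar> \<le> \<tau>) + (?a j - ?b j)\<^sup>2 / \<tau>\<^sup>2" if j: "j < m" for j
  proof (cases "crosses n x t (\<theta> j) \<and> \<not> \<bar>?b j\<bar> \<le> \<tau>")
    case True
    then have "sgn1 (?a j) \<noteq> sgn1 (?b j)"
      using sgn1_mult_pos[OF r[OF j]] by (simp add: crosses_def)
    then have "\<bar>?b j\<bar> \<le> \<bar>?a j - ?b j\<bar>"
      by (auto simp: sgn1_def abs_if split: if_splits)
    then have "\<tau> \<le> \<bar>?a j - ?b j\<bar>" using True by linarith
    then have "\<tau>\<^sup>2 \<le> (?a j - ?b j)\<^sup>2"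
      using \<tau> by (metis abs_le_square_iff abs_of_pos)
    then have "1 \<le> (?a j - ?b j)\<^sup>2 / \<tau>\<^sup>2"
      using \<tau> by simp
    then show ?thesis
      by (simp add: crossing_def)
  next
    case False
    have "0 \<le> (?a j - ?b j)\<^sup>2 / \<tau>\<^sup>2" by simp
    then show ?thesis using False by (auto simp: crossing_def)
  qed
  then have "(\<Sum>j<m. crossing n x t (\<theta> j)) \<le> (\<Sum>j<m. of_bool (\<bar>?b j\<bar> \<le> \<tau>) + (?a j - ?b j)\<^sup>2 / \<tau>\<^sup>2)"
    by (intro sum_mono) auto
  also have "\<dots> \<le> b + (\<Sum>j<m. (?a j - ?b j)\<^sup>2) / \<tau>\<^sup>2"
    using slab by (simp add: sum.distrib sum_divide_distrib)
  also have "(\<Sum>j<m. (?a j - ?b j)\<^sup>2) \<le> 64 * real m * sqdist n x t"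
  proof (cases "sqdist n x t = 0")
    case True
    then show ?thesis by (simp add: sinner_eq_of_sqdist_0[OF True])
  next
    case False
    obtain w where w: "w \<in> sparse_sphere n s" "\<And>z. sinner n z x - sinner n z t = sqrt (sqdist n x t) * sinner n z w"
      using sparse_direction[OF x t supp False] by blast
    have "(?a j - ?b j)\<^sup>2 = sqdist n x t * (r j * sinner n (\<theta> j) w)\<^sup>2" for j
    proof -
      have "?a j - ?b j = sqrt (sqdist n x t) * (r j * sinner n (\<theta> j) w)"
        using w(2)[of "\<theta> j"] by (simp add: right_diff_distrib[symmetric])
      then show ?thesis
        by (simp add: power_mult_distrib sqdist_nonneg)
    qed
    then have "(\<Sum>j<m. (?a j - ?b j)\<^sup>2) = sqdist n x t * (\<Sum>j<m. (r j * sinner n (\<theta> j) w)\<^sup>2)"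
      by (simp add: sum_distrib_left)
    also have "\<dots> \<le> sqdist n x t * (64 * real m)"
      using op[OF w(1)] sqdist_nonneg by (intro mult_left_mono)
    finally show ?thesis by (simp add: mult_ac)
  qed
  finally show ?thesis
    using \<tau> by (simp add: divide_right_mono)
qed

text \<open>Error budget: sign flips cost \<open>\<delta> / 16\<close> at each of the two points,
  the chain between their net points costs \<open>\<delta> / 4\<close>, and the change of distance
  costs at most \<open>\<delta> / 8\<close>. The total \<open>\<delta> / 2\<close> leaves room for
  the strict inequality.\<close>

lemma sparse_RIP_deterministic:
  fixes \<theta> :: "nat \<Rightarrow> nat \<Rightarrow> real" and r :: "nat \<Rightarrow> real"
  assumes \<delta>: "0 < \<delta>" "\<delta> < 1" and m: "m > 0" and K: "1 / \<delta> \<le> 4 ^ K"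
    and N: "\<And>k. N k \<subseteq> sparse_sphere n s"
    and net: "\<And>k x. x \<in> sparse_sphere n s \<Longrightarrow> \<exists>t\<in>N k. support n x = support n t \<and> sqdist n x t \<le> (scale k)\<^sup>2"
    and N': "N' \<subseteq> sparse_sphere n s"
    and net': "\<And>x. x \<in> sparse_sphere n s \<Longrightarrow> \<exists>t\<in>N'. support n x = support n t \<and> sqdist n x t \<le> (1 / 2)\<^sup>2"
    and H1: "\<And>k D. k \<le> K \<Longrightarrow> D \<in> links n N k \<Longrightarrow>
      \<bar>(\<Sum>j<m. D (\<theta> j)) - real m * (\<integral>z. D z \<partial>gauss_vec (Suc n))\<bar> < real m * (\<delta> / 8 * (1 / 2) ^ k)"
    and r: "\<And>j. j < m \<Longrightarrow> 0 < r j"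
    and H2: "\<And>t. t \<in> N K \<Longrightarrow> (\<Sum>j<m. of_bool (\<bar>r j * sinner n (\<theta> j) t\<bar> \<le> \<delta> / 128)) \<le> real m * (3 * \<delta> / 64)"
    and H3: "\<And>t. t \<in> N' \<Longrightarrow> (\<Sum>j<m. (r j * sinner n (\<theta> j) t)\<^sup>2) \<le> 16 * real m"
  shows "is_RIP n m (sparse_sphere n s) (\<lambda>x j. sgn1 (sinner n (\<theta> j) x)) \<delta>"
proof -
  let ?K = "sparse_sphere n s"
  have mp: "real m > 0" using m by simp
  have KS: "?K \<subseteq> sphere_n n" by (auto simp: sparse_sphere_iff)
  have NS: "N k \<subseteq> sphere_n n" for k using N KS by blast
  have sc0: "0 \<le> scale k" for k by (simp add: scale_def)
  \<comment> \<open>Four to the power \<open>K\<close> reaches \<open>1 / \<delta>\<close>, so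
    \<open>16 ^ -K \<le> \<delta>^2\<close>. The divisor \<open>16384 = 128^2\<close> in
    \<open>scale\<close> makes the last mesh at most the square of the slab threshold
    \<open>\<delta> / 128\<close>.\<close>
  have scK: "scale K \<le> \<delta>\<^sup>2 / 16384"
  proof -
    have "(1 / 4) ^ K \<le> \<delta>"
      using K \<delta> by (simp add: power_one_over field_simps)
    then have "((1 / 4) ^ K)\<^sup>2 \<le> \<delta>\<^sup>2"
      by (intro power_mono) auto
    also have "((1 / 4 :: real) ^ K)\<^sup>2 = ((1 / 4)\<^sup>2) ^ K"
      by (simp only: power_mult[symmetric] mult.commute)
    finally show ?thesis
      by (simp add: scale_def power2_eq_square)
  qed
  define \<pi> where "\<pi> x k = (SOME t. t \<in> N k \<and> support n x = support n t \<and> sqdist n x t \<le> (scale k)\<^sup>2)" for x k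
  have \<pi>: "\<pi> x k \<in> N k" "support n x = support n (\<pi> x k)" "sqdist n x (\<pi> x k) \<le> (scale k)\<^sup>2"
    if "x \<in> ?K" for x k
    using someI_ex[of "\<lambda>t. t \<in> N k \<and> support n x = support n t \<and> sqdist n x t \<le> (scale k)\<^sup>2"] net[OF that, of k]
    unfolding \<pi>_def by blast+
  have d\<pi>: "sdist n x (\<pi> x k) \<le> scale k" if "x \<in> ?K" for x k
  proof -
    have "sdist n x (\<pi> x k) \<le> sqrt (sqdist n x (\<pi> x k))"
      using \<pi>(1)[OF that, of k] NS KS that by (intro sdist_le_sqrt_sqdist) auto
    also have "\<dots> \<le> scale k"
      using \<pi>(3)[OF that, of k] sc0 by (intro real_le_lsqrt) auto
    finally show ?thesis .
  qed
  have link: "sdist n (\<pi> x k) (\<pi> x (Suc k)) \<le> 2 * scale k" if x: "x \<in> ?K" for x k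
  proof -
    have "sdist n (\<pi> x k) (\<pi> x (Suc k)) \<le> sdist n (\<pi> x k) x + sdist n x (\<pi> x (Suc k))"
      using \<pi>(1)[OF x] NS KS x by (intro sdist_triangle) auto
    also have "\<dots> \<le> scale k + scale (Suc k)"
      using d\<pi>[OF x, of k] d\<pi>[OF x, of "Suc k"] by (simp add: sdist_sym)
    also have "\<dots> \<le> 2 * scale k"
      by (simp add: scale_def)
    finally show ?thesis .
  qed
  have op: "(\<Sum>j<m. (r j * sinner n (\<theta> j) x)\<^sup>2) \<le> 64 * real m" if "x \<in> ?K" for x
    by (rule sparse_operator_bound[OF N' net' H3 that])
  \<comment> \<open>Rows nearly orthogonal to the net point contribute
    \<open>3 * \<delta> / 64\<close>, large increments at most \<open>\<delta> / 256\<close>;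
    together \<open>13/256\<close>, below \<open>16/256\<close>.\<close>
  have flips: "(\<Sum>j<m. crossing n x (\<pi> x K) (\<theta> j)) \<le> real m * (\<delta> / 16)" if x: "x \<in> ?K" for x
  proof -
    have "(\<Sum>j<m. crossing n x (\<pi> x K) (\<theta> j))
        \<le> real m * (3 * \<delta> / 64) + 64 * real m * sqdist n x (\<pi> x K) / (\<delta> / 128)\<^sup>2"
      using \<delta> \<pi>(1)[OF x, of K] N by (intro sum_crossing_close[OF op r _ x _ \<pi>(2)[OF x] H2]) auto
    also have "64 * real m * sqdist n x (\<pi> x K) / (\<delta> / 128)\<^sup>2 \<le> 64 * real m * (\<delta>\<^sup>2 / 16384)\<^sup>2 / (\<delta> / 128)\<^sup>2"
    proof (intro divide_right_mono mult_left_mono)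
      show "sqdist n x (\<pi> x K) \<le> (\<delta>\<^sup>2 / 16384)\<^sup>2"
        using \<pi>(3)[OF x, of K] power_mono[OF scK sc0, of 2] by linarith
    qed auto
    also have "64 * real m * (\<delta>\<^sup>2 / 16384)\<^sup>2 / (\<delta> / 128)\<^sup>2 = real m * (\<delta> * \<delta>) / 256"
      using \<delta> by (simp add: power2_eq_square field_simps)
    also have "\<dots> \<le> real m * (\<delta> * 1) / 256"
      using \<delta> by (intro divide_right_mono mult_left_mono) auto
    finally have "(\<Sum>j<m. crossing n x (\<pi> x K) (\<theta> j)) \<le> (real m * \<delta>) * (13 / 256)"
      by (simp add: algebra_simps)
    also have "\<dots> \<le> (real m * \<delta>) * (1 / 16)"
      using \<delta> by (intro mult_left_mono) auto
    finally show ?thesis by simp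
  qed
  show ?thesis
    unfolding is_RIP_def
  proof (intro conjI ballI)
    show "(\<lambda>j. sgn1 (sinner n (\<theta> j) x)) \<in> cube m" for x
      by (simp add: cube_def sgn1_def)
    fix x y assume x: "x \<in> ?K" and y: "y \<in> ?K"
    let ?x = "\<pi> x K" and ?y = "\<pi> y K"
    let ?E = "\<lambda>a b. \<Sum>j<m. crossing n a b (\<theta> j)"
    have ham: "real m * hamming m (\<lambda>j. sgn1 (sinner n (\<theta> j) x)) (\<lambda>j. sgn1 (sinner n (\<theta> j) y)) = ?E x y"
      using mp by (simp add: hamming_def crossing_def crosses_def sum_of_bool_eq Int_def)
    have "\<bar>?E ?x ?y - ?E x y\<bar> \<le> (\<Sum>j<m. \<bar>crossing n ?x ?y (\<theta> j) - crossing n x y (\<theta> j)\<bar>)"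
      unfolding sum_subtractf[symmetric] by (rule sum_abs)
    also have "\<dots> \<le> ?E x ?x + ?E y ?y"
      unfolding sum.distrib[symmetric] by (intro sum_mono crossing_diff_le)
    also have "\<dots> \<le> real m * (\<delta> / 16) + real m * (\<delta> / 16)"
      by (intro add_mono flips x y)
    finally have 1: "\<bar>?E ?x ?y - ?E x y\<bar> \<le> real m * (\<delta> / 8)" by (simp add: mult.commute)
    have "\<bar>?E ?x ?y - real m * sdist n ?x ?y\<bar> \<le> real m * (\<delta> / 8 * (2 - (1 / 2) ^ K))"
      by (rule chaining[OF NS H1 \<pi>(1)[OF x] link[OF x] \<pi>(1)[OF y] link[OF y] order_refl])
    also have "\<dots> \<le> real m * (\<delta> / 8 * 2)"
      using \<delta> by (intro mult_left_mono) auto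
    finally have 2: "\<bar>?E ?x ?y - real m * sdist n ?x ?y\<bar> \<le> real m * (\<delta> / 4)" by (simp add: mult.commute)
    have "\<bar>sdist n x y - sdist n ?x ?y\<bar> \<le> sdist n x ?x + sdist n y ?y"
      using x y \<pi>(1)[OF x, of K] \<pi>(1)[OF y, of K] KS NS by (intro sdist_diff_le) auto
    also have "\<dots> \<le> \<delta>\<^sup>2 / 16384 + \<delta>\<^sup>2 / 16384"
      using d\<pi>[OF x, of K] d\<pi>[OF y, of K] scK by linarith
    also have "\<dots> \<le> \<delta> / 8"
    proof -
      have "\<delta>\<^sup>2 \<le> \<delta> * 1"
        unfolding power2_eq_square using \<delta> by (intro mult_left_mono) auto
      then show ?thesis using \<delta> by simp
    qed
    finally have "real m * \<bar>sdist n x y - sdist n ?x ?y\<bar> \<le> real m * (\<delta> / 8)"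
      by (rule mult_left_mono) simp
    then have 3: "\<bar>real m * sdist n x y - real m * sdist n ?x ?y\<bar> \<le> real m * (\<delta> / 8)"
      by (simp add: right_diff_distrib[symmetric] abs_mult)
    let ?h = "hamming m (\<lambda>j. sgn1 (sinner n (\<theta> j) x)) (\<lambda>j. sgn1 (sinner n (\<theta> j) y))"
    have "0 < real m * \<delta>" using mp \<delta> by simp
    then have "\<bar>real m * sdist n x y - real m * ?h\<bar> < real m * \<delta>"
      using 1 2 3 unfolding ham by linarith
    then have "real m * \<bar>sdist n x y - ?h\<bar> < real m * \<delta>"
      by (simp add: right_diff_distrib[symmetric] abs_mult)
    then show "\<bar>sdist n x y - ?h\<bar> < \<delta>"
      using mp by (simp only: mult_less_cancel_left_pos)
  qed
qed

subsection \<open>Sparse vectors: probability of the good event\<close>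

text \<open>Based on \<open>a \<le> exp (a - 1)\<close>. It trades surplus in the exponent for a
  small prefactor, so that several failure probabilities fit under a single
  \<open>exp (- E)\<close>.\<close>

lemma exp_neg_mult_le:
  fixes E a :: real
  assumes "1 \<le> E" "1 \<le> a"
  shows "exp (- (a * E)) \<le> exp (- E) / a"
proof -
  have "a \<le> exp (a - 1)"
    using exp_ge_add_one_self[of "a - 1"] by simp
  also have "\<dots> \<le> exp ((a - 1) * E)"
    using assms mult_left_mono[of 1 E "a - 1"] by simp
  finally have "exp (- E) * (1 / exp ((a - 1) * E)) \<le> exp (- E) * (1 / a)"
    using assms by (intro mult_left_mono divide_left_mono) auto
  moreover have "exp (- (a * E)) = exp (- E) * (1 / exp ((a - 1) * E))"
    by (simp add: exp_minus exp_add[symmetric] field_simps)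
  ultimately show ?thesis by simp
qed

text \<open>Since \<open>1 / scale k\<close> is \<open>2 ^ (14 + 4 * k)\<close>, the entropy of the
  nets grows only linearly in the level; together with the 6 of \<open>sparse_net\<close> this gives
  the recurring \<open>16 + 3 * k\<close>.\<close>

lemma ln_inverse_scale_le: "ln (1 / scale k) \<le> 10 + 3 * real k"
proof -
  have "1 / scale k = 2 ^ (14 + 4 * k)"
    by (simp add: scale_def power_add power_mult power_one_over)
  then have "ln (1 / scale k) = real (14 + 4 * k) * ln 2"
    by (simp only: ln_realpow)
  also have "\<dots> \<le> real (14 + 4 * k) * (25 / 36)"
    using ln2_le_25_over_36 by (intro mult_left_mono) auto
  also have "\<dots> \<le> 10 + 3 * real k" by simp
  finally show ?thesis .
qed

definition sparse_entropy :: "nat \<Rightarrow> nat \<Rightarrow> real" where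
  "sparse_entropy n s = real s * log_plus (real n / real s)"

text \<open>The scales $r_j$ enter only where the size of a linear form matters; the indicators in
  the links depend on signs alone.\<close>

definition row_good :: "nat \<Rightarrow> nat \<Rightarrow> real \<Rightarrow> nat \<Rightarrow> (nat \<Rightarrow> (nat \<Rightarrow> real) set) \<Rightarrow> (nat \<Rightarrow> real) set \<Rightarrow>
    real \<Rightarrow> (nat \<Rightarrow> real) \<Rightarrow> (nat \<Rightarrow> nat \<Rightarrow> real) \<Rightarrow> bool" where
  "row_good n m \<delta> K N N' \<tau> r \<theta> \<longleftrightarrow>
    (\<forall>k\<in>{..K}. \<forall>D\<in>links n N k.
      \<bar>(\<Sum>j<m. D (\<theta> j)) - real m * (\<integral>z. D z \<partial>gauss_vec (Suc n))\<bar> < real m * (\<delta> / 8 * (1 / 2) ^ k)) \<and>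
    (\<forall>t\<in>N K. (\<Sum>j<m. of_bool (\<bar>r j * sinner n (\<theta> j) t\<bar> \<le> \<tau>)) \<le> real m * (3 * \<delta> / 64)) \<and>
    (\<forall>t\<in>N'. (\<Sum>j<m. (r j * sinner n (\<theta> j) t)\<^sup>2) \<le> 16 * real m)"

context
  fixes n s m :: nat and \<delta> :: real
  assumes s: "1 \<le> s" "s \<le> n + 1" and \<delta>: "0 < \<delta>" "\<delta> < 1"
    and m: "real m \<ge> 2 ^ 15 * \<delta> powr (-2) * real s * log_plus (real n / real s)"
begin

abbreviation (input) "M \<equiv> gauss_vec (Suc n)"
abbreviation (input) "P \<equiv> PiM {..<m} (\<lambda>_. gauss_vec (Suc n))"

abbreviation (input) "entropy \<equiv> sparse_entropy n s"

lemma entropy_ge_1: "1 \<le> entropy"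
proof -
  have "1 * 1 \<le> real s * log_plus (real n / real s)"
    using s log_plus_ge(1) by (intro mult_mono) auto
  then show ?thesis by (simp add: sparse_entropy_def)
qed

lemma m_ge: "2 ^ 15 * entropy / \<delta>\<^sup>2 \<le> real m" "2 ^ 15 * entropy / \<delta> \<le> real m" "2 ^ 15 * entropy \<le> real m"
proof -
  have "\<delta> powr (-2) = 1 / \<delta>\<^sup>2"
    using \<delta> by (simp add: powr_minus powr_numeral divide_inverse)
  then show 1: "2 ^ 15 * entropy / \<delta>\<^sup>2 \<le> real m"
    using m by (simp add: sparse_entropy_def mult_ac)
  have "\<delta>\<^sup>2 \<le> \<delta>"
    using \<delta> by (simp add: power2_eq_square mult_left_le)
  then have "2 ^ 15 * entropy / \<delta> \<le> 2 ^ 15 * entropy / \<delta>\<^sup>2"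
    using \<delta> entropy_ge_1 by (intro divide_left_mono) auto
  then show 2: "2 ^ 15 * entropy / \<delta> \<le> real m" using 1 by linarith
  have "2 ^ 15 * entropy / 1 \<le> 2 ^ 15 * entropy / \<delta>"
    using \<delta> entropy_ge_1 by (intro divide_left_mono) auto
  then show "2 ^ 15 * entropy \<le> real m" using 2 by simp
qed

lemma prob_space_samples: "prob_space P"
  by (intro prob_space_PiM prob_space_gauss_vec)

lemma measurable_sample_coordinate:
  assumes "f \<in> borel_measurable M" "j \<in> {..<m}"
  shows "(\<lambda>\<omega>. f (\<omega> j)) \<in> borel_measurable P"
  using assms by (intro measurable_compose[OF measurable_component_singleton])

text \<open>With the threshold and the second moment of level \<open>k\<close>, the exponent is
  \<open>m * \<delta>^2 * 2 ^ k / 256\<close>, while the number of links costs only a multiple of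
  \<open>entropy * (k + 1)\<close>. The hypothesis on \<open>4 ^ k\<close> is the constraint that
  the exponential parameter be at most 1.\<close>

lemma links_failure:
  assumes N: "\<And>k. finite (N k)" "\<And>k. N k \<subseteq> sphere_n n"
    and card: "\<And>k. real (card (N k)) \<le> exp (entropy * (16 + 3 * real k))"
    and k: "4 ^ k \<le> 16 / \<delta>"
  shows "{\<omega> \<in> space P. \<exists>D\<in>links n N k. real m * (\<delta> / 8 * (1 / 2) ^ k) \<le> \<bar>(\<Sum>j<m. D (\<omega> j)) - real m * (\<integral>z. D z \<partial>M)\<bar>} \<in> sets P"
    (is "?A \<in> _")
    "measure P {\<omega> \<in> space P. \<exists>D\<in>links n N k. real m * (\<delta> / 8 * (1 / 2) ^ k) \<le> \<bar>(\<Sum>j<m. D (\<omega> j)) - real m * (\<integral>z. D z \<partial>M)\<bar>}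
      \<le> exp (- entropy) * (1 / 2) ^ (k + 3)"
proof -
  \<comment> \<open>The maximizer \<open>t / (2 * v)\<close> of \<open>l * t - l^2 * v\<close> for
    \<open>t = \<delta> / 8 * (1 / 2) ^ k\<close> and \<open>v = (1 / 8) ^ k\<close>.\<close>
  let ?l = "\<delta> * 4 ^ k / 16"
  have l: "0 < ?l" "?l \<le> 1"
    using \<delta> k by (auto simp: field_simps)
  have lm: "D \<in> borel_measurable M" if "D \<in> links n N k" for D
    by (rule links_properties(1)[where N = N, OF _ that]) (rule N(2))
  have l1: "\<bar>D z\<bar> \<le> 1" if "D \<in> links n N k" for D z
    by (rule links_properties(2)[where N = N, OF _ that]) (rule N(2))
  have lv: "(\<integral>z. (D z)\<^sup>2 \<partial>M) \<le> (1 / 8) ^ k" if "D \<in> links n N k" for D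
    by (rule links_properties(3)[where N = N, OF _ that]) (rule N(2))
  have fin: "finite (links n N k)"
    using N(1) by (rule finite_links)
  show "?A \<in> sets P"
    by (rule iid_family_bernstein(1)[where M = M and F = "links n N k" and v = "(1 / 8) ^ k" and l = "?l"],
      rule prob_space_gauss_vec, rule fin, erule lm, erule l1, erule lv, rule l, rule l)
  have "measure P ?A \<le> 2 * real (card (links n N k)) *
      exp (- real m * (?l * (\<delta> / 8 * (1 / 2) ^ k) - ?l\<^sup>2 * (1 / 8) ^ k))"
    by (rule iid_family_bernstein(2)[where M = M and F = "links n N k" and v = "(1 / 8) ^ k" and l = "?l"],
      rule prob_space_gauss_vec, rule fin, erule lm, erule l1, erule lv, rule l, rule l)
  also have "?l * (\<delta> / 8 * (1 / 2) ^ k) - ?l\<^sup>2 * (1 / 8) ^ k = \<delta>\<^sup>2 * 2 ^ k / 256"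
  proof -
    have "(4::real) ^ k * (1 / 2) ^ k = 2 ^ k"
      unfolding power_mult_distrib[symmetric] by simp
    moreover have "((4::real) ^ k)\<^sup>2 * (1 / 8) ^ k = 2 ^ k"
      unfolding power_mult[symmetric] mult.commute[of k 2] unfolding power_mult power_mult_distrib[symmetric] by simp
    moreover have "?l * (\<delta> / 8 * (1 / 2) ^ k) = \<delta>\<^sup>2 * (4 ^ k * (1 / 2) ^ k) / 128"
      by (simp add: power2_eq_square)
    moreover have "?l\<^sup>2 * (1 / 8) ^ k = \<delta>\<^sup>2 * ((4 ^ k)\<^sup>2 * (1 / 8) ^ k) / 256"
      by (simp add: power_mult_distrib power_divide)
    ultimately show ?thesis by simp
  qed
  \<comment> \<open>From \<open>m * \<delta>^2 \<ge> 2 ^ 15 * entropy\<close> the exponent is at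
    least \<open>128 * entropy * 2 ^ k\<close>, twice the cost \<open>64 * entropy * (k + 1)\<close>
    of the links even after \<open>2 ^ k\<close> is lowered to \<open>k + 1\<close>.\<close>
  also have "2 * real (card (links n N k)) * exp (- real m * (\<delta>\<^sup>2 * 2 ^ k / 256))
      \<le> 2 * exp (4 * (entropy * (16 + 3 * real k))) * exp (- (128 * entropy * real (k + 1)))"
  proof (intro mult_mono mult_left_mono)
    show "real (card (links n N k)) \<le> exp (4 * (entropy * (16 + 3 * real k)))"
      using entropy_ge_1 by (intro card_links N card) (auto simp: mono_def mult_left_mono)
    have "128 * entropy * real (k + 1) \<le> 128 * entropy * 2 ^ k"
    proof (intro mult_left_mono)
      show "real (k + 1) \<le> 2 ^ k"
        using Suc_leI[OF less_exp[of k]] by (metis Suc_eq_plus1 numeral_power_eq_of_nat_cancel_iff of_nat_le_iff of_nat_numeral of_nat_power)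
    qed (use entropy_ge_1 in auto)
    also have "\<dots> = (2 ^ 15 * entropy / \<delta>\<^sup>2) * (\<delta>\<^sup>2 * 2 ^ k / 256)"
      using \<delta> by simp
    also have "\<dots> \<le> real m * (\<delta>\<^sup>2 * 2 ^ k / 256)"
      by (intro mult_right_mono m_ge) auto
    finally show "exp (- real m * (\<delta>\<^sup>2 * 2 ^ k / 256)) \<le> exp (- (128 * entropy * real (k + 1)))"
      by simp
  qed auto
  also have "\<dots> \<le> 2 * exp (- (64 * real (k + 1) * entropy))"
  proof -
    have "4 * (entropy * (16 + 3 * real k)) \<le> 64 * entropy * real (k + 1)"
      using entropy_ge_1 by (simp add: algebra_simps)
    then show ?thesis
      by (simp add: exp_add[symmetric] algebra_simps)
  qed
  also have "\<dots> \<le> exp (- entropy) * (1 / 2) ^ (k + 3)"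
  proof -
    \<comment> \<open>One copy of the entropy is kept for the final probability; the rest becomes
      geometric decay in \<open>k\<close>, so that the levels can be summed.\<close>
    have "64 * real (k + 1) * entropy \<ge> entropy + 63 * real (k + 1)"
      using entropy_ge_1 mult_left_mono[OF entropy_ge_1, of "64 * real k + 63"] by (simp add: algebra_simps)
    then have "exp (- (64 * real (k + 1) * entropy)) \<le> exp (- entropy + real (k + 1) * (-63))"
      by simp
    also have "\<dots> = exp (- entropy) * exp (-63) ^ (k + 1)"
      unfolding exp_add exp_of_nat_mult ..
    also have "\<dots> \<le> exp (- entropy) * (1 / 16) ^ (k + 1)"
    proof (intro mult_left_mono power_mono)
      show "exp (-63 :: real) \<le> 1 / 16"
      proof -
        have "exp (-63 :: real) \<le> exp (-1) / 63"
          using exp_neg_mult_le[of 1 63] by simp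
        also have "\<dots> \<le> 1 / 63" by (intro divide_right_mono) auto
        finally show ?thesis by simp
      qed
    qed auto
    also have "\<dots> \<le> exp (- entropy) * ((1 / 2) ^ (k + 3) / 2)"
    proof (intro mult_left_mono)
      have "(1 / 16 :: real) ^ k \<le> (1 / 2) ^ k" by (intro power_mono) auto
      then show "(1 / 16 :: real) ^ (k + 1) \<le> (1 / 2) ^ (k + 3) / 2"
        by (simp add: power_add power3_eq_cube)
    qed auto
    finally show ?thesis by simp
  qed
  finally show "measure P ?A \<le> exp (- entropy) * (1 / 2) ^ (k + 3)" .
qed

text \<open>Bernstein with \<open>l = 1\<close>: the mean is at most \<open>\<delta> / 64\<close>
  and the indicator has second moment equal to its mean, so a deviation of
  \<open>\<delta> / 32\<close> has exponent
  \<open>m * \<delta> / 64 \<ge> 512 * entropy / \<delta>\<close>. This is linear in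
  \<open>\<delta>\<close>, which tolerates a net as large as
  \<open>exp (28 * entropy / \<delta>)\<close>.\<close>

lemma slab_failure:
  assumes N: "finite N" "N \<subseteq> sphere_n n" and card: "real (card N) \<le> exp (28 * entropy / \<delta>)"
  shows "\<exists>A\<in>sets P. measure P A \<le> exp (- entropy) / 4 \<and>
    (\<forall>\<omega>\<in>space P - A. \<forall>t\<in>N. (\<Sum>j<m. of_bool (\<bar>sinner n (\<omega> j) t\<bar> \<le> \<delta> / 64)) \<le> real m * (3 * \<delta> / 64))"
proof -
  define D where "D t z = (of_bool (\<bar>sinner n z t\<bar> \<le> \<delta> / 64) :: real)" for t z
  have Dm: "D t \<in> borel_measurable M" for t
    unfolding D_def[abs_def] using measurable_sinner[of n t] by measurable
  have Dint: "(\<integral>z. D t z \<partial>M) \<le> \<delta> / 64" if t: "t \<in> N" for t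
  proof -
    let ?S = "{z \<in> space M. \<bar>sinner n z t\<bar> \<le> \<delta> / 64}"
    have S: "?S \<in> sets M"
      using measurable_sinner[of n t] by measurable
    have "(\<integral>z. D t z \<partial>M) = (\<integral>z. indicator ?S z \<partial>M)"
      by (intro Bochner_Integration.integral_cong) (auto simp: D_def indicator_def)
    also have "\<dots> = measure M ?S" using S by simp
    also have "\<dots> \<le> \<delta> / 64"
      using t N \<delta> by (intro prob_slab_le) auto
    finally show ?thesis .
  qed
  have D2: "(\<integral>z. (d z)\<^sup>2 \<partial>M) \<le> \<delta> / 64" if d: "d \<in> D ` N" for d
  proof -
    obtain t where t: "t \<in> N" "d = D t" using d by blast
    have "(\<lambda>z. (d z)\<^sup>2) = D t" by (auto simp: t(2) D_def)
    then show ?thesis using Dint[OF t(1)] by simp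
  qed
  have D1: "\<bar>d x\<bar> \<le> 1" if "d \<in> D ` N" for d x
    using that by (auto simp: D_def)
  have Dm': "d \<in> borel_measurable M" if "d \<in> D ` N" for d
    using that Dm by auto
  let ?A = "{\<omega> \<in> space P. \<exists>d\<in>D ` N. real m * (\<delta> / 32) \<le> \<bar>(\<Sum>j<m. d (\<omega> j)) - real m * (\<integral>z. d z \<partial>M)\<bar>}"
  have A: "?A \<in> sets P"
    by (rule iid_family_bernstein(1)[where M = M and F = "D ` N" and v = "\<delta> / 64" and l = 1],
      rule prob_space_gauss_vec, rule finite_imageI[OF N(1)], erule Dm', erule D1, erule D2, simp_all)
  have "measure P ?A \<le> 2 * real (card (D ` N)) * exp (- real m * (1 * (\<delta> / 32) - 1\<^sup>2 * (\<delta> / 64)))"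
    by (rule iid_family_bernstein(2)[where M = M and F = "D ` N" and v = "\<delta> / 64" and l = 1],
      rule prob_space_gauss_vec, rule finite_imageI[OF N(1)], erule Dm', erule D1, erule D2, simp_all)
  also have "\<dots> \<le> 2 * exp (28 * entropy / \<delta>) * exp (- (512 * entropy / \<delta>))"
  proof (intro mult_mono mult_left_mono)
    show "real (card (D ` N)) \<le> exp (28 * entropy / \<delta>)"
      using card_image_le[OF N(1), of D] card by linarith
    have "512 * entropy / \<delta> = (2 ^ 15 * entropy / \<delta>\<^sup>2) * (\<delta> / 64)"
      using \<delta> by (simp add: power2_eq_square)
    also have "\<dots> \<le> real m * (\<delta> / 64)"
      using \<delta> by (intro mult_right_mono m_ge) auto
    finally show "exp (- real m * (1 * (\<delta> / 32) - 1\<^sup>2 * (\<delta> / 64))) \<le> exp (- (512 * entropy / \<delta>))"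
      by simp
  qed auto
  also have "\<dots> = 2 * exp (- (484 * entropy / \<delta>))"
    by (simp add: exp_add[symmetric] diff_divide_distrib[symmetric])
  also have "\<dots> \<le> 2 * exp (- (484 * entropy))"
    using \<delta> entropy_ge_1 by (simp add: field_simps)
  also have "\<dots> \<le> 2 * (exp (- entropy) / 484)"
    using exp_neg_mult_le[OF entropy_ge_1, of 484] by simp
  also have "\<dots> \<le> exp (- entropy) / 4" by simp
  finally have "measure P ?A \<le> exp (- entropy) / 4" .
  moreover have "(\<Sum>j<m. of_bool (\<bar>sinner n (\<omega> j) t\<bar> \<le> \<delta> / 64)) \<le> real m * (3 * \<delta> / 64)"
    if \<omega>: "\<omega> \<in> space P - ?A" and t: "t \<in> N" for \<omega> t
  proof -
    have "\<not> real m * (\<delta> / 32) \<le> \<bar>(\<Sum>j<m. D t (\<omega> j)) - real m * (\<integral>z. D t z \<partial>M)\<bar>"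
      using \<omega> t by blast
    moreover have "real m * (\<integral>z. D t z \<partial>M) \<le> real m * (\<delta> / 64)"
      using Dint[OF t] by (intro mult_left_mono) auto
    ultimately have "(\<Sum>j<m. D t (\<omega> j)) \<le> real m * (\<delta> / 32) + real m * (\<delta> / 64)"
      by linarith
    also have "real m * (\<delta> / 32) + real m * (\<delta> / 64) = real m * (3 * \<delta> / 64)"
      by (simp add: field_simps)
    finally show ?thesis
      unfolding D_def .
  qed
  ultimately show ?thesis
    using A by blast
qed

text \<open>The exponential moment with parameter \<open>1/4\<close> gives each net point the
  failure probability \<open>exp (m - 4 * m)\<close>, and \<open>m \<ge> 2 ^ 15 * entropy\<close>
  makes this negligible against the size of the net.\<close>

lemma square_failure:
  assumes N: "finite N" "N \<subseteq> sphere_n n" and card: "real (card N) \<le> exp (7 * entropy)"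
  shows "\<exists>A\<in>sets P. measure P A \<le> exp (- entropy) / 4 \<and>
    (\<forall>\<omega>\<in>space P - A. \<forall>t\<in>N. (\<Sum>j<m. (sinner n (\<omega> j) t)\<^sup>2) \<le> 16 * real m)"
proof -
  let ?A = "\<lambda>t. {\<omega> \<in> space P. 16 * real m \<le> (\<Sum>j<m. (sinner n (\<omega> j) t)\<^sup>2)}"
  have Sm: "(\<lambda>z. (sinner n z t)\<^sup>2) \<in> borel_measurable M" for t
    using measurable_sinner[of n t] by measurable
  have A: "?A t \<in> sets P" for t
  proof -
    have "(\<lambda>\<omega>. \<Sum>j<m. (sinner n (\<omega> j) t)\<^sup>2) \<in> borel_measurable P"
    proof (rule borel_measurable_sum)
      fix j assume "j \<in> {..<m}"
      then show "(\<lambda>\<omega>. (sinner n (\<omega> j) t)\<^sup>2) \<in> borel_measurable P"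
        by (rule measurable_sample_coordinate[OF Sm])
    qed
    then show ?thesis by measurable
  qed
  have "measure P (\<Union>t\<in>N. ?A t) \<le> real (card N) * exp (real m * 1 - 1 / 4 * (16 * real m))"
  proof (rule measure_union_bound[OF prob_space_samples N(1) A])
    fix t assume "t \<in> N"
    then have t: "t \<in> sphere_n n" using N by blast
    show "measure P (?A t) \<le> exp (real m * 1 - 1 / 4 * (16 * real m))"
      by (rule iid_chernoff[OF prob_space_gauss_vec Sm exp_square_sinner[OF t]]) simp
  qed
  also have "\<dots> \<le> exp (7 * entropy) * exp (- (3 * real m))"
    using card by (intro mult_mono) auto
  also have "\<dots> \<le> exp (- (484 * entropy))"
    using m_ge(3) entropy_ge_1 by (simp add: exp_add[symmetric])
  also have "\<dots> \<le> exp (- entropy) / 484"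
    using exp_neg_mult_le[OF entropy_ge_1, of 484] by simp
  also have "\<dots> \<le> exp (- entropy) / 4" by simp
  finally have "measure P (\<Union>t\<in>N. ?A t) \<le> exp (- entropy) / 4" .
  moreover have "(\<Union>t\<in>N. ?A t) \<in> sets P"
    using N(1) A by (intro sets.finite_UN) auto
  moreover have "(\<Sum>j<m. (sinner n (\<omega> j) t)\<^sup>2) \<le> 16 * real m"
    if "\<omega> \<in> space P - (\<Union>t\<in>N. ?A t)" "t \<in> N" for \<omega> t
  proof -
    have "\<omega> \<in> space P" "\<omega> \<notin> ?A t" using that by auto
    then show ?thesis by (simp add: not_le)
  qed
  ultimately show ?thesis by blast
qed

text \<open>The lower bound on \<open>4 ^ K\<close> brings the last mesh down to order
  \<open>\<delta>^2\<close>; the upper bound, from minimality of \<open>K\<close>, keeps every level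
  within the range of \<open>links_failure\<close> and bounds the last net.\<close>

lemma exists_chain_length: "\<exists>K. 1 / \<delta> \<le> 4 ^ K \<and> 4 ^ K \<le> 4 / \<delta>"
proof -
  define K where "K = (LEAST K. 1 / \<delta> \<le> (4::real) ^ K)"
  have "\<exists>K. 1 / \<delta> \<le> (4::real) ^ K"
    using real_arch_pow[of 4 "1 / \<delta>"] by (auto intro: less_imp_le)
  then have 1: "1 / \<delta> \<le> 4 ^ K"
    unfolding K_def by (rule LeastI_ex)
  have "K \<noteq> 0"
    using 1 \<delta> by (intro notI) simp
  then obtain j where j: "K = Suc j"
    using not0_implies_Suc by blast
  have "\<not> 1 / \<delta> \<le> 4 ^ j"
    using not_less_Least[of j "\<lambda>K. 1 / \<delta> \<le> (4::real) ^ K"] j unfolding K_def by simp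
  then have "4 ^ K \<le> 4 / \<delta>"
    unfolding j by simp
  then show ?thesis using 1 by blast
qed

lemma chaining_nets:
  obtains N :: "nat \<Rightarrow> (nat \<Rightarrow> real) set" where "\<And>k. finite (N k)" "\<And>k. N k \<subseteq> sparse_sphere n s"
    "\<And>k. real (card (N k)) \<le> exp (entropy * (16 + 3 * real k))"
    "\<And>k x. x \<in> sparse_sphere n s \<Longrightarrow> \<exists>t\<in>N k. support n x = support n t \<and> sqdist n x t \<le> (scale k)\<^sup>2"
proof -
  have "\<forall>k. \<exists>N. finite N \<and> N \<subseteq> sparse_sphere n s \<and> real (card N) \<le> exp (entropy * (16 + 3 * real k)) \<and>
    (\<forall>x\<in>sparse_sphere n s. \<exists>t\<in>N. support n x = support n t \<and> sqdist n x t \<le> (scale k)\<^sup>2)"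
  proof
    fix k
    have sc: "0 < scale k" "scale k \<le> 1"
    proof -
      show "0 < scale k" by (simp add: scale_def)
      have "(1 / 16 :: real) ^ k \<le> 1" by (intro power_le_one) auto
      then show "scale k \<le> 1" unfolding scale_def by simp
    qed
    have "exp (entropy * (6 + ln (1 / scale k))) \<le> exp (entropy * (16 + 3 * real k))"
      using ln_inverse_scale_le[of k] entropy_ge_1 by simp
    then show "\<exists>N. finite N \<and> N \<subseteq> sparse_sphere n s \<and> real (card N) \<le> exp (entropy * (16 + 3 * real k)) \<and>
      (\<forall>x\<in>sparse_sphere n s. \<exists>t\<in>N. support n x = support n t \<and> sqdist n x t \<le> (scale k)\<^sup>2)"
      using sparse_net[OF s sc] unfolding sparse_entropy_def[symmetric] by (meson order_trans)
  qed
  from choice[OF this] obtain N where N: "\<forall>k. finite (N k) \<and> N k \<subseteq> sparse_sphere n s \<and>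
      real (card (N k)) \<le> exp (entropy * (16 + 3 * real k)) \<and>
      (\<forall>x\<in>sparse_sphere n s. \<exists>t\<in>N k. support n x = support n t \<and> sqdist n x t \<le> (scale k)\<^sup>2)"
    by blast
  show ?thesis
    by (rule that[of N]) (use N in blast)+
qed

text \<open>The Gaussian statement uses unit factors and the slab threshold
  \<open>\<delta> / 64\<close>, the deterministic implication arbitrary positive factors and
  \<open>\<delta> / 128\<close>. The gap of 2 pays for rescaling normalized rows. The links, slabs
  and squares fail with probability at most \<open>exp (- entropy) / 4\<close> each.\<close>

lemma exists_good_gaussian_event:
  "\<exists>K N N' B. (\<forall>k. finite (N k)) \<and> finite N' \<and> B \<in> sets P \<and> 1 - exp (- entropy) \<le> measure P B \<and>
    (\<forall>\<omega>\<in>B. row_good n m \<delta> K N N' (\<delta> / 64) (\<lambda>_. 1) \<omega>) \<and>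
    (\<forall>r \<theta>. (\<forall>j<m. 0 < r j) \<longrightarrow> row_good n m \<delta> K N N' (\<delta> / 128) r \<theta> \<longrightarrow>
      is_RIP n m (sparse_sphere n s) (\<lambda>x j. sgn1 (sinner n (\<theta> j) x)) \<delta>)"
proof -
  have KS: "sparse_sphere n s \<subseteq> sphere_n n" by (auto simp: sparse_sphere_iff)
  obtain K where K: "1 / \<delta> \<le> 4 ^ K" "4 ^ K \<le> 4 / \<delta>"
    using exists_chain_length by blast
  obtain N where N: "\<And>k. finite (N k)" "\<And>k. N k \<subseteq> sparse_sphere n s"
    and Ncard: "\<And>k. real (card (N k)) \<le> exp (entropy * (16 + 3 * real k))"
    and net: "\<And>k x. x \<in> sparse_sphere n s \<Longrightarrow> \<exists>t\<in>N k. support n x = support n t \<and> sqdist n x t \<le> (scale k)\<^sup>2"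
    using chaining_nets by blast
  have NS: "N k \<subseteq> sphere_n n" for k using N(2) KS by blast
  have half: "0 < (1 / 2 :: real)" "(1 / 2 :: real) \<le> 1" by auto
  obtain N' where N': "finite N'" "N' \<subseteq> sparse_sphere n s"
    and N'card: "real (card N') \<le> exp (entropy * (6 + ln (1 / (1 / 2))))"
    and net': "\<And>x. x \<in> sparse_sphere n s \<Longrightarrow> \<exists>t\<in>N'. support n x = support n t \<and> sqdist n x t \<le> (1 / 2)\<^sup>2"
    using sparse_net[OF s half] unfolding sparse_entropy_def[symmetric] by blast
  have N'7: "real (card N') \<le> exp (7 * entropy)"
  proof -
    have "entropy * (6 + ln (1 / (1 / 2))) \<le> entropy * 7"
      using ln_2_less_1 entropy_ge_1 by (intro mult_left_mono) auto
    then have "exp (entropy * (6 + ln (1 / (1 / 2)))) \<le> exp (7 * entropy)"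
      by (simp add: mult.commute)
    then show ?thesis using N'card by linarith
  qed
  have NK28: "real (card (N K)) \<le> exp (28 * entropy / \<delta>)"
  proof -
    \<comment> \<open>A crude bound on the number of levels is enough here:
      \<open>16 + 3 * K \<le> 16 / \<delta> + 12 / \<delta>\<close>.\<close>
    have "real K \<le> 4 ^ K"
    proof -
      have "K \<le> 4 ^ K" using less_exp[of K] power_mono[of 2 4 K] by simp
      then show ?thesis by (metis of_nat_le_iff of_nat_numeral of_nat_power)
    qed
    then have "real K \<le> 4 / \<delta>" using K by linarith
    moreover have "16 \<le> 16 / \<delta>" using \<delta> by (simp add: field_simps)
    ultimately have "16 + 3 * real K \<le> 28 / \<delta>" by linarith
    then have "entropy * (16 + 3 * real K) \<le> entropy * (28 / \<delta>)"
      using entropy_ge_1 by (intro mult_left_mono) auto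
    then have "exp (entropy * (16 + 3 * real K)) \<le> exp (28 * entropy / \<delta>)"
      by (simp add: mult.commute)
    then show ?thesis using Ncard[of K] by linarith
  qed
  define A1 where "A1 k = {\<omega> \<in> space P. \<exists>D\<in>links n N k. real m * (\<delta> / 8 * (1 / 2) ^ k) \<le> \<bar>(\<Sum>j<m. D (\<omega> j)) - real m * (\<integral>z. D z \<partial>M)\<bar>}" for k
  have A1: "A1 k \<in> sets P" "measure P (A1 k) \<le> exp (- entropy) * (1 / 2) ^ (k + 3)" if "k \<in> {..K}" for k
  proof -
    have "(4::real) ^ k \<le> 4 ^ K" using that by (intro power_increasing) auto
    also have "\<dots> \<le> 16 / \<delta>" using K(2) \<delta> by (simp add: field_simps)
    finally have k: "4 ^ k \<le> 16 / \<delta>" .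
    show "A1 k \<in> sets P" "measure P (A1 k) \<le> exp (- entropy) * (1 / 2) ^ (k + 3)"
      unfolding A1_def by (rule links_failure[where N = N], rule N, rule NS, rule Ncard, rule k)+
  qed
  obtain A2 where A2: "A2 \<in> sets P" "measure P A2 \<le> exp (- entropy) / 4"
    "\<And>\<omega> t. \<omega> \<in> space P - A2 \<Longrightarrow> t \<in> N K \<Longrightarrow> (\<Sum>j<m. of_bool (\<bar>sinner n (\<omega> j) t\<bar> \<le> \<delta> / 64)) \<le> real m * (3 * \<delta> / 64)"
    using slab_failure[OF N(1) NS NK28] by blast
  have N'S: "N' \<subseteq> sphere_n n" using N'(2) KS by blast
  obtain A3 where A3: "A3 \<in> sets P" "measure P A3 \<le> exp (- entropy) / 4"
    "\<And>\<omega> t. \<omega> \<in> space P - A3 \<Longrightarrow> t \<in> N' \<Longrightarrow> (\<Sum>j<m. (sinner n (\<omega> j) t)\<^sup>2) \<le> 16 * real m"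
    using square_failure[OF N'(1) N'S N'7] by blast
  interpret P: prob_space P by (rule prob_space_samples)
  define A where "A = (\<Union>k\<in>{..K}. A1 k) \<union> (A2 \<union> A3)"
  have A: "A \<in> sets P"
    unfolding A_def using A1(1) A2(1) A3(1) by (intro sets.Un sets.finite_UN) auto
  have "measure P (\<Union>k\<in>{..K}. A1 k) \<le> (\<Sum>k\<in>{..K}. measure P (A1 k))"
    using A1(1) by (intro P.finite_measure_subadditive_finite) auto
  also have "\<dots> \<le> (\<Sum>k\<in>{..K}. exp (- entropy) * (1 / 2) ^ (k + 3))"
    by (intro sum_mono A1(2))
  also have "\<dots> \<le> exp (- entropy) / 4"
  proof -
    have "(\<Sum>k\<in>{..K}. (1 / 2 :: real) ^ (k + 3)) = 1 / 4 - (1 / 2) ^ (K + 3)"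
      by (induction K) (simp_all add: power_add power3_eq_cube power4_eq_xxxx)
    then have "(\<Sum>k\<in>{..K}. (1 / 2 :: real) ^ (k + 3)) \<le> 1 / 4" by simp
    then show ?thesis
      unfolding sum_distrib_left[symmetric] by (simp add: field_simps)
  qed
  finally have "measure P (\<Union>k\<in>{..K}. A1 k) \<le> exp (- entropy) / 4" .
  moreover have "measure P A \<le> measure P (\<Union>k\<in>{..K}. A1 k) + measure P (A2 \<union> A3)"
    unfolding A_def using A1(1) A2(1) A3(1) by (intro measure_Un_le sets.Un sets.finite_UN) auto
  moreover have "measure P (A2 \<union> A3) \<le> measure P A2 + measure P A3"
    using A2(1) A3(1) by (rule measure_Un_le)
  ultimately have mA: "measure P A \<le> exp (- entropy)"
    using A2(2) A3(2) exp_ge_zero[of "- entropy"] by linarith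
  let ?B = "space P - A"
  have "1 - exp (- entropy) \<le> measure P ?B"
    using mA P.prob_compl[OF A] by simp
  moreover have "?B \<in> sets P" using A by auto
  moreover have "row_good n m \<delta> K N N' (\<delta> / 64) (\<lambda>_. 1) \<omega>" if \<omega>: "\<omega> \<in> ?B" for \<omega>
    unfolding row_good_def mult_1
  proof (intro conjI ballI)
    fix k D assume k: "k \<in> {..K}" and D: "D \<in> links n N k"
    have "\<omega> \<in> space P" "\<omega> \<notin> A1 k" using \<omega> k unfolding A_def by auto
    then show "\<bar>(\<Sum>j<m. D (\<omega> j)) - real m * (\<integral>z. D z \<partial>M)\<bar> < real m * (\<delta> / 8 * (1 / 2) ^ k)"
      using D unfolding A1_def by (auto simp: not_le)
  next
    fix t assume "t \<in> N K"
    then show "(\<Sum>j<m. of_bool (\<bar>sinner n (\<omega> j) t\<bar> \<le> \<delta> / 64)) \<le> real m * (3 * \<delta> / 64)"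
      using \<omega> unfolding A_def by (intro A2(3)) auto
  next
    fix t assume "t \<in> N'"
    then show "(\<Sum>j<m. (sinner n (\<omega> j) t)\<^sup>2) \<le> 16 * real m"
      using \<omega> unfolding A_def by (intro A3(3)) auto
  qed
  moreover have "is_RIP n m (sparse_sphere n s) (\<lambda>x j. sgn1 (sinner n (\<theta> j) x)) \<delta>"
    if r: "\<forall>j<m. 0 < r j" and g: "row_good n m \<delta> K N N' (\<delta> / 128) r \<theta>" for r \<theta>
  proof (rule sparse_RIP_deterministic[where K = K and N = N and N' = N' and r = r])
    show "m > 0"
      using m_ge(3) entropy_ge_1 by (cases m) auto
  qed (use \<delta> K N(2) N'(2) net net' r g in \<open>auto simp: row_good_def\<close>)
  ultimately show ?thesis
    using N(1) N'(1) by blast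
qed

end

subsection \<open>Passing to the uniform distribution on the sphere\<close>

definition normalize_row :: "nat \<Rightarrow> (nat \<Rightarrow> real) \<Rightarrow> nat \<Rightarrow> real" where
  "normalize_row n g = (\<lambda>i. if i \<le> n then g i / sqrt (\<Sum>l\<le>n. (g l)\<^sup>2) else 0)"

lemma sinner_normalize_row: "sinner n (normalize_row n g) x = sinner n g x / sqrt (\<Sum>l\<le>n. (g l)\<^sup>2)"
  by (simp add: sinner_def normalize_row_def sum_divide_distrib)

lemma sinner_eq_0_of_norm_0:
  assumes "(\<Sum>l\<le>n. (g l)\<^sup>2) = 0" shows "sinner n g x = 0"
proof -
  have "\<forall>l\<in>{..n}. (g l)\<^sup>2 = 0"
    using assms by (subst (asm) sum_nonneg_eq_0_iff) auto
  then show ?thesis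
    unfolding sinner_def by (intro sum.neutral) auto
qed

text \<open>Positive scaling keeps signs. A zero row is divided by zero and stays zero, so the
  identity holds everywhere and not just almost surely.\<close>

lemma crossing_normalize_row: "crossing n x y (normalize_row n g) = crossing n x y g"
proof (cases "(\<Sum>l\<le>n. (g l)\<^sup>2) = 0")
  case True
  then show ?thesis
    by (simp add: crossing_def crosses_def sinner_normalize_row sinner_eq_0_of_norm_0)
next
  case False
  then have "0 < (\<Sum>l\<le>n. (g l)\<^sup>2)"
    using sum_nonneg[of "{..n}" "\<lambda>l. (g l)\<^sup>2"] by (simp add: less_le)
  then have "sgn1 (sinner n (normalize_row n g) x) = sgn1 (sinner n g x)" for x
    unfolding sinner_normalize_row by (simp add: sgn1_def zero_le_divide_iff not_le)
  then show ?thesis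
    by (simp add: crossing_def crosses_def)
qed

lemma links_normalize_row: "D \<in> links n N k \<Longrightarrow> D (normalize_row n g) = D g"
  by (cases k) (auto simp: crossing_normalize_row)

text \<open>Any rational between half the norm of the row and the norm works, by density. For a zero
  row all products vanish and \<open>q = 1\<close> will do.\<close>

lemma rational_rescaling:
  "\<exists>q\<in>\<rat>. 0 < q \<and> (\<forall>x. \<bar>q * sinner n (normalize_row n g) x\<bar> \<le> \<bar>sinner n g x\<bar> \<and>
    \<bar>sinner n g x\<bar> \<le> 2 * \<bar>q * sinner n (normalize_row n g) x\<bar>)"
proof (cases "(\<Sum>l\<le>n. (g l)\<^sup>2) = 0")
  case True
  then show ?thesis
    by (intro bexI[of _ 1]) (auto simp: sinner_normalize_row sinner_eq_0_of_norm_0)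
next
  case False
  define \<rho> where "\<rho> = sqrt (\<Sum>l\<le>n. (g l)\<^sup>2)"
  have \<rho>: "\<rho> > 0"
    using False sum_nonneg[of "{..n}" "\<lambda>l. (g l)\<^sup>2"] by (simp add: \<rho>_def less_le)
  obtain q where q: "q \<in> \<rat>" "\<rho> / 2 < q" "q < \<rho>"
    using Rats_dense_in_real[of "\<rho> / 2" \<rho>] \<rho> by auto
  have q0: "0 < q" using q \<rho> by simp
  have "\<bar>q * (a / \<rho>)\<bar> \<le> \<bar>a\<bar>" "\<bar>a\<bar> \<le> 2 * \<bar>q * (a / \<rho>)\<bar>" for a
  proof -
    have e: "\<bar>q * (a / \<rho>)\<bar> = q / \<rho> * \<bar>a\<bar>"
      using q0 \<rho> by (simp add: abs_mult)
    have "q / \<rho> \<le> 1" "1 \<le> 2 * (q / \<rho>)"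
      using q \<rho> by (auto simp: field_simps)
    then have "q / \<rho> * \<bar>a\<bar> \<le> 1 * \<bar>a\<bar>" "1 * \<bar>a\<bar> \<le> 2 * (q / \<rho>) * \<bar>a\<bar>"
      by (intro mult_right_mono; simp)+
    then show "\<bar>q * (a / \<rho>)\<bar> \<le> \<bar>a\<bar>" "\<bar>a\<bar> \<le> 2 * \<bar>q * (a / \<rho>)\<bar>"
      unfolding e by simp_all
  qed
  then show ?thesis
    using q(1) q0 unfolding sinner_normalize_row \<rho>_def[symmetric] by blast
qed

lemma measurable_normalize_row: "normalize_row n \<in> gauss_vec (Suc n) \<rightarrow>\<^sub>M PiM UNIV (\<lambda>_. borel)"
proof (rule measurable_PiM_single')
  fix i :: nat
  have c: "(\<lambda>g. g l) \<in> borel_measurable (gauss_vec (Suc n))" if "l \<le> n" for l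
    using that by (simp add: gauss_vec_def)
  show "(\<lambda>g. normalize_row n g i) \<in> borel_measurable (gauss_vec (Suc n))"
  proof (cases "i \<le> n")
    case True
    then show ?thesis
      unfolding normalize_row_def
      by (auto intro!: borel_measurable_divide c borel_measurable_sum borel_measurable_power
          measurable_compose[OF _ borel_measurable_sqrt])
  qed (simp add: normalize_row_def)
qed (auto simp: space_PiM)

lemma unif_sphere_eq: "unif_sphere n = distr (gauss_vec (Suc n)) (PiM UNIV (\<lambda>_. borel)) (normalize_row n)"
  unfolding unif_sphere_def normalize_row_def[abs_def] ..

lemma sets_unif_sphere: "sets (unif_sphere n) = sets (PiM UNIV (\<lambda>_. borel))"
  by (simp add: unif_sphere_eq)

lemma prob_space_unif_sphere: "prob_space (unif_sphere n)"
  unfolding unif_sphere_eq by (intro gauss_vec.prob_space_distr measurable_normalize_row)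

lemma measurable_sinner_unif: "(\<lambda>z. sinner n z x) \<in> borel_measurable (unif_sphere n)"
  unfolding sinner_def unif_sphere_eq by simp

lemma measurable_crossing_unif: "crossing n x y \<in> borel_measurable (unif_sphere n)"
proof -
  have m: "(\<lambda>z. sgn1 (sinner n z x)) \<in> borel_measurable (unif_sphere n)" for x
    by (rule measurable_compose[OF measurable_sinner_unif measurable_sgn1])
  have "{z \<in> space (unif_sphere n). crosses n x y z} \<in> sets (unif_sphere n)"
    unfolding crosses_def by (rule borel_measurable_neq[OF m m])
  then have "Measurable.pred (unif_sphere n) (crosses n x y)"
    unfolding pred_def .
  then show ?thesis
    unfolding crossing_def[abs_def] by measurable
qed

lemma measurable_links_unif: "D \<in> links n N k \<Longrightarrow> D \<in> borel_measurable (unif_sphere n)"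
  by (cases k) (auto intro!: borel_measurable_diff measurable_crossing_unif)

lemma measurable_row:
  assumes "f \<in> borel_measurable (unif_sphere n)" "j \<in> {..<m}"
  shows "(\<lambda>\<theta>. f (\<theta> j)) \<in> borel_measurable (iid_sphere n m)"
  unfolding iid_sphere_def using assms by (intro measurable_compose[OF measurable_component_singleton])

lemma measurable_normalize_row': "normalize_row n \<in> gauss_vec (Suc n) \<rightarrow>\<^sub>M unif_sphere n"
  using measurable_normalize_row measurable_cong_sets[OF refl sets_unif_sphere] by blast

text \<open>A product of image measures is the image of the product under the coordinatewise map;
  \<open>compose\<close> restricts it to the index set, as the extensional functions of
  \<open>PiM\<close> require.\<close>

lemma iid_sphere_eq:
  "iid_sphere n m = distr (PiM {..<m} (\<lambda>_. gauss_vec (Suc n))) (PiM {..<m} (\<lambda>_. unif_sphere n)) (compose {..<m} (normalize_row n))"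
proof -
  have "distr (gauss_vec (Suc n)) (unif_sphere n) (normalize_row n) = unif_sphere n"
    unfolding unif_sphere_eq[of n] by (rule distr_cong) auto
  then show ?thesis
    unfolding iid_sphere_def
    by (subst distr_PiM_finite_prob_space')
      (auto simp: prob_space_gauss_vec prob_space_unif_sphere measurable_normalize_row')
qed

lemma measurable_compose_normalize:
  "compose {..<m} (normalize_row n) \<in> PiM {..<m} (\<lambda>_. gauss_vec (Suc n)) \<rightarrow>\<^sub>M PiM {..<m} (\<lambda>_. unif_sphere n)"
  unfolding compose_def
proof (rule measurable_restrict)
  fix j assume "j \<in> {..<m}"
  from measurable_component_singleton[OF this]
  show "(\<lambda>\<omega>. normalize_row n (\<omega> j)) \<in> PiM {..<m} (\<lambda>_. gauss_vec (Suc n)) \<rightarrow>\<^sub>M unif_sphere n"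
    by (rule measurable_compose) (rule measurable_normalize_row')
qed

text \<open>The RIP quantifies over uncountably many vectors, whereas \<open>row_good\<close> is a
  conjunction over finite nets of conditions on measurable sums.\<close>

lemma row_good_measurable:
  assumes N: "\<And>k. finite (N k)" "finite N'"
  shows "{\<theta> \<in> space (iid_sphere n m). row_good n m \<delta> K N N' \<tau> r \<theta>} \<in> sets (iid_sphere n m)"
proof -
  let ?I = "iid_sphere n m"
  have L: "(\<lambda>\<theta>. \<Sum>j<m. D (\<theta> j)) \<in> borel_measurable ?I" if "D \<in> links n N k" for D k
    using measurable_links_unif[OF that] by (intro borel_measurable_sum measurable_row)
  have q: "(\<lambda>z. r j * sinner n z t) \<in> borel_measurable (unif_sphere n)" for j t
    by (intro borel_measurable_times borel_measurable_const measurable_sinner_unif)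
  have sq: "(\<lambda>\<theta>. \<Sum>j<m. (r j * sinner n (\<theta> j) t)\<^sup>2) \<in> borel_measurable ?I" for t
  proof (rule borel_measurable_sum)
    fix j assume j: "j \<in> {..<m}"
    have "(\<lambda>z. (r j * sinner n z t)\<^sup>2) \<in> borel_measurable (unif_sphere n)"
      using q by (rule borel_measurable_power)
    from measurable_row[OF this j]
    show "(\<lambda>\<theta>. (r j * sinner n (\<theta> j) t)\<^sup>2) \<in> borel_measurable ?I" .
  qed
  have sl: "(\<lambda>\<theta>. \<Sum>j<m. of_bool (\<bar>r j * sinner n (\<theta> j) t\<bar> \<le> \<tau>) :: real) \<in> borel_measurable ?I" for t
  proof (rule borel_measurable_sum)
    fix j assume j: "j \<in> {..<m}"
    have "(\<lambda>z. of_bool (\<bar>r j * sinner n z t\<bar> \<le> \<tau>) :: real) \<in> borel_measurable (unif_sphere n)"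
      using q[of j t] by measurable
    from measurable_row[OF this j]
    show "(\<lambda>\<theta>. of_bool (\<bar>r j * sinner n (\<theta> j) t\<bar> \<le> \<tau>) :: real) \<in> borel_measurable ?I" .
  qed
  show ?thesis
    unfolding row_good_def
  proof (intro sets.sets_Collect_conj sets.sets_Collect_finite_All finite_links N finite_atMost)
    fix k D assume "D \<in> links n N k"
    then show "{\<theta> \<in> space ?I. \<bar>(\<Sum>j<m. D (\<theta> j)) - real m * (\<integral>z. D z \<partial>gauss_vec (Suc n))\<bar> < real m * (\<delta> / 8 * (1 / 2) ^ k)} \<in> sets ?I"
      using L by measurable
  next
    fix t
    show "{\<theta> \<in> space ?I. (\<Sum>j<m. of_bool (\<bar>r j * sinner n (\<theta> j) t\<bar> \<le> \<tau>)) \<le> real m * (3 * \<delta> / 64)} \<in> sets ?I"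
      using sl[of t] by measurable
    show "{\<theta> \<in> space ?I. (\<Sum>j<m. (r j * sinner n (\<theta> j) t)\<^sup>2) \<le> 16 * real m} \<in> sets ?I"
      using sq[of t] by measurable
  qed
qed

text \<open>The norms of the Gaussian rows are lost after normalization. A union over countably many
  rational rescalings recovers them up to a factor two and keeps the event measurable.\<close>

lemma sparse_RIP_probability:
  fixes \<delta> :: real
  assumes s: "1 \<le> s" "s \<le> n + 1" and \<delta>: "0 < \<delta>" "\<delta> < 1"
    and m: "real m \<ge> 2 ^ 15 * \<delta> powr (-2) * real s * log_plus (real n / real s)"
  shows "\<exists>A \<in> sets (iid_sphere n m).
    A \<subseteq> {\<theta> \<in> space (iid_sphere n m). is_RIP n m (sparse_sphere n s) (\<lambda>x j. sgn1 (sinner n (\<theta> j) x)) \<delta>} \<and>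
    measure (iid_sphere n m) A \<ge> 1 - exp (- (real s * log_plus (real n / real s)))"
proof -
  let ?I = "iid_sphere n m"
  let ?P = "PiM {..<m} (\<lambda>_. gauss_vec (Suc n))"
  obtain K N N' B where N: "\<And>k. finite (N k)" "finite N'" and B: "B \<in> sets ?P"
    and mB: "1 - exp (- sparse_entropy n s) \<le> measure ?P B"
    and good: "\<And>\<omega>. \<omega> \<in> B \<Longrightarrow> row_good n m \<delta> K N N' (\<delta> / 64) (\<lambda>_. 1) \<omega>"
    and RIP: "\<And>r \<theta>. (\<forall>j<m. 0 < r j) \<Longrightarrow> row_good n m \<delta> K N N' (\<delta> / 128) r \<theta> \<Longrightarrow>
      is_RIP n m (sparse_sphere n s) (\<lambda>x j. sgn1 (sinner n (\<theta> j) x)) \<delta>"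
    using exists_good_gaussian_event[OF s \<delta> m] by blast
  define R where "R = {..<m} \<rightarrow>\<^sub>E {q :: real. q \<in> \<rat> \<and> 0 < q}"
  define G where "G r = {\<theta> \<in> space ?I. row_good n m \<delta> K N N' (\<delta> / 128) r \<theta>}" for r
  have "countable {q :: real. q \<in> \<rat> \<and> 0 < q}"
    by (rule countable_subset[OF _ countable_rat]) auto
  then have R: "countable R"
    unfolding R_def by (intro countable_PiE) auto
  define A where "A = (\<Union>r\<in>R. G r)"
  have A: "A \<in> sets ?I"
    unfolding A_def G_def by (intro sets.countable_UN' R) (auto intro!: row_good_measurable N)
  have sub: "A \<subseteq> {\<theta> \<in> space ?I. is_RIP n m (sparse_sphere n s) (\<lambda>x j. sgn1 (sinner n (\<theta> j) x)) \<delta>}"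
  proof
    fix \<theta> assume "\<theta> \<in> A"
    then obtain r where r: "r \<in> R" "\<theta> \<in> space ?I" "row_good n m \<delta> K N N' (\<delta> / 128) r \<theta>"
      unfolding A_def G_def by blast
    have "\<forall>j<m. 0 < r j" using r(1) by (auto simp: R_def PiE_iff)
    then show "\<theta> \<in> {\<theta> \<in> space ?I. is_RIP n m (sparse_sphere n s) (\<lambda>x j. sgn1 (sinner n (\<theta> j) x)) \<delta>}"
      using RIP[OF _ r(3)] r(2) by blast
  qed
  let ?T = "compose {..<m} (normalize_row n)"
  \<comment> \<open>A good Gaussian sample is sent into \<open>A\<close>: the rational factors
    chosen row by row for this sample are an admissible index \<open>r\<close> of the union.\<close>
  have BA: "B \<subseteq> ?T -` A \<inter> space ?P"
  proof
    fix \<omega> assume \<omega>: "\<omega> \<in> B"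
    have \<omega>P: "\<omega> \<in> space ?P" using sets.sets_into_space[OF B] \<omega> by blast
    have Tj: "?T \<omega> j = normalize_row n (\<omega> j)" if "j < m" for j
      using that by (simp add: compose_def)
    have "\<forall>j. \<exists>q. q \<in> \<rat> \<and> 0 < q \<and> (\<forall>x. \<bar>q * sinner n (normalize_row n (\<omega> j)) x\<bar> \<le> \<bar>sinner n (\<omega> j) x\<bar> \<and>
        \<bar>sinner n (\<omega> j) x\<bar> \<le> 2 * \<bar>q * sinner n (normalize_row n (\<omega> j)) x\<bar>)"
      using rational_rescaling[of n] by blast
    from choice[OF this] obtain q where q: "\<And>j. q j \<in> \<rat>" "\<And>j. 0 < q j"
      and q1: "\<And>j x. \<bar>q j * sinner n (normalize_row n (\<omega> j)) x\<bar> \<le> \<bar>sinner n (\<omega> j) x\<bar>"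
      and q2: "\<And>j x. \<bar>sinner n (\<omega> j) x\<bar> \<le> 2 * \<bar>q j * sinner n (normalize_row n (\<omega> j)) x\<bar>"
      by blast
    define r where "r = restrict q {..<m}"
    have rj: "r j = q j" if "j < m" for j using that by (simp add: r_def)
    have rR: "r \<in> R" using q by (auto simp: R_def r_def)
    have "row_good n m \<delta> K N N' (\<delta> / 128) r (?T \<omega>)"
      unfolding row_good_def
    proof (intro conjI ballI)
      fix k D assume k: "k \<in> {..K}" and D: "D \<in> links n N k"
      have "(\<Sum>j<m. D (?T \<omega> j)) = (\<Sum>j<m. D (\<omega> j))"
        by (intro sum.cong refl) (simp add: Tj links_normalize_row[OF D])
      then show "\<bar>(\<Sum>j<m. D (?T \<omega> j)) - real m * (\<integral>z. D z \<partial>gauss_vec (Suc n))\<bar> < real m * (\<delta> / 8 * (1 / 2) ^ k)"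
        using good[OF \<omega>] k D unfolding row_good_def by simp
    next
      fix t assume t: "t \<in> N K"
      \<comment> \<open>A rescaled product of at most \<open>\<delta> / 128\<close> forces the
        Gaussian one to be at most twice that, inside the larger slab.\<close>
      have "(\<Sum>j<m. of_bool (\<bar>r j * sinner n (?T \<omega> j) t\<bar> \<le> \<delta> / 128) :: real)
          \<le> (\<Sum>j<m. of_bool (\<bar>1 * sinner n (\<omega> j) t\<bar> \<le> \<delta> / 64))"
      proof (rule sum_mono)
        fix j assume "j \<in> {..<m}"
        then show "(of_bool (\<bar>r j * sinner n (?T \<omega> j) t\<bar> \<le> \<delta> / 128) :: real) \<le> of_bool (\<bar>1 * sinner n (\<omega> j) t\<bar> \<le> \<delta> / 64)"
          using q2[of j t] by (auto simp: rj Tj)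
      qed
      also have "\<dots> \<le> real m * (3 * \<delta> / 64)"
        using good[OF \<omega>] t unfolding row_good_def by blast
      finally show "(\<Sum>j<m. of_bool (\<bar>r j * sinner n (?T \<omega> j) t\<bar> \<le> \<delta> / 128)) \<le> real m * (3 * \<delta> / 64)" .
    next
      fix t assume t: "t \<in> N'"
      have "(\<Sum>j<m. (r j * sinner n (?T \<omega> j) t)\<^sup>2) \<le> (\<Sum>j<m. (1 * sinner n (\<omega> j) t)\<^sup>2)"
      proof (rule sum_mono)
        fix j assume "j \<in> {..<m}"
        then show "(r j * sinner n (?T \<omega> j) t)\<^sup>2 \<le> (1 * sinner n (\<omega> j) t)\<^sup>2"
          using q1[of j t] by (simp add: rj Tj abs_le_square_iff)
      qed
      also have "\<dots> \<le> 16 * real m"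
        using good[OF \<omega>] t unfolding row_good_def by blast
      finally show "(\<Sum>j<m. (r j * sinner n (?T \<omega> j) t)\<^sup>2) \<le> 16 * real m" .
    qed
    moreover have "?T \<omega> \<in> space ?I"
      using measurable_space[OF measurable_compose_normalize \<omega>P] by (simp add: iid_sphere_def)
    ultimately have "?T \<omega> \<in> A"
      unfolding A_def G_def using rR by blast
    then show "\<omega> \<in> ?T -` A \<inter> space ?P" using \<omega>P by simp
  qed
  interpret P: prob_space ?P
    by (intro prob_space_PiM prob_space_gauss_vec)
  have A': "A \<in> sets (PiM {..<m} (\<lambda>_. unif_sphere n))"
    using A by (simp add: iid_sphere_def)
  have "measure ?P B \<le> measure ?P (?T -` A \<inter> space ?P)"
    using BA measurable_sets[OF measurable_compose_normalize A'] by (intro P.finite_measure_mono)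
  also have "\<dots> = measure ?I A"
    unfolding iid_sphere_eq by (rule measure_distr[OF measurable_compose_normalize A', symmetric])
  finally have "1 - exp (- (real s * log_plus (real n / real s))) \<le> measure ?I A"
    using mB unfolding sparse_entropy_def by linarith
  then show ?thesis
    using A sub by blast
qed

theorem theorem1p3:
  shows "\<exists>C>0. \<forall>(n::nat) (\<delta>::real). 0 < \<delta> \<and> \<delta> < 1 \<longrightarrow>
    (\<forall>K m. K \<subseteq> sphere_n n \<and> real m \<ge> C * \<delta> powr (-2) * (hemi_width n K)\<^sup>2 \<longrightarrow>
        (\<exists>\<phi>. is_RIP n m K \<phi> \<delta>)) \<and>
    (\<forall>(s::nat) (m::nat). 1 \<le> s \<and> s \<le> n + 1 \<and>
        real m \<ge> C * \<delta> powr (-2) * real s * log_plus (real n / real s) \<longrightarrow>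
        (\<exists>A \<in> sets (iid_sphere n m).
           A \<subseteq> {\<theta> \<in> space (iid_sphere n m).
                  is_RIP n m (sparse_sphere n s) (\<lambda>x j. sgn1 (sinner n (\<theta> j) x)) \<delta>} \<and>
           measure (iid_sphere n m) A \<ge> 1 - exp (- (real s * log_plus (real n / real s)))))"
\<comment> \<open>The constant required by the sparse part; it exceeds the \<open>2 ^ 14\<close>
  required for general sets.\<close>
proof (intro exI[of _ "2 ^ 15"] conjI allI impI)
  show "(0::real) < 2 ^ 15" by simp
next
  fix n :: nat and \<delta> :: real and K m
  assume \<delta>: "0 < \<delta> \<and> \<delta> < 1"
    and "K \<subseteq> sphere_n n \<and> real m \<ge> 2 ^ 15 * \<delta> powr (-2) * (hemi_width n K)\<^sup>2"
  moreover have "2 ^ 14 * (\<delta> powr (-2) * (hemi_width n K)\<^sup>2) \<le> 2 ^ 15 * (\<delta> powr (-2) * (hemi_width n K)\<^sup>2)"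
    by (intro mult_right_mono) auto
  ultimately show "\<exists>\<phi>. is_RIP n m K \<phi> \<delta>"
    by (intro exists_RIP_general) (auto simp: mult.assoc)
next
  fix n s m :: nat and \<delta> :: real
  assume "0 < \<delta> \<and> \<delta> < 1" and "1 \<le> s \<and> s \<le> n + 1 \<and> real m \<ge> 2 ^ 15 * \<delta> powr (-2) * real s * log_plus (real n / real s)"
  then show "\<exists>A \<in> sets (iid_sphere n m).
      A \<subseteq> {\<theta> \<in> space (iid_sphere n m). is_RIP n m (sparse_sphere n s) (\<lambda>x j. sgn1 (sinner n (\<theta> j) x)) \<delta>} \<and>
      measure (iid_sphere n m) A \<ge> 1 - exp (- (real s * log_plus (real n / real s)))"
    by (intro sparse_RIP_probability) auto
qed

end
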